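(* Let $u$ be the solution map of the affine parametric elliptic problem described in the context. Assume that $\rho=(\rho_j)_{j\ge1}$ is a sequence of positive numbers such that, for some $\widetilde r>0$, $$\sum_{j\ge1}\rho_j|\psi_j(x)|\le\overline a(x)-\widetilde r,\qquad x\in D,$$ with $(\rho_j^{-1})_{j\ge1}\in\ell^q(\mathbb{N})$ for some $0<q<\infty$ and $\rho_j>1$ for all $j$. Then there is a constant $C$ independent of $n$ such that for all $n\geq 1$ $$\|u-u_{\Lambda_n}\|_{L^\infty(U,V)}\le Cn^{-s},\qquad s:=\frac1q-\frac12,$$ where $u_{\Lambda_n}:=\sum_{\nu\in\Lambda_n}t_\nu y^\nu$ is the truncated Taylor series, and $\Lambda_n$ is any downward closed set corresponding to the $n$ largest $\kappa_\nu:=b^\nu$, with $b:=(\rho_j^{-1})_{j\ge1}$.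
   Context: Setting: $D\subset\mathbb{R}^k$ is a bounded Lipschitz domain ($k=1,2$ or $3$), $f\in L^2(D)$, $\overline a,\psi_j\in L^\infty(D)$ for $j\ge1$, $V:=H^1_0(D)$, $U:=[-1,1]^{\mathbb{N}}$. For $y=(y_j)_{j\ge1}\in U$, let $a(y):=\overline a+\sum_{j\ge1}y_j\psi_j$ and let $u(y)\in V$ be the weak solution of $-\mathrm{div}(a(y)\nabla u(y))=f$ in $D$ with $u(y)=0$ on $\partial D$, i.e. $\int_D a(y)\nabla u(y)\cdot\nabla v=\int_D fv$ for all $v\in V$ (the displayed inequality in the claim, with $\rho_j>1$, implies $\sum_j|\psi_j|\le\overline a-\widetilde r$, so this is well-posed for all $y\in U$). Inequalities between functions on $D$ are understood almost everywhere. $\mathcal{F}$ is the set of finitely supported sequences $\nu=(\nu_j)_{j\ge1}$ of nonnegative integers, with $\widetilde\nu\le\nu$ iff $\widetilde\nu_j\le\nu_j$ for all $j$. A set $\Lambda\subset\mathcal{F}$ is downward closed if $\nu\in\Lambda$, $\widetilde\nu\le\nu$ imply $\widetilde\nu\in\Lambda$. Notation: $y^\nu:=\prod_{j\ge1}y_j^{\nu_j}$, $b^\nu:=\prod_{j\ge1}b_j^{\nu_j}$, $\nu!:=\prod_{j\ge1}\nu_j!$, and the Taylor coefficients are $t_\nu:=\frac1{\nu!}\partial^\nu u(y=0)\in V$. A set corresponding to the $n$ largest $\kappa_\nu$ is a set $\Lambda\subset\mathcal{F}$ with $\#(\Lambda)=n$ such that $\kappa_\nu\ge\kappa_\mu$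 for all $\nu\in\Lambda$, $\mu\notin\Lambda$. $\|v\|_{L^\infty(U,V)}:=\sup_{y\in U}\|v(y)\|_V$. *)

theory Defs
  imports "HOL-Analysis.Analysis"
begin

text \<open>
  Functions on \<open>D\<close> are total functions on the ambient space whose values outside \<open>D\<close> are
  irrelevant. Elements of the function spaces are represented by individual functions, so that
  equality in the space is equality almost everywhere on \<open>D\<close>, and the norms below are
  seminorms on representatives.
\<close>

definition lipschitz_boundary :: "(real^'k) set \<Rightarrow> bool" where
  "lipschitz_boundary D \<longleftrightarrow>
     (\<forall>x \<in> frontier D. \<exists>r>0. \<exists>e g L. norm e = 1 \<and> L-lipschitz_on {z. z \<bullet> e = 0} g \<and>
        D \<inter> ball x r = {z \<in> ball x r. z \<bullet> e > g (z - (z \<bullet> e) *\<^sub>R e)})"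

definition bounded_lipschitz_domain :: "(real^'k) set \<Rightarrow> bool" where
  "bounded_lipschitz_domain D \<longleftrightarrow>
     open D \<and> connected D \<and> D \<noteq> {} \<and> bounded D \<and> lipschitz_boundary D"

definition L2_space :: "(real^'k) set \<Rightarrow> (real^'k \<Rightarrow> real) set" where
  "L2_space D = {v \<in> borel_measurable (lebesgue_on D). integrable (lebesgue_on D) (\<lambda>x. (v x)\<^sup>2)}"

definition Linf_space :: "(real^'k) set \<Rightarrow> (real^'k \<Rightarrow> real) set" where
  "Linf_space D = {v \<in> borel_measurable (lebesgue_on D). \<exists>B. AE x in lebesgue_on D. \<bar>v x\<bar> \<le> B}"

definition partial_deriv :: "'k \<Rightarrow> (real^'k \<Rightarrow> real) \<Rightarrow> real^'k \<Rightarrow> real" where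
  "partial_deriv i \<phi> x = frechet_derivative \<phi> (at x) (axis i 1)"

primrec C_diff :: "nat \<Rightarrow> (real^'k \<Rightarrow> real) \<Rightarrow> bool" where
  "C_diff 0 \<phi> \<longleftrightarrow> continuous_on UNIV \<phi>"
| "C_diff (Suc m) \<phi> \<longleftrightarrow> (\<forall>x. \<phi> differentiable (at x)) \<and> (\<forall>i. C_diff m (partial_deriv i \<phi>))"

definition test_functions :: "(real^'k) set \<Rightarrow> (real^'k \<Rightarrow> real) set" where
  "test_functions D =
     {\<phi>. (\<forall>m. C_diff m \<phi>) \<and> compact (closure {x. \<phi> x \<noteq> 0}) \<and> closure {x. \<phi> x \<noteq> 0} \<subseteq> D}"

definition has_weak_gradient ::
    "(real^'k) set \<Rightarrow> (real^'k \<Rightarrow> real) \<Rightarrow> (real^'k \<Rightarrow> real^'k) \<Rightarrow> bool" where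
  "has_weak_gradient D v G \<longleftrightarrow>
     (\<forall>i. (\<lambda>x. G x $ i) \<in> L2_space D \<and>
       (\<forall>\<phi> \<in> test_functions D.
          (LINT x|lebesgue_on D. v x * partial_deriv i \<phi> x)
          = - (LINT x|lebesgue_on D. G x $ i * \<phi> x)))"

definition H1_space :: "(real^'k) set \<Rightarrow> (real^'k \<Rightarrow> real) set" where
  "H1_space D = {v \<in> L2_space D. \<exists>G. has_weak_gradient D v G}"

definition weak_grad :: "(real^'k) set \<Rightarrow> (real^'k \<Rightarrow> real) \<Rightarrow> real^'k \<Rightarrow> real^'k" where
  "weak_grad D v = (SOME G. has_weak_gradient D v G)"

definition H1_norm :: "(real^'k) set \<Rightarrow> (real^'k \<Rightarrow> real) \<Rightarrow> ennreal" where
  "H1_norm D v =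
     (if v \<in> H1_space D
      then ennreal (sqrt ((LINT x|lebesgue_on D. (v x)\<^sup>2)
                        + (LINT x|lebesgue_on D. (norm (weak_grad D v x))\<^sup>2)))
      else \<infinity>)"

definition H10_space :: "(real^'k) set \<Rightarrow> (real^'k \<Rightarrow> real) set" where
  "H10_space D = {v \<in> H1_space D.
     \<forall>\<epsilon>>0. \<exists>\<phi> \<in> test_functions D. H1_norm D (\<lambda>x. v x - \<phi> x) < ennreal \<epsilon>}"

definition weak_solution ::
    "(real^'k) set \<Rightarrow> (real^'k \<Rightarrow> real) \<Rightarrow> (real^'k \<Rightarrow> real) \<Rightarrow> (real^'k \<Rightarrow> real) \<Rightarrow> bool" where
  "weak_solution D a f w \<longleftrightarrow> w \<in> H10_space D \<and>
     (\<forall>v \<in> H10_space D.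
        (LINT x|lebesgue_on D. a x * (weak_grad D w x \<bullet> weak_grad D v x))
        = (LINT x|lebesgue_on D. f x * v x))"

text \<open>Sequences indexed by the positive integers are indexed by \<^typ>\<open>nat\<close>, starting at 0.\<close>

definition param_domain :: "(nat \<Rightarrow> real) set" where
  "param_domain = (UNIV \<rightarrow> {-1..1})"

definition affine_coeff ::
    "(real^'k \<Rightarrow> real) \<Rightarrow> (nat \<Rightarrow> real^'k \<Rightarrow> real) \<Rightarrow> (nat \<Rightarrow> real) \<Rightarrow> real^'k \<Rightarrow> real" where
  "affine_coeff abar \<psi> y x = abar x + (\<Sum>j. y j * \<psi> j x)"

definition multi_indices :: "(nat \<Rightarrow> nat) set" where
  "multi_indices = {\<nu>. finite {j. \<nu> j \<noteq> 0}}"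

definition downward_closed :: "(nat \<Rightarrow> nat) set \<Rightarrow> bool" where
  "downward_closed \<Lambda> \<longleftrightarrow> \<Lambda> \<subseteq> multi_indices \<and>
     (\<forall>\<nu> \<in> \<Lambda>. \<forall>\<nu>' \<in> multi_indices. \<nu>' \<le> \<nu> \<longrightarrow> \<nu>' \<in> \<Lambda>)"

definition multi_power :: "(nat \<Rightarrow> real) \<Rightarrow> (nat \<Rightarrow> nat) \<Rightarrow> real" where
  "multi_power y \<nu> = (\<Prod>j | \<nu> j \<noteq> 0. y j ^ \<nu> j)"

definition multi_fact :: "(nat \<Rightarrow> nat) \<Rightarrow> real" where
  "multi_fact \<nu> = (\<Prod>j | \<nu> j \<noteq> 0. fact (\<nu> j))"

definition n_largest :: "((nat \<Rightarrow> nat) \<Rightarrow> real) \<Rightarrow> nat \<Rightarrow> (nat \<Rightarrow> nat) set \<Rightarrow> bool" where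
  "n_largest \<kappa> n \<Lambda> \<longleftrightarrow> \<Lambda> \<subseteq> multi_indices \<and> finite \<Lambda> \<and> card \<Lambda> = n \<and>
     (\<forall>\<nu> \<in> \<Lambda>. \<forall>\<mu> \<in> multi_indices - \<Lambda>. \<kappa> \<mu> \<le> \<kappa> \<nu>)"

text \<open>
  Strong partial derivatives of maps from the parameter domain into \<^const>\<open>H10_space\<close>: the
  difference quotients converge in norm (one-sidedly on the faces of the parameter domain).
\<close>

definition has_param_partial ::
    "(real^'k) set \<Rightarrow> nat \<Rightarrow> ((nat \<Rightarrow> real) \<Rightarrow> real^'k \<Rightarrow> real) \<Rightarrow> (nat \<Rightarrow> real)
      \<Rightarrow> (real^'k \<Rightarrow> real) \<Rightarrow> bool" where
  "has_param_partial D j w y g \<longleftrightarrow> g \<in> H10_space D \<and>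
     ((\<lambda>h. H1_norm D (\<lambda>x. (w (y(j := y j + h)) x - w y x) / h - g x)) \<longlongrightarrow> 0)
       (at 0 within {h. y(j := y j + h) \<in> param_domain})"

definition param_partial ::
    "(real^'k) set \<Rightarrow> nat \<Rightarrow> ((nat \<Rightarrow> real) \<Rightarrow> real^'k \<Rightarrow> real)
      \<Rightarrow> (nat \<Rightarrow> real) \<Rightarrow> real^'k \<Rightarrow> real" where
  "param_partial D j w y = (SOME g. has_param_partial D j w y g)"

definition mixed_partial ::
    "(real^'k) set \<Rightarrow> (nat \<Rightarrow> nat) \<Rightarrow> ((nat \<Rightarrow> real) \<Rightarrow> real^'k \<Rightarrow> real)
      \<Rightarrow> (nat \<Rightarrow> real) \<Rightarrow> real^'k \<Rightarrow> real" where
  "mixed_partial D \<nu> w =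
     foldr (\<lambda>j. param_partial D j ^^ \<nu> j) (sorted_list_of_set {j. \<nu> j \<noteq> 0}) w"

definition taylor_coeff ::
    "(real^'k) set \<Rightarrow> ((nat \<Rightarrow> real) \<Rightarrow> real^'k \<Rightarrow> real) \<Rightarrow> (nat \<Rightarrow> nat) \<Rightarrow> real^'k \<Rightarrow> real" where
  "taylor_coeff D u \<nu> x = mixed_partial D \<nu> u (\<lambda>_. 0) x / multi_fact \<nu>"

definition taylor_truncation ::
    "(real^'k) set \<Rightarrow> ((nat \<Rightarrow> real) \<Rightarrow> real^'k \<Rightarrow> real) \<Rightarrow> (nat \<Rightarrow> nat) set
      \<Rightarrow> (nat \<Rightarrow> real) \<Rightarrow> real^'k \<Rightarrow> real" where
  "taylor_truncation D u \<Lambda> y x = (\<Sum>\<nu>\<in>\<Lambda>. taylor_coeff D u \<nu> x * multi_power y \<nu>)"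

definition sup_H1_norm :: "(real^'k) set \<Rightarrow> ((nat \<Rightarrow> real) \<Rightarrow> real^'k \<Rightarrow> real) \<Rightarrow> ennreal" where
  "sup_H1_norm D w = (SUP y\<in>param_domain. H1_norm D (w y))"

end

theory Submission
  imports Defs "HOL-Library.Function_Algebras" "HOL-Real_Asymp.Real_Asymp"
begin

text \<open>
  Write \<open>t\<^sub>\<nu>\<close> for the Taylor coefficients and \<open>b\<^sub>j = 1 / \<rho>\<^sub>j\<close>. The whole estimate rests on
  one fact: the sequence \<open>\<rho>\<^sup>\<nu> \<parallel>t\<^sub>\<nu>\<parallel>\<close> is square summable (\<open>weighted_l2_summable\<close>).
  Differentiating the weak formulation gives the recursion
  \<open>\<integral> abar \<nabla>t\<^sub>\<nu> \<sqdot> \<nabla>v = - \<Sum>\<^sub>j \<integral> \<psi>\<^sub>j \<nabla>t\<^sub>\<nu>\<^sub>-\<^sub>e\<^sub>j \<sqdot> \<nabla>v\<close>, the sum running over the support of \<open>\<nu>\<close>.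
  Testing with \<open>v = t\<^sub>\<nu>\<close>, using Young's inequality pointwise and summing over all \<open>\<nu>\<close> with
  \<open>|\<nu>| = k\<close>, every \<open>t\<^sub>\<mu>\<close> with \<open>|\<mu>| = k - 1\<close> meets the whole sum \<open>\<Sum>\<^sub>j \<rho>\<^sub>j |\<psi>\<^sub>j|\<close>, which is at
  most \<open>\<delta> abar\<close> for some \<open>\<delta> < 1\<close>. Hence the weighted energies of the levels \<open>|\<nu>| = k\<close> decay
  geometrically (\<open>energy_decay\<close>).

  For \<open>q \<le> 2\<close> the solution is the sum of its Taylor series, so the error is at most the sum
  of \<open>\<parallel>t\<^sub>\<nu>\<parallel> = (\<rho>\<^sup>\<nu> \<parallel>t\<^sub>\<nu>\<parallel>) b\<^sup>\<nu>\<close> over \<open>\<nu> \<notin> \<Lambda>\<close>. By the Cauchy-Schwarz inequality this is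
  bounded by the \<open>\<ell>\<^sup>2\<close> tail of \<open>b\<^sup>\<nu>\<close>, and Stechkin's lemma turns \<open>\<ell>\<^sup>q\<close> summability of \<open>b\<^sup>\<nu>\<close>,
  which follows from that of \<open>b\<close> through the product \<open>\<Prod>\<^sub>j 1 / (1 - b\<^sub>j\<^sup>q)\<close>, into the rate
  \<open>1 / q - 1 / 2\<close>. For \<open>q > 2\<close> the claimed bound grows with \<open>n\<close>; the error is then estimated
  crudely by \<open>\<parallel>u\<parallel>\<close> plus the sum of \<open>\<parallel>t\<^sub>\<nu>\<parallel>\<close> over \<open>\<Lambda>\<close>, whose growth is controlled by
  Cauchy-Schwarz and a Hoelder-type estimate (\<open>l2_le_lq_growth\<close>).

  Convergence of the series is not a matter of cutting off the affine expansion uniformly in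
  \<open>x\<close>: the sum \<open>\<Sum>\<^sub>j |\<psi>\<^sub>j(x)|\<close> need not converge uniformly. Instead \<open>y\<close> is truncated to
  finitely many coordinates: dominated convergence shows that the solution depends
  continuously on the truncation, and for finitely many coordinates the residual of a Taylor
  polynomial of degree \<open>N\<close> involves only the level \<open>|\<nu>| = N\<close>.

  The analytic foundation is a small theory of \<open>H\<^sup>1\<^sub>0\<close> for the representatives by functions
  used in the statement: weak gradients are unique almost everywhere (fundamental lemma of
  the calculus of variations, with explicit smooth bumps), \<open>H\<^sup>1\<^sub>0\<close> is complete, Poincare's
  inequality makes the \<open>L\<^sup>2\<close> norm of the gradient an equivalent norm, and Riesz
  representation solves the equations that define the derivatives of the solution map. These
  solutions are then identified with the iterated strong partial derivatives by an induction
  on the order.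
\<close>

section \<open>Semi-inner products and Riesz representation\<close>

text \<open>
  Functions form a real vector space under pointwise operations. The function spaces below
  are subspaces of it in the sense of \<^const>\<open>subspace\<close>, so that finite sums and linear
  combinations need no separate treatment.
\<close>

instantiation "fun" :: (type, real_vector) real_vector
begin

definition scaleR_fun: "scaleR c f = (\<lambda>x. c *\<^sub>R f x)"

instance
  by standard (auto simp: scaleR_fun plus_fun_def fun_eq_iff algebra_simps)

end

text \<open>
  The first-order condition at a minimum, for the quadratic functions that occur in the
  variational argument for Riesz representation.
\<close>

lemma linear_term_zero:
  fixes b c :: real
  assumes "\<And>t. 0 \<le> t\<^sup>2 * b + 2 * t * c" and "0 \<le> b"
  shows "c = 0"
proof (rule ccontr)
  assume "c \<noteq> 0"
  (* Evaluation at - k: the denominator b + 1 also covers the case b = 0. *)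
  define k where "k = c / (b + 1)"
  have c: "c = k * (b + 1)" using assms(2) by (simp add: k_def)
  have "0 \<le> (- k)\<^sup>2 * b + 2 * (- k) * c"
    by (rule assms)
  also have "\<dots> = - (k\<^sup>2 * (b + 2))"
    by (simp add: c power2_eq_square algebra_simps)
  also have "\<dots> < 0"
    using assms(2) \<open>c \<noteq> 0\<close> c by (auto intro!: mult_pos_pos)
  finally show False by simp
qed

text \<open>
  Forms are bilinear and symmetric on a subspace, because the integrals below behave well
  only on functions that have a weak gradient. Without a sign condition this covers the
  forms with coefficient \<open>\<psi>\<^sub>j\<close>; the semidefinite case, with its seminorm, is the next
  locale. Functions that agree almost everywhere are distinct vectors at distance zero.
\<close>

locale sym_bilinear =
  fixes V :: "'v::real_vector set" and B :: "'v \<Rightarrow> 'v \<Rightarrow> real"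
  assumes sub: "subspace V"
    and add_left: "\<And>x y z. \<lbrakk>x \<in> V; y \<in> V; z \<in> V\<rbrakk> \<Longrightarrow> B (x + y) z = B x z + B y z"
    and scale_left: "\<And>c x z. \<lbrakk>x \<in> V; z \<in> V\<rbrakk> \<Longrightarrow> B (c *\<^sub>R x) z = c * B x z"
    and sym: "\<And>x y. \<lbrakk>x \<in> V; y \<in> V\<rbrakk> \<Longrightarrow> B x y = B y x"
begin

lemma V_intros [intro, simp]:
  "0 \<in> V" "\<lbrakk>x \<in> V; y \<in> V\<rbrakk> \<Longrightarrow> x + y \<in> V" "\<lbrakk>x \<in> V; y \<in> V\<rbrakk> \<Longrightarrow> x - y \<in> V" "x \<in> V \<Longrightarrow> c *\<^sub>R x \<in> V"
  using sub by (auto simp: subspace_0 subspace_add subspace_diff subspace_scale)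

lemma add_right: "\<lbrakk>x \<in> V; y \<in> V; z \<in> V\<rbrakk> \<Longrightarrow> B z (x + y) = B z x + B z y"
  by (simp add: sym[of z] add_left)

lemma scale_right: "\<lbrakk>x \<in> V; z \<in> V\<rbrakk> \<Longrightarrow> B z (c *\<^sub>R x) = c * B z x"
  by (simp add: sym[of z] scale_left)

lemma diff_left: "\<lbrakk>x \<in> V; y \<in> V; z \<in> V\<rbrakk> \<Longrightarrow> B (x - y) z = B x z - B y z"
  using add_left[of x "(-1) *\<^sub>R y" z] scale_left[of y z "-1"] V_intros(4)[of y "-1"] by simp

lemma diff_right: "\<lbrakk>x \<in> V; y \<in> V; z \<in> V\<rbrakk> \<Longrightarrow> B z (x - y) = B z x - B z y"
  by (simp add: sym[of z] diff_left)

lemmas bil = add_left add_right scale_left scale_right diff_left diff_right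

lemma sum_in_V: "(\<And>i. i \<in> I \<Longrightarrow> g i \<in> V) \<Longrightarrow> sum g I \<in> V"
  using subspace_sum[OF sub] by metis

lemma sum_left:
  assumes "\<And>i. i \<in> I \<Longrightarrow> g i \<in> V" and "z \<in> V"
  shows "B (sum g I) z = (\<Sum>i\<in>I. B (g i) z)"
  using assms
proof (induction I rule: infinite_finite_induct)
  case (insert i I)
  then show ?case
    using add_left[of "g i" "sum g I" z] sum_in_V[of I g] by force
qed (use scale_left[of 0 z 0] in auto)

end

locale semi_inner = sym_bilinear +
  assumes nonneg: "\<And>x. x \<in> V \<Longrightarrow> 0 \<le> B x x"
begin

definition nrm :: "'a \<Rightarrow> real" where "nrm x = sqrt (B x x)"

lemma nrm_sq: "x \<in> V \<Longrightarrow> (nrm x)\<^sup>2 = B x x"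
  by (simp add: nrm_def nonneg)

lemma nrm_nonneg [simp]: "x \<in> V \<Longrightarrow> 0 \<le> nrm x"
  by (simp add: nrm_def nonneg)

lemma Cauchy_Schwarz:
  assumes x: "x \<in> V" and y: "y \<in> V"
  shows "\<bar>B x y\<bar> \<le> nrm x * nrm y"
proof -
  have q: "0 \<le> B x x + 2 * t * B x y + t\<^sup>2 * B y y" for t
  proof -
    have "B (x + t *\<^sub>R y) (x + t *\<^sub>R y) = B x x + 2 * t * B x y + t\<^sup>2 * B y y"
      using x y sym[of y x] by (simp add: bil power2_eq_square algebra_simps)
    then show ?thesis using nonneg[of "x + t *\<^sub>R y"] x y by simp
  qed
  have "(B x y)\<^sup>2 \<le> B x x * B y y"
  proof (cases "B y y = 0")
    case True
    have "B x y = 0"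
    proof (rule ccontr)
      assume "B x y \<noteq> 0"
      then show False using q[of "- (B x x + 1) / (2 * B x y)"] True by (simp add: field_simps)
    qed
    then show ?thesis using True by simp
  next
    case False
    then have p: "B y y > 0" using nonneg[OF y] by simp
    have "0 \<le> B y y * (B x x + 2 * (- B x y / B y y) * B x y + (- B x y / B y y)\<^sup>2 * B y y)"
      using q[of "- B x y / B y y"] p by (intro mult_nonneg_nonneg) auto
    also have "\<dots> = B x x * B y y - (B x y)\<^sup>2"
      using p by (simp add: field_simps power2_eq_square)
    finally show ?thesis by simp
  qed
  then have "(B x y)\<^sup>2 \<le> (nrm x * nrm y)\<^sup>2"
    by (simp add: power_mult_distrib nrm_sq x y)
  then show ?thesis
    using x y by (simp add: abs_le_square_iff[symmetric])
qed

lemma nrm_triangle: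
  assumes x: "x \<in> V" and y: "y \<in> V"
  shows "nrm (x + y) \<le> nrm x + nrm y"
proof (rule power2_le_imp_le)
  have "(nrm (x + y))\<^sup>2 = (nrm x)\<^sup>2 + 2 * B x y + (nrm y)\<^sup>2"
    using x y by (simp add: nrm_sq bil sym[of y x])
  also have "\<dots> \<le> (nrm x + nrm y)\<^sup>2"
    using Cauchy_Schwarz[OF x y] by (simp add: power2_sum abs_le_iff)
  finally show "(nrm (x + y))\<^sup>2 \<le> (nrm x + nrm y)\<^sup>2" .
qed (use x y in simp)

lemma nrm_scale: "x \<in> V \<Longrightarrow> nrm (c *\<^sub>R x) = \<bar>c\<bar> * nrm x"
  by (simp add: nrm_def bil real_sqrt_mult flip: mult.assoc)

lemma nrm_0 [simp]: "nrm 0 = 0"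
  using nrm_scale[of 0 0] by simp

lemma nrm_minus_commute: "\<lbrakk>x \<in> V; y \<in> V\<rbrakk> \<Longrightarrow> nrm (x - y) = nrm (y - x)"
  using nrm_scale[of "x - y" "-1"] by simp

lemma nrm_triangle_diff:
  assumes "x \<in> V" "y \<in> V" shows "nrm (x - y) \<le> nrm x + nrm y"
  using nrm_triangle[of x "(-1) *\<^sub>R y"] nrm_scale[of y "-1"] assms V_intros(4)[of y "-1"] by simp

lemma nrm_triangle3:
  assumes "x \<in> V" "y \<in> V" "z \<in> V" shows "nrm (x - z) \<le> nrm (x - y) + nrm (y - z)"
  using nrm_triangle[of "x - y" "y - z"] assms by simp

lemma nrm_triangle_sub:
  assumes "x \<in> V" "y \<in> V" shows "\<bar>nrm x - nrm y\<bar> \<le> nrm (x - y)"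
  using nrm_triangle[of "x - y" y] nrm_triangle[of "y - x" x] nrm_minus_commute[of x y] assms by auto

lemma nrm_sum:
  assumes "\<And>i. i \<in> I \<Longrightarrow> g i \<in> V"
  shows "nrm (sum g I) \<le> (\<Sum>i\<in>I. nrm (g i))"
  using assms
proof (induction I rule: infinite_finite_induct)
  case (insert i I)
  then show ?case
    using nrm_triangle[of "g i" "sum g I"] sum_in_V[of I g] by force
qed auto

text \<open>
  A minimising sequence of \<open>B x x - 2 l x\<close> is Cauchy by the parallelogram law; its limit
  satisfies the first-order condition \<open>B w v = l v\<close>. Completeness is a hypothesis on the
  seminorm, in the form in which it is available for function spaces.
\<close>

lemma riesz_representation:
  assumes complete: "\<And>X. \<lbrakk>\<And>n::nat. X n \<in> V; \<And>e. e > 0 \<Longrightarrow> \<exists>N. \<forall>m\<ge>N. \<forall>n\<ge>N. nrm (X m - X n) < e\<rbrakk>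
            \<Longrightarrow> \<exists>x\<in>V. (\<lambda>n. nrm (X n - x)) \<longlonglongrightarrow> 0"
    and l_add: "\<And>x y. \<lbrakk>x \<in> V; y \<in> V\<rbrakk> \<Longrightarrow> l (x + y) = l x + l y"
    and l_scale: "\<And>c x. x \<in> V \<Longrightarrow> l (c *\<^sub>R x) = c * l x"
    and bounded: "\<And>x. x \<in> V \<Longrightarrow> \<bar>l x\<bar> \<le> C * nrm x"
  shows "\<exists>w\<in>V. \<forall>v\<in>V. B w v = l v"
proof -
  define J where "J x = B x x - 2 * l x" for x
  define I where "I = Inf (J ` V)"
  have Jlow: "- C\<^sup>2 \<le> J x" if "x \<in> V" for x
  proof -
    have "0 \<le> (nrm x - C)\<^sup>2" by simp
    also have "\<dots> = B x x - 2 * (C * nrm x) + C\<^sup>2"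
      using that by (simp add: power2_diff nrm_sq)
    also have "\<dots> \<le> J x + C\<^sup>2"
      using bounded[OF that] by (simp add: J_def abs_le_iff)
    finally show ?thesis by simp
  qed
  have bdd: "bdd_below (J ` V)"
    using Jlow by (intro bdd_belowI2[of _ "- C\<^sup>2"])
  have Ile: "I \<le> J x" if "x \<in> V" for x
    unfolding I_def using bdd that by (rule cINF_lower)
  have "\<exists>x\<in>V. J x < I + 1 / real (Suc n)" for n
  proof -
    have "Inf (J ` V) < I + 1 / real (Suc n)" by (simp add: I_def)
    then show ?thesis using cInf_less_iff[of "J ` V"] bdd sub subspace_0 by blast
  qed
  then obtain X where X: "\<And>n. X n \<in> V" and JX: "\<And>n. J (X n) < I + 1 / real (Suc n)"
    by metis
  have par: "(nrm (x - y))\<^sup>2 \<le> 2 * (J x - I) + 2 * (J y - I)" if "x \<in> V" "y \<in> V" for x y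
  proof -
    have "4 * J ((1/2) *\<^sub>R (x + y)) = B x x + 2 * B x y + B y y - 4 * (l x + l y)"
      using that by (simp add: J_def bil l_scale l_add sym[of y x] algebra_simps)
    moreover have "(nrm (x - y))\<^sup>2 = B x x - 2 * B x y + B y y"
      using that by (simp add: nrm_sq bil sym[of y x])
    moreover have "I \<le> J ((1/2) *\<^sub>R (x + y))" using that by (intro Ile) auto
    ultimately show ?thesis by (simp add: J_def)
  qed
  have "\<exists>w\<in>V. (\<lambda>n. nrm (X n - w)) \<longlonglongrightarrow> 0"
  proof (rule complete[OF X])
    fix e :: real assume "e > 0"
    obtain N :: nat where N: "4 / e\<^sup>2 < real N" using reals_Archimedean2 by blast
    have "nrm (X m - X n) < e" if "m \<ge> N" "n \<ge> N" for m n
    proof (rule power2_less_imp_less)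
      have small: "J (X i) - I < e\<^sup>2 / 4" if "i \<ge> N" for i
      proof -
        have "4 / e\<^sup>2 < real (Suc i)" using N that by linarith
        then have "1 / real (Suc i) < e\<^sup>2 / 4" using \<open>e > 0\<close> by (simp add: field_simps)
        then show ?thesis using JX[of i] by linarith
      qed
      have "(nrm (X m - X n))\<^sup>2 < 2 * (e\<^sup>2 / 4) + 2 * (e\<^sup>2 / 4)"
        using par[OF X[of m] X[of n]] small[OF that(1)] small[OF that(2)] by argo
      then show "(nrm (X m - X n))\<^sup>2 < e\<^sup>2" by simp
    qed (use \<open>e > 0\<close> in auto)
    then show "\<exists>N. \<forall>m\<ge>N. \<forall>n\<ge>N. nrm (X m - X n) < e" by blast
  qed
  then obtain w where w: "w \<in> V" and lim: "(\<lambda>n. nrm (X n - w)) \<longlonglongrightarrow> 0" by blast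
  have "B w v = l v" if v: "v \<in> V" for v
  proof -
    have "(\<lambda>n. B (X n - w) v) \<longlonglongrightarrow> 0"
    proof (rule Lim_null_comparison)
      show "\<forall>\<^sub>F n in sequentially. norm (B (X n - w) v) \<le> nrm (X n - w) * nrm v"
        using Cauchy_Schwarz X w v by auto
      show "(\<lambda>n. nrm (X n - w) * nrm v) \<longlonglongrightarrow> 0"
        using tendsto_mult_left_zero[OF lim] .
    qed
    then have limB: "(\<lambda>n. B (X n) v) \<longlonglongrightarrow> B w v"
      using X w v by (simp add: bil LIM_zero_iff)
    have "0 \<le> t\<^sup>2 * B v v + 2 * t * (B w v - l v)" for t
    proof -
      have ev: "0 \<le> 1 / real (Suc n) + (t\<^sup>2 * B v v + 2 * t * (B (X n) v - l v))" for n
      proof -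
        have "I \<le> J (X n + t *\<^sub>R v)" using X v by (intro Ile) auto
        also have "\<dots> = J (X n) + (t\<^sup>2 * B v v + 2 * t * (B (X n) v - l v))"
          using X v
          by (simp add: J_def bil l_add l_scale sym[of v "X n"] power2_eq_square algebra_simps)
        finally show ?thesis using JX[of n] by linarith
      qed
      have "(\<lambda>n. 1 / real (Suc n) + (t\<^sup>2 * B v v + 2 * t * (B (X n) v - l v)))
              \<longlonglongrightarrow> 0 + (t\<^sup>2 * B v v + 2 * t * (B w v - l v))"
        by (intro tendsto_intros limB lim_inverse_n'[THEN LIMSEQ_Suc])
      then have "0 \<le> 0 + (t\<^sup>2 * B v v + 2 * t * (B w v - l v))"
        by (rule LIMSEQ_le_const) (use ev in blast)
      then show ?thesis by simp
    qed
    then have "B w v - l v = 0"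
      using linear_term_zero nonneg[OF v] by blast
    then show ?thesis by simp
  qed
  then show ?thesis using w by blast
qed

end

section \<open>Square-integrable vector fields\<close>

text \<open>
  The values lie in an arbitrary Euclidean space. Scalar functions, gradients and pairs of a
  function and its gradient are thereby covered by one completeness proof.
\<close>

definition L2v :: "'a measure \<Rightarrow> ('a \<Rightarrow> 'b::euclidean_space) set" where
  "L2v M = {g \<in> borel_measurable M. integrable M (\<lambda>x. (norm (g x))\<^sup>2)}"

definition l2_inner :: "'a measure \<Rightarrow> ('a \<Rightarrow> 'b::euclidean_space) \<Rightarrow> ('a \<Rightarrow> 'b) \<Rightarrow> real" where
  "l2_inner M g h = (LINT x|M. g x \<bullet> h x)"

definition l2_norm :: "'a measure \<Rightarrow> ('a \<Rightarrow> 'b::euclidean_space) \<Rightarrow> real" where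
  "l2_norm M g = sqrt (LINT x|M. (norm (g x))\<^sup>2)"

lemma L2v_measurable [measurable_dest]: "g \<in> L2v M \<Longrightarrow> g \<in> borel_measurable M"
  by (simp add: L2v_def)

lemma L2v_integrable: "g \<in> L2v M \<Longrightarrow> integrable M (\<lambda>x. (norm (g x))\<^sup>2)"
  by (simp add: L2v_def)

lemma L2v_integrable_norm_mult:
  assumes "g \<in> L2v M" and "h \<in> L2v M"
  shows "integrable M (\<lambda>x. norm (g x) * norm (h x))"
proof (rule Bochner_Integration.integrable_bound)
  show "integrable M (\<lambda>x. (norm (g x))\<^sup>2 + (norm (h x))\<^sup>2)"
    by (intro Bochner_Integration.integrable_add L2v_integrable assms)
  show "AE x in M. norm (norm (g x) * norm (h x)) \<le> norm ((norm (g x))\<^sup>2 + (norm (h x))\<^sup>2)"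
  proof (intro AE_I2)
    fix x
    have "norm (g x) * norm (h x) \<le> (norm (g x))\<^sup>2 + (norm (h x))\<^sup>2"
      using sum_squares_bound[of "norm (g x)" "norm (h x)"]
        mult_nonneg_nonneg[OF norm_ge_zero[of "g x"] norm_ge_zero[of "h x"]] by linarith
    then show "norm (norm (g x) * norm (h x)) \<le> norm ((norm (g x))\<^sup>2 + (norm (h x))\<^sup>2)"
      by simp
  qed
qed (use assms in measurable)

lemma L2v_integrable_inner:
  assumes "g \<in> L2v M" and "h \<in> L2v M"
  shows "integrable M (\<lambda>x. g x \<bullet> h x)"
  by (rule Bochner_Integration.integrable_bound[OF L2v_integrable_norm_mult[OF assms]])
     (use assms Cauchy_Schwarz_ineq2 in \<open>auto dest!: L2v_measurable\<close>)

lemma L2v_add: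
  assumes "g \<in> L2v M" and "h \<in> L2v M"
  shows "g + h \<in> L2v M"
proof -
  have "(norm (g x + h x))\<^sup>2 = (norm (g x))\<^sup>2 + 2 * (g x \<bullet> h x) + (norm (h x))\<^sup>2" for x
    by (simp add: power2_norm_eq_inner inner_add inner_commute)
  then have "integrable M (\<lambda>x. (norm ((g + h) x))\<^sup>2)"
    using L2v_integrable[OF assms(1)] L2v_integrable[OF assms(2)] L2v_integrable_inner[OF assms]
    by simp
  moreover have "g + h \<in> borel_measurable M"
    unfolding plus_fun_def using assms by (intro borel_measurable_add L2v_measurable)
  ultimately show ?thesis by (simp add: L2v_def)
qed

lemma L2v_scale:
  assumes "g \<in> L2v M"
  shows "c *\<^sub>R g \<in> L2v M"
proof -
  have "c *\<^sub>R g \<in> borel_measurable M"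
    unfolding scaleR_fun using assms by (auto dest!: L2v_measurable)
  then show ?thesis
    using L2v_integrable[OF assms] by (simp add: L2v_def scaleR_fun power_mult_distrib)
qed

interpretation L2: semi_inner "L2v M :: ('a \<Rightarrow> 'b::euclidean_space) set" "l2_inner M"
  rewrites "semi_inner.nrm (l2_inner M) = l2_norm M" for M :: "'a measure"
proof -
  show si: "semi_inner (L2v M :: ('a \<Rightarrow> 'b) set) (l2_inner M)"
  proof
    show "subspace (L2v M :: ('a \<Rightarrow> 'b) set)"
      by (auto simp: subspace_def L2v_add L2v_scale) (simp add: L2v_def zero_fun_def)
    show "l2_inner M x y = l2_inner M y x" for x y :: "'a \<Rightarrow> 'b"
      by (simp add: l2_inner_def inner_commute)
  qed (auto simp: l2_inner_def plus_fun_def scaleR_fun inner_add_left L2v_integrable_inner)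
  interpret semi_inner "L2v M :: ('a \<Rightarrow> 'b) set" "l2_inner M" by (rule si)
  show "nrm = l2_norm M"
    by (simp add: fun_eq_iff nrm_def l2_norm_def l2_inner_def power2_norm_eq_inner)
qed

lemma l2_norm_power2: "(l2_norm M g)\<^sup>2 = (LINT x|M. (norm (g x))\<^sup>2)"
  by (simp add: l2_norm_def)

lemma l2_norm_ge_0 [simp]: "0 \<le> l2_norm M g"
  by (simp add: l2_norm_def)

lemma L2v_AE_bounded:
  assumes "finite_measure M" "g \<in> borel_measurable M" "AE x in M. norm (g x) \<le> C"
  shows "g \<in> L2v M"
proof -
  interpret finite_measure M by fact
  have "integrable M (\<lambda>x. (norm (g x))\<^sup>2)"
  proof (rule integrable_const_bound[where B = "C\<^sup>2"])
    show "AE x in M. norm ((norm (g x))\<^sup>2) \<le> C\<^sup>2"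
      using assms(3) by eventually_elim (simp add: power_mono)
  qed (use assms in measurable)
  then show ?thesis using assms by (simp add: L2v_def)
qed

lemma L1_le_l2_norm:
  assumes "finite_measure M" and g: "g \<in> L2v M"
  shows "integrable M (\<lambda>x. norm (g x))"
    and "(LINT x|M. norm (g x)) \<le> l2_norm M g * sqrt (measure M (space M))"
proof -
  interpret finite_measure M by fact
  have 1: "(\<lambda>_. 1 :: real) \<in> L2v M"
    by (rule L2v_AE_bounded[where C = 1]) (auto intro: finite_measure_axioms)
  have n: "(\<lambda>x. norm (g x)) \<in> L2v M" using g by (auto simp: L2v_def)
  show "integrable M (\<lambda>x. norm (g x))"
    using L2v_integrable_inner[OF n 1] by simp
  have "\<bar>l2_inner M (\<lambda>x. norm (g x)) (\<lambda>_. 1)\<bar> \<le> l2_norm M (\<lambda>x. norm (g x)) * l2_norm M (\<lambda>_. 1 :: real)"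
    by (rule L2.Cauchy_Schwarz[OF n 1])
  then show "(LINT x|M. norm (g x)) \<le> l2_norm M g * sqrt (measure M (space M))"
    by (simp add: l2_inner_def l2_norm_def)
qed

text \<open>
  The theorem of Riesz and Fischer. On a finite measure space a subsequence with summable
  \<open>L\<^sup>2\<close> increments has summable \<open>L\<^sup>1\<close> increments and so converges almost everywhere; Fatou's
  lemma shows that the pointwise limit is the limit in \<open>L\<^sup>2\<close>.
\<close>

lemma L2v_complete:
  fixes X :: "nat \<Rightarrow> 'a \<Rightarrow> 'b::euclidean_space"
  assumes fin: "finite_measure M" and X: "\<And>n. X n \<in> L2v M"
    and cauchy: "\<And>e. e > 0 \<Longrightarrow> \<exists>N. \<forall>m\<ge>N. \<forall>n\<ge>N. l2_norm M (X m - X n) < e"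
  shows "\<exists>g\<in>L2v M. (\<lambda>n. l2_norm M (X n - g)) \<longlonglongrightarrow> 0"
proof -
  interpret finite_measure M by fact
  have [measurable]: "X n \<in> borel_measurable M" for n using X by (rule L2v_measurable)
  have "\<exists>N. \<forall>m\<ge>N. \<forall>n\<ge>N. l2_norm M (X m - X n) < (1/2)^k" for k :: nat
    by (rule cauchy) simp
  then obtain N where N: "\<And>k m n. \<lbrakk>m \<ge> N k; n \<ge> N k\<rbrakk> \<Longrightarrow> l2_norm M (X m - X n) < (1/2)^k"
    by metis
  (* Sums of the thresholds: a monotone choice of indices that dominates every threshold. *)
  define \<phi> where "\<phi> k = (\<Sum>i\<le>k. N i)" for k
  have \<phi>_ge: "N k \<le> \<phi> i" if "i \<ge> k" for i k
    unfolding \<phi>_def using that by (intro member_le_sum) auto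
  define Y where "Y k = X (\<phi> k)" for k
  have [measurable]: "Y n \<in> borel_measurable M" for n by (simp add: Y_def)
  define c where "c = sqrt (measure M (space M))"
  have Yd: "Y (Suc k) - Y k \<in> L2v M" for k using X by (simp add: Y_def)
  have step: "(\<integral>\<^sup>+x. ennreal (norm (Y (Suc k) x - Y k x)) \<partial>M) \<le> ennreal ((1/2)^k * c)" for k
  proof -
    have "(LINT x|M. norm ((Y (Suc k) - Y k) x)) \<le> l2_norm M (Y (Suc k) - Y k) * c"
      unfolding c_def by (rule L1_le_l2_norm[OF fin Yd])
    also have "\<dots> \<le> (1/2)^k * c"
      using N[OF \<phi>_ge \<phi>_ge, of k "Suc k" k] by (intro mult_right_mono) (auto simp: Y_def c_def intro: less_imp_le)
    finally show ?thesis
      using L1_le_l2_norm(1)[OF fin Yd[of k]]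
      by (subst nn_integral_eq_integral) (auto simp: ennreal_leI)
  qed
  have "(\<integral>\<^sup>+x. (\<Sum>k. ennreal (norm (Y (Suc k) x - Y k x))) \<partial>M)
      = (\<Sum>k. \<integral>\<^sup>+x. ennreal (norm (Y (Suc k) x - Y k x)) \<partial>M)"
    by (intro nn_integral_suminf) measurable
  also have "\<dots> \<le> (\<Sum>k. ennreal ((1/2)^k * c))"
    by (intro suminf_le step) auto
  also have "\<dots> = ennreal (\<Sum>k. (1/2)^k * c)"
    by (intro suminf_ennreal2 summable_mult2 summable_geometric) (auto simp: c_def)
  also have "\<dots> < \<infinity>" by simp
  finally have "AE x in M. (\<Sum>k. ennreal (norm (Y (Suc k) x - Y k x))) \<noteq> \<infinity>"
    by (intro nn_integral_PInf_AE) (simp_all add: less_top)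
  then have conv: "AE x in M. (\<lambda>k. Y k x) \<longlonglongrightarrow> lim (\<lambda>k. Y k x)"
  proof eventually_elim
    case (elim x)
    have "summable (\<lambda>k. norm (Y (Suc k) x - Y k x))"
      using elim by (intro summable_suminf_not_top) auto
    then have "summable (\<lambda>k. Y (Suc k) x - Y k x)" by (rule summable_norm_cancel)
    then have "convergent (\<lambda>k. \<Sum>i<k. Y (Suc i) x - Y i x)" by (rule summable_iff_convergent[THEN iffD1])
    then have "convergent (\<lambda>k. Y k x - Y 0 x)" by (simp add: sum_lessThan_telescope[of "\<lambda>k. Y k x"])
    then have "convergent (\<lambda>k. Y 0 x + (Y k x - Y 0 x))" by (intro convergent_add convergent_const)
    then show ?case by (simp add: convergent_LIMSEQ_iff)
  qed
  define g where "g x = lim (\<lambda>k. Y k x)" for x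
  have [measurable]: "g \<in> borel_measurable M"
    unfolding g_def by (rule borel_measurable_lim_metric) measurable
  have fatou: "(\<integral>\<^sup>+x. ennreal ((norm (X n x - g x))\<^sup>2) \<partial>M) \<le> ennreal (e\<^sup>2)"
    if e: "e \<ge> 0" and close: "\<forall>k\<ge>K. l2_norm M (X n - Y k) \<le> e" for e n K
  proof -
    have "(\<integral>\<^sup>+x. ennreal ((norm (X n x - g x))\<^sup>2) \<partial>M)
        = (\<integral>\<^sup>+x. liminf (\<lambda>k. ennreal ((norm (X n x - Y k x))\<^sup>2)) \<partial>M)"
    proof (rule nn_integral_cong_AE)
      show "AE x in M. ennreal ((norm (X n x - g x))\<^sup>2) = liminf (\<lambda>k. ennreal ((norm (X n x - Y k x))\<^sup>2))"
        using conv
      proof eventually_elim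
        case (elim x)
        then have "(\<lambda>k. ennreal ((norm (X n x - Y k x))\<^sup>2)) \<longlonglongrightarrow> ennreal ((norm (X n x - g x))\<^sup>2)"
          unfolding g_def by (intro tendsto_intros) auto
        from lim_imp_Liminf[OF trivial_limit_sequentially this] show ?case by simp
      qed
    qed
    also have "\<dots> \<le> liminf (\<lambda>k. \<integral>\<^sup>+x. ennreal ((norm (X n x - Y k x))\<^sup>2) \<partial>M)"
      by (intro nn_integral_liminf) measurable
    also have "\<dots> \<le> ennreal (e\<^sup>2)"
    proof (rule Liminf_le)
      show "\<forall>\<^sub>F k in sequentially. (\<integral>\<^sup>+x. ennreal ((norm (X n x - Y k x))\<^sup>2) \<partial>M) \<le> ennreal (e\<^sup>2)"
        using eventually_ge_at_top[of K]
      proof eventually_elim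
        case (elim k)
        have "X n - Y k \<in> L2v M" using X by (simp add: Y_def)
        from L2v_integrable[OF this]
        have "(\<integral>\<^sup>+x. ennreal ((norm (X n x - Y k x))\<^sup>2) \<partial>M) = ennreal ((l2_norm M (X n - Y k))\<^sup>2)"
          unfolding l2_norm_power2 by (subst nn_integral_eq_integral) auto
        also have "\<dots> \<le> ennreal (e\<^sup>2)"
          using close elim e by (intro ennreal_leI power_mono) auto
        finally show ?case .
      qed
    qed auto
    finally show ?thesis .
  qed
  have lim: "X n - g \<in> L2v M \<and> l2_norm M (X n - g) \<le> e"
    if e: "e \<ge> 0" and close: "\<forall>k\<ge>K. l2_norm M (X n - Y k) \<le> e" for e n K
  proof
    note f = fatou[OF that]
    have "integrable M (\<lambda>x. (norm ((X n - g) x))\<^sup>2)"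
      using f by (intro integrableI_bounded) (auto intro: le_less_trans)
    then show m: "X n - g \<in> L2v M"
      unfolding L2v_def by (auto simp: fun_diff_def)
    have "ennreal ((l2_norm M (X n - g))\<^sup>2) \<le> ennreal (e\<^sup>2)"
      using f L2v_integrable[OF m] unfolding l2_norm_power2
      by (subst (asm) nn_integral_eq_integral) auto
    then have "(l2_norm M (X n - g))\<^sup>2 \<le> e\<^sup>2" by (simp add: ennreal_le_iff)
    then show "l2_norm M (X n - g) \<le> e" using e power2_le_imp_le by blast
  qed
  have near: "\<exists>n0. \<forall>n\<ge>n0. X n - g \<in> L2v M \<and> l2_norm M (X n - g) \<le> (1/2)^k" for k
  proof (intro exI[of _ "N k"] allI impI)
    fix n assume "n \<ge> N k"
    then show "X n - g \<in> L2v M \<and> l2_norm M (X n - g) \<le> (1/2)^k"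
      by (intro lim[of _ k]) (auto simp: Y_def intro!: less_imp_le N \<phi>_ge)
  qed
  have "g \<in> L2v M"
  proof -
    obtain n where "X n - g \<in> L2v M" using near[of 0] by blast
    then have "X n - (X n - g) \<in> L2v M" by (rule L2.V_intros(3)[OF X])
    moreover have "X n - (X n - g) = g" by (simp add: fun_eq_iff)
    ultimately show ?thesis by simp
  qed
  moreover have "(\<lambda>n. l2_norm M (X n - g)) \<longlonglongrightarrow> 0"
  proof (rule LIMSEQ_I)
    fix r :: real assume "r > 0"
    then obtain k :: nat where k: "(1/2)^k < r" using real_arch_pow_inv[of r "1/2"] by auto
    obtain n0 where "\<forall>n\<ge>n0. l2_norm M (X n - g) \<le> (1/2)^k" using near[of k] by blast
    then show "\<exists>n0. \<forall>n\<ge>n0. norm (l2_norm M (X n - g) - 0) < r"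
      using k by (intro exI[of _ n0]) (auto intro: le_less_trans)
  qed
  ultimately show ?thesis by blast
qed

section \<open>Smooth cut-off functions\<close>

text \<open>
  One-dimensional smoothness of finite order, phrased by existence of derivatives so that
  closure under sums, products and affine substitution is a direct induction.
\<close>

primrec smooth_upto :: "nat \<Rightarrow> (real \<Rightarrow> real) \<Rightarrow> bool" where
  "smooth_upto 0 h \<longleftrightarrow> continuous_on UNIV h"
| "smooth_upto (Suc m) h \<longleftrightarrow> (\<exists>h'. (\<forall>x. (h has_real_derivative h' x) (at x)) \<and> smooth_upto m h')"

lemma smooth_upto_SucI:
  "\<lbrakk>\<And>x. (h has_real_derivative h' x) (at x); smooth_upto m h'\<rbrakk> \<Longrightarrow> smooth_upto (Suc m) h"
  by auto

lemma smooth_upto_SucD: "smooth_upto (Suc m) h \<Longrightarrow> smooth_upto m h"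
proof (induction m arbitrary: h)
  case 0
  then obtain h' where "\<forall>x. (h has_real_derivative h' x) (at x)" by auto
  then have "\<forall>x. isCont h x" by (blast intro: DERIV_isCont)
  then show ?case by (simp add: continuous_at_imp_continuous_on)
next
  case (Suc m)
  then show ?case by (metis smooth_upto.simps(2))
qed

lemma smooth_upto_const: "smooth_upto m (\<lambda>_. c)"
  by (induction m arbitrary: c) (auto intro!: exI[of _ "\<lambda>_. 0"])

lemma smooth_upto_add:
  "smooth_upto m f \<Longrightarrow> smooth_upto m g \<Longrightarrow> smooth_upto m (\<lambda>x. f x + g x)"
proof (induction m arbitrary: f g)
  case (Suc m)
  then obtain f' g' where "\<forall>x. (f has_real_derivative f' x) (at x)" "smooth_upto m f'"
     "\<forall>x. (g has_real_derivative g' x) (at x)" "smooth_upto m g'" by auto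
  then show ?case using Suc.IH
    by (auto intro!: exI[of _ "\<lambda>x. f' x + g' x"] derivative_intros)
qed (auto intro: continuous_intros)

lemma smooth_upto_mult:
  "smooth_upto m f \<Longrightarrow> smooth_upto m g \<Longrightarrow> smooth_upto m (\<lambda>x. f x * g x)"
proof (induction m arbitrary: f g)
  case (Suc m)
  then obtain f' g' where d: "\<And>x. (f has_real_derivative f' x) (at x)" "smooth_upto m f'"
     "\<And>x. (g has_real_derivative g' x) (at x)" "smooth_upto m g'" by auto
  have "((\<lambda>x. f x * g x) has_real_derivative f' x * g x + f x * g' x) (at x)" for x
    by (rule derivative_eq_intros d refl)+ simp
  moreover have "smooth_upto m (\<lambda>x. f' x * g x + f x * g' x)"
    using Suc d smooth_upto_SucD by (intro smooth_upto_add) blast+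
  ultimately show ?case by (rule smooth_upto_SucI)
qed (auto intro: continuous_intros)

lemma smooth_upto_affine:
  "smooth_upto m f \<Longrightarrow> smooth_upto m (\<lambda>x. f (c * x + d))"
proof (induction m arbitrary: f)
  case 0
  then show ?case
    by (auto intro!: continuous_on_compose2[of UNIV f] continuous_intros)
next
  case (Suc m)
  then obtain f' where d: "\<And>x. (f has_real_derivative f' x) (at x)" "smooth_upto m f'" by auto
  have "((\<lambda>x. f (c * x + d)) has_real_derivative f' (c * x + d) * c) (at x)" for x
    by (rule DERIV_chain2[OF d(1)]) (auto intro!: derivative_eq_intros)
  moreover have "smooth_upto m (\<lambda>x. f' (c * x + d) * c)"
    using Suc.IH[OF d(2)] by (intro smooth_upto_mult smooth_upto_const)
  ultimately show ?case by (rule smooth_upto_SucI)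
qed

text \<open>
  The flat function \<open>exp (- 1 / x)\<close>, multiplied by a power of \<open>1 / x\<close>: including the powers
  makes the family closed under differentiation up to linear combination.
\<close>

definition exp_cutoff :: "nat \<Rightarrow> real \<Rightarrow> real" where
  "exp_cutoff k x = (if x > 0 then inverse x ^ k * exp (- inverse x) else 0)"

lemma exp_cutoff_tendsto_0: "(exp_cutoff k \<longlongrightarrow> 0) (at_right 0)"
proof -
  have "((\<lambda>x. x ^ k / exp x) \<longlongrightarrow> 0) (at_top :: real filter)"
    by (rule tendsto_power_div_exp_0)
  then have "((\<lambda>x. inverse x ^ k / exp (inverse x)) \<longlongrightarrow> (0::real)) (at_right 0)"
    by (rule filterlim_compose) (rule filterlim_inverse_at_top_right)
  then show ?thesis
    by (rule Lim_transform_eventually)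
       (auto simp: eventually_at_filter exp_cutoff_def exp_minus field_simps)
qed

lemma exp_cutoff_deriv:
  "(exp_cutoff k has_real_derivative exp_cutoff (k + 2) x + (- real k) * exp_cutoff (k + 1) x) (at x)"
proof (cases "x = 0")
  case True
  have "((\<lambda>h. exp_cutoff k h / h) \<longlongrightarrow> 0) (at_right 0)"
    by (rule Lim_transform_eventually[OF exp_cutoff_tendsto_0[of "Suc k"]])
       (auto simp: eventually_at_filter exp_cutoff_def field_simps)
  moreover have "((\<lambda>h. exp_cutoff k h / h) \<longlongrightarrow> 0) (at_left 0)"
    by (rule Lim_transform_eventually[OF tendsto_const[of 0]])
       (auto simp: eventually_at_filter exp_cutoff_def)
  ultimately have "((\<lambda>h. exp_cutoff k h / h) \<longlongrightarrow> 0) (at 0)"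
    by (simp add: filterlim_at_split)
  then show ?thesis using True by (simp add: DERIV_def exp_cutoff_def)
next
  case False
  show ?thesis
  proof (cases "x > 0")
    case True
    have "((\<lambda>x. inverse x ^ k * exp (- inverse x)) has_real_derivative
            exp_cutoff (k + 2) x + (- real k) * exp_cutoff (k + 1) x) (at x)"
    proof (rule DERIV_cong)
      show "((\<lambda>x. inverse x ^ k * exp (- inverse x)) has_real_derivative
          real k * (- (inverse x * inverse x)) * inverse x ^ (k - 1) * exp (- inverse x)
          + inverse x ^ k * (exp (- inverse x) * (inverse x * inverse x))) (at x)"
        using True by (auto intro!: derivative_eq_intros)
      show "real k * (- (inverse x * inverse x)) * inverse x ^ (k - 1) * exp (- inverse x)
          + inverse x ^ k * (exp (- inverse x) * (inverse x * inverse x))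
          = exp_cutoff (k + 2) x + (- real k) * exp_cutoff (k + 1) x"
        using True by (cases k) (simp_all add: exp_cutoff_def algebra_simps)
    qed
    then show ?thesis
      by (rule has_field_derivative_transform_within_open[of _ _ _ "{0<..}"])
         (use True in \<open>auto simp: exp_cutoff_def\<close>)
  next
    case False
    have "((\<lambda>x. 0) has_real_derivative
            exp_cutoff (k + 2) x + (- real k) * exp_cutoff (k + 1) x) (at x)"
      using False by (simp add: exp_cutoff_def)
    then show ?thesis
      by (rule has_field_derivative_transform_within_open[of _ _ _ "{..<0}"])
         (use False \<open>x \<noteq> 0\<close> in \<open>auto simp: exp_cutoff_def\<close>)
  qed
qed

lemma smooth_upto_exp_cutoff: "smooth_upto m (exp_cutoff k)"
proof (induction m arbitrary: k)
  case 0
  then show ?case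
    by (auto intro!: DERIV_isCont[OF exp_cutoff_deriv] continuous_at_imp_continuous_on)
next
  case (Suc m)
  have "smooth_upto m (\<lambda>x. exp_cutoff (k + 2) x + (- real k) * exp_cutoff (k + 1) x)"
    by (intro smooth_upto_add smooth_upto_mult smooth_upto_const Suc)
  then show ?case by (rule smooth_upto_SucI[OF exp_cutoff_deriv])
qed

text \<open>
  Products of functions of one coordinate. A partial derivative replaces a single factor by
  its derivative, so smoothness is inherited from the factors.
\<close>

definition tensor :: "('k::finite \<Rightarrow> real \<Rightarrow> real) \<Rightarrow> real^'k \<Rightarrow> real" where
  "tensor h x = (\<Prod>i\<in>UNIV. h i (x $ i))"

lemma tensor_has_derivative:
  assumes "\<And>i x. (h i has_real_derivative h' i x) (at x)"
  shows "(tensor h has_derivative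
           (\<lambda>v. \<Sum>i\<in>UNIV. h' i (x $ i) * v $ i * (\<Prod>j\<in>UNIV - {i}. h j (x $ j)))) (at x)"
  unfolding tensor_def
proof (rule has_derivative_prod)
  fix i
  have "((\<lambda>x. x $ i) has_derivative (\<lambda>v. v $ i)) (at x)"
    by (rule bounded_linear.has_derivative[OF bounded_linear_vec_nth]) (rule has_derivative_ident)
  from has_derivative_compose[OF this assms[of i "x $ i", unfolded has_field_derivative_def]]
  show "((\<lambda>x. h i (x $ i)) has_derivative (\<lambda>v. h' i (x $ i) * v $ i)) (at x)" .
qed

lemma partial_deriv_eq:
  "(g has_derivative g') (at x) \<Longrightarrow> partial_deriv i g x = g' (axis i 1)"
  unfolding partial_deriv_def by (metis frechet_derivative_at)

lemma partial_deriv_tensor: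
  assumes "\<And>i x. (h i has_real_derivative h' i x) (at x)"
  shows "partial_deriv i (tensor h) = tensor (h(i := h' i))"
proof
  fix x
  have "partial_deriv i (tensor h) x
      = (\<Sum>k\<in>UNIV. h' k (x $ k) * axis i 1 $ k * (\<Prod>j\<in>UNIV - {k}. h j (x $ j)))"
    by (rule partial_deriv_eq[OF tensor_has_derivative[OF assms]])
  also have "\<dots> = (\<Sum>k\<in>UNIV. if k = i then h' k (x $ k) * (\<Prod>j\<in>UNIV - {k}. h j (x $ j)) else 0)"
    by (intro sum.cong) (auto simp: axis_def)
  also have "\<dots> = h' i (x $ i) * (\<Prod>j\<in>UNIV - {i}. h j (x $ j))"
    by simp
  also have "\<dots> = tensor (h(i := h' i)) x"
    unfolding tensor_def by (subst prod.remove[of _ i]) auto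
  finally show "partial_deriv i (tensor h) x = tensor (h(i := h' i)) x" .
qed

lemma C_diff_tensor: "(\<And>i. smooth_upto m (h i)) \<Longrightarrow> C_diff m (tensor h)"
proof (induction m arbitrary: h)
  case 0
  have "continuous_on UNIV (\<lambda>x. h i (x $ i))" for i
    by (rule continuous_on_compose2[of UNIV "h i"]) (use 0 in \<open>auto intro!: continuous_intros\<close>)
  then show ?case
    unfolding tensor_def C_diff.simps by (rule continuous_on_prod)
next
  case (Suc m)
  have "\<forall>i. \<exists>h'. (\<forall>x. (h i has_real_derivative h' x) (at x)) \<and> smooth_upto m h'"
    using Suc.prems by simp
  from choice[OF this] obtain h' where h': "\<And>i x. (h i has_real_derivative h' i x) (at x)"
    "\<And>i. smooth_upto m (h' i)"
    by blast
  have "C_diff m (partial_deriv i (tensor h))" for i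
    unfolding partial_deriv_tensor[OF h'(1)]
    using h'(2) smooth_upto_SucD[OF Suc.prems] by (intro Suc.IH) auto
  moreover have "tensor h differentiable (at x)" for x
    unfolding differentiable_def by (rule exI, rule tensor_has_derivative) (rule h'(1))
  ultimately show ?case by simp
qed

section \<open>Test functions\<close>

lemma partial_deriv_linear:
  assumes "f differentiable (at x)" "g differentiable (at x)"
  shows "partial_deriv i (\<lambda>x. a * f x + b * g x) x = a * partial_deriv i f x + b * partial_deriv i g x"
proof -
  have "((\<lambda>x. a * f x + b * g x) has_derivative
      (\<lambda>v. a * frechet_derivative f (at x) v + b * frechet_derivative g (at x) v)) (at x)"
    using assms by (intro derivative_intros) (auto simp: frechet_derivative_works[symmetric])
  from partial_deriv_eq[OF this] show ?thesis by (simp add: partial_deriv_def)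
qed

lemma partial_deriv_mult:
  assumes "f differentiable (at x)" "g differentiable (at x)"
  shows "partial_deriv i (\<lambda>x. f x * g x) x = f x * partial_deriv i g x + partial_deriv i f x * g x"
proof -
  have "((\<lambda>x. f x * g x) has_derivative
      (\<lambda>v. f x * frechet_derivative g (at x) v + frechet_derivative f (at x) v * g x)) (at x)"
    using assms by (intro derivative_intros) (auto simp: frechet_derivative_works[symmetric])
  from partial_deriv_eq[OF this] show ?thesis by (simp add: partial_deriv_def)
qed

lemma C_diff_linear: "C_diff m f \<Longrightarrow> C_diff m g \<Longrightarrow> C_diff m (\<lambda>x. a * f x + b * g x)"
proof (induction m arbitrary: f g)
  case (Suc m)
  have "partial_deriv i (\<lambda>x. a * f x + b * g x) = (\<lambda>x. a * partial_deriv i f x + b * partial_deriv i g x)" for i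
    using Suc.prems by (auto simp: partial_deriv_linear)
  then show ?case using Suc by (auto intro!: derivative_intros)
qed (auto intro!: continuous_intros)

lemma test_functions_linear:
  assumes f: "f \<in> test_functions D" and g: "g \<in> test_functions D"
  shows "(\<lambda>x. a * f x + b * g x) \<in> test_functions D"
proof -
  let ?K = "closure {x. f x \<noteq> 0} \<union> closure {x. g x \<noteq> 0}"
  have sub: "closure {x. a * f x + b * g x \<noteq> 0} \<subseteq> ?K"
    unfolding closure_Un[symmetric] by (rule closure_mono) auto
  moreover have "compact ?K" "?K \<subseteq> D"
    using f g by (auto simp: test_functions_def)
  ultimately have "compact (closure {x. a * f x + b * g x \<noteq> 0})"
    using bounded_subset compact_eq_bounded_closed by blast
  then show ?thesis
    using f g sub \<open>?K \<subseteq> D\<close> unfolding test_functions_def by (auto intro!: C_diff_linear)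
qed

text \<open>
  Smooth approximations from below of the indicator of an open box. The shifts by \<open>1\<close> keep
  the support at distance at least \<open>1 / (n + 1)\<close> from the boundary, so that it is compact
  and contained in the open box.
\<close>

definition box_bump :: "nat \<Rightarrow> real^'k \<Rightarrow> real^'k \<Rightarrow> real^'k \<Rightarrow> real" where
  "box_bump n a b = tensor (\<lambda>i t. exp_cutoff 0 (real (Suc n) * t + (- real (Suc n) * a $ i - 1))
                               * exp_cutoff 0 (- real (Suc n) * t + (real (Suc n) * b $ i - 1)))"

lemma exp_cutoff_0_range: "0 \<le> exp_cutoff 0 t" "exp_cutoff 0 t \<le> 1"
  by (auto simp: exp_cutoff_def)

lemma box_bump_range: "0 \<le> box_bump n a b x" "box_bump n a b x \<le> 1"
  unfolding box_bump_def tensor_def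
  by (auto intro!: prod_nonneg prod_le_1 mult_nonneg_nonneg mult_le_one exp_cutoff_0_range)

lemma box_bump_support:
  assumes "box_bump n a b x \<noteq> 0"
  shows "x \<in> cbox (a + (\<chi> i. 1 / real (Suc n))) (b - (\<chi> i. 1 / real (Suc n)))"
proof -
  have "a $ i + 1 / real (Suc n) \<le> x $ i \<and> x $ i \<le> b $ i - 1 / real (Suc n)" for i
  proof -
    have "exp_cutoff 0 (real (Suc n) * x $ i + (- real (Suc n) * a $ i - 1)) \<noteq> 0"
      "exp_cutoff 0 (- real (Suc n) * x $ i + (real (Suc n) * b $ i - 1)) \<noteq> 0"
      using assms by (auto simp: box_bump_def tensor_def)
    then have "0 < real (Suc n) * x $ i + (- real (Suc n) * a $ i - 1)"
      "0 < - real (Suc n) * x $ i + (real (Suc n) * b $ i - 1)"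
      by (auto simp: exp_cutoff_def split: if_splits)
    then show ?thesis by (simp add: field_simps del: of_nat_Suc)
  qed
  then show ?thesis by (simp add: mem_box_cart)
qed

lemma box_bump_test_function:
  assumes "box a b \<subseteq> D"
  shows "box_bump n a b \<in> test_functions D"
proof -
  let ?K = "cbox (a + (\<chi> i. 1 / real (Suc n))) (b - (\<chi> i. 1 / real (Suc n)))"
  have sub: "closure {x. box_bump n a b x \<noteq> 0} \<subseteq> ?K"
    by (rule closure_minimal) (use box_bump_support in auto)
  have "?K \<subseteq> box a b"
  proof
    fix x assume x: "x \<in> ?K"
    have "a $ i < x $ i \<and> x $ i < b $ i" for i
    proof -
      have "a $ i + 1 / real (Suc n) \<le> x $ i" "x $ i \<le> b $ i - 1 / real (Suc n)"
        using x by (auto simp: mem_box_cart)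
      moreover have "0 < 1 / real (Suc n)" by simp
      ultimately show ?thesis by linarith
    qed
    then show "x \<in> box a b" by (simp add: mem_box_cart)
  qed
  moreover have "compact (closure {x. box_bump n a b x \<noteq> 0})"
    using sub bounded_subset[OF bounded_cbox] by (simp add: compact_eq_bounded_closed)
  moreover have "C_diff m (box_bump n a b)" for m
    unfolding box_bump_def
    by (intro C_diff_tensor smooth_upto_mult smooth_upto_affine smooth_upto_exp_cutoff)
  ultimately show ?thesis using sub assms by (auto simp: test_functions_def)
qed

lemma exp_cutoff_affine_tendsto_1:
  assumes "s > 0"
  shows "(\<lambda>n. exp_cutoff 0 (real (Suc n) * s - 1)) \<longlonglongrightarrow> 1"
proof -
  have lim: "filterlim (\<lambda>n. real (Suc n) * s - 1) at_top sequentially"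
    using assms by real_asymp
  have "(\<lambda>n. exp (- inverse (real (Suc n) * s - 1))) \<longlonglongrightarrow> exp (- 0)"
    by (intro tendsto_intros tendsto_inverse_0_at_top lim)
  then have "(\<lambda>n. exp (- inverse (real (Suc n) * s - 1))) \<longlonglongrightarrow> 1" by simp
  moreover have "\<forall>\<^sub>F n in sequentially. exp (- inverse (real (Suc n) * s - 1))
      = exp_cutoff 0 (real (Suc n) * s - 1)"
    using filterlim_at_top_dense[THEN iffD1, OF lim, rule_format, of 0]
    by eventually_elim (simp add: exp_cutoff_def)
  ultimately show ?thesis by (rule Lim_transform_eventually)
qed

lemma box_bump_tendsto: "(\<lambda>n. box_bump n a b x) \<longlonglongrightarrow> indicator (box a b) x"
proof (cases "x \<in> box a b")
  case True
  have "(\<lambda>n. exp_cutoff 0 (real (Suc n) * x $ i + (- real (Suc n) * a $ i - 1))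
           * exp_cutoff 0 (- real (Suc n) * x $ i + (real (Suc n) * b $ i - 1))) \<longlonglongrightarrow> 1" for i
  proof -
    have "(\<lambda>n. exp_cutoff 0 (real (Suc n) * (x $ i - a $ i) - 1)
           * exp_cutoff 0 (real (Suc n) * (b $ i - x $ i) - 1)) \<longlonglongrightarrow> 1 * 1"
      using True by (intro tendsto_mult exp_cutoff_affine_tendsto_1) (auto simp: mem_box_cart)
    then show ?thesis by (simp add: algebra_simps)
  qed
  then have "(\<lambda>n. box_bump n a b x) \<longlonglongrightarrow> (\<Prod>i\<in>(UNIV :: 'a set). 1)"
    unfolding box_bump_def tensor_def by (rule tendsto_prod)
  then show ?thesis using True by simp
next
  case False
  have "box_bump n a b x = 0" for n
  proof (rule ccontr)
    assume "box_bump n a b x \<noteq> 0"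
    with box_bump_test_function[of a b "box a b" n] closure_subset[of "{x. box_bump n a b x \<noteq> 0}"]
    show False using False by (auto simp: test_functions_def)
  qed
  then show ?thesis using False by simp
qed

lemma test_functions_continuous:
  "\<phi> \<in> test_functions D \<Longrightarrow> continuous_on UNIV \<phi>"
  unfolding test_functions_def using C_diff.simps(1) by blast

lemma test_functions_measurable:
  "\<phi> \<in> test_functions D \<Longrightarrow> \<phi> \<in> borel_measurable borel"
  using test_functions_continuous borel_measurable_continuous_onI by blast

section \<open>The fundamental lemma of the calculus of variations\<close>

text \<open>
  Boxes are stable under intersection and generate the Borel sets, so the integral of \<open>g\<close>
  vanishes over every Borel subset of a box in \<open>U\<close>, in particular over the sets where \<open>g\<close> is
  positive or negative. Countably many boxes cover \<open>U\<close>.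
\<close>

lemma integral_zero_on_boxes_AE_zero:
  fixes g :: "'a::euclidean_space \<Rightarrow> real"
  assumes g: "integrable lebesgue g"
    and zero: "\<And>a b. box a b \<subseteq> U \<Longrightarrow> (LINT x|lebesgue. g x * indicator (box a b) x) = 0"
    and U: "open U"
  shows "AE x in lebesgue. x \<in> U \<longrightarrow> g x = 0"
proof -
  have gm: "g \<in> borel_measurable (completion lborel)" by (rule borel_measurable_integrable[OF g])
  then obtain h where h [measurable]: "h \<in> borel_measurable lborel" and gh: "AE x in lborel. g x = h x"
    using completion_ex_borel_measurable_real by blast
  have gh': "AE x in lebesgue. g x = h x" using gh by (rule AE_completion)
  have hm: "h \<in> borel_measurable (completion lborel)" by (rule measurable_completion[OF h])
  have "integrable lebesgue h"
    using integrable_cong_AE[OF gm hm gh'] g by blast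
  then have h_int: "integrable lborel h"
    using integrable_completion[OF h] by blast
  have hzero: "(LINT x|lborel. h x * indicator (box a b) x) = 0" if "box a b \<subseteq> U" for a b
  proof -
    have "(LINT x|lborel. h x * indicator (box a b) x) = (LINT x|lebesgue. h x * indicator (box a b) x)"
      by (subst integral_completion) auto
    also have "\<dots> = (LINT x|lebesgue. g x * indicator (box a b) x)"
      using gh' by (intro integral_cong_AE borel_measurable_times gm hm borel_measurable_indicator) auto
    finally show ?thesis using zero[OF that] by simp
  qed
  have on_box: "AE x in lborel. x \<in> box a b \<longrightarrow> h x = 0" if ab: "box a b \<subseteq> U" for a b
  proof -
    define k where "k x = h x * indicator (box a b) x" for x
    have k_int: "integrable lborel k"
      unfolding k_def using h_int by (intro integrable_real_mult_indicator) auto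
    have kA: "(LINT x|lborel. k x * indicator A x) = 0" if A: "A \<in> sets borel" for A
    proof -
      let ?G = "range (\<lambda>(a, b). box a b) :: 'a set set"
      have stable: "Int_stable ?G"
        by (auto simp: Int_stable_def box_Int_box)
      have "A \<in> sigma_sets UNIV ?G"
        using A by (simp add: borel_eq_box)
      from stable subset_UNIV[of ?G, folded Pow_UNIV] this show ?thesis
      proof (induction rule: sigma_sets_induct_disjoint)
        case (basic A)
        then obtain p where "A = (case p of (a, b) \<Rightarrow> box a b)" by blast
        then obtain c d where A: "A = box c d" by (cases p) simp
        obtain e f where ef: "box a b \<inter> box c d = box e f"
          using box_Int_box[of a b c d] by blast
        have "(LINT x|lborel. k x * indicator A x) = (LINT x|lborel. h x * indicator (box e f) x)"
          by (simp add: k_def A mult.assoc flip: indicator_inter_arith ef)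
        also have "\<dots> = 0" using ef ab by (intro hzero) auto
        finally show ?case .
      next
        case (compl A)
        have A: "A \<in> sets borel" using compl(1) by (simp add: borel_eq_box)
        have "(LINT x|lborel. k x * indicator (UNIV - A) x)
            = (LINT x|lborel. k x - k x * indicator A x)"
          by (intro Bochner_Integration.integral_cong) (auto simp: indicator_def)
        also have "\<dots> = (LINT x|lborel. k x) - (LINT x|lborel. k x * indicator A x)"
          using k_int A by (intro Bochner_Integration.integral_diff integrable_real_mult_indicator) auto
        also have "\<dots> = 0" using compl hzero[OF ab] by (simp add: k_def)
        finally show ?case .
      next
        case (union A)
        have A: "A i \<in> sets borel" for i using union(2) by (auto simp: borel_eq_box)
        have "(LINT x:(\<Union>i. A i)|lborel. k x) = (\<Sum>i. LINT x:A i|lborel. k x)"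
        proof (rule lebesgue_integral_countable_add)
          show "set_integrable lborel (\<Union>i. A i) k"
            unfolding set_integrable_def using A k_int by (intro integrable_mult_indicator) auto
        qed (use A union(1) in \<open>auto simp: disjoint_family_on_def\<close>)
        then show ?case using union(3) by (simp add: set_lebesgue_integral_def mult.commute)
      qed auto
    qed
    have [measurable]: "k \<in> borel_measurable lborel" using k_int by auto
    define P where "P = {x. k x > 0}"
    define N where "N = {x. k x < 0}"
    have [measurable]: "P \<in> sets borel" "N \<in> sets borel"
      unfolding P_def N_def by (auto intro!: borel_measurable_less)
    have kint: "integrable lborel (\<lambda>x. k x * indicator A x)" if "A \<in> sets borel" for A
      using k_int that by (intro integrable_real_mult_indicator) auto
    have "AE x in lborel. k x * indicator P x = 0"
      using kA[of P] kint[of P]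
      by (subst integral_nonneg_eq_0_iff_AE[symmetric]) (auto simp: P_def indicator_def)
    moreover have "AE x in lborel. - (k x * indicator N x) = 0"
      using kA[of N] kint[of N]
      by (subst integral_nonneg_eq_0_iff_AE[symmetric]) (auto simp: N_def indicator_def)
    ultimately show ?thesis
      by eventually_elim (auto simp: k_def P_def N_def indicator_def split: if_splits)
  qed
  obtain \<D> where \<D>: "countable \<D>" "\<D> \<subseteq> Pow U" "\<And>X. X \<in> \<D> \<Longrightarrow> \<exists>a b. X = box a b" "\<Union>\<D> = U"
    using open_countable_Union_open_box[OF U] by metis
  have "AE x in lborel. \<forall>X\<in>\<D>. x \<in> X \<longrightarrow> h x = 0"
  proof (subst AE_ball_countable[OF \<D>(1)], intro ballI)
    fix X assume X: "X \<in> \<D>"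
    then obtain a b where "X = box a b" using \<D>(3) by blast
    then show "AE x in lborel. x \<in> X \<longrightarrow> h x = 0" using on_box X \<D>(2) by blast
  qed
  then have "AE x in lborel. x \<in> U \<longrightarrow> h x = 0"
    by eventually_elim (use \<D>(4) in blast)
  then have "AE x in lebesgue. x \<in> U \<longrightarrow> h x = 0" by (rule AE_completion)
  with gh' show ?thesis by eventually_elim simp
qed

text \<open>
  Smooth bumps converge boundedly to the indicators of boxes; dominated convergence
  transfers the hypothesis from test functions to boxes.
\<close>

lemma fundamental_lemma:
  fixes g :: "real^'k \<Rightarrow> real"
  assumes D: "open D" and g: "integrable (lebesgue_on D) g"
    and zero: "\<And>\<phi>. \<phi> \<in> test_functions D \<Longrightarrow> (LINT x|lebesgue_on D. g x * \<phi> x) = 0"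
  shows "AE x in lebesgue_on D. g x = 0"
proof -
  have Ds [simp]: "D \<in> sets lebesgue" using D by auto
  have meas: "box a b \<in> sets (lebesgue_on D)" if "box a b \<subseteq> D" for a b
    using that by (simp add: sets_restrict_space_iff)
  have "AE x in lebesgue. x \<in> D \<longrightarrow> indicator D x * g x = 0"
  proof (rule integral_zero_on_boxes_AE_zero[OF _ _ D])
    show "integrable lebesgue (\<lambda>x. indicator D x * g x)"
      using g integrable_restrict_space[of D lebesgue g] by simp
    fix a b assume ab: "box a b \<subseteq> D"
    have "(\<lambda>n. LINT x|lebesgue_on D. g x * box_bump n a b x)
        \<longlonglongrightarrow> (LINT x|lebesgue_on D. g x * indicator (box a b) x)"
    proof (rule integral_dominated_convergence[where w = "\<lambda>x. norm (g x)"])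
      show "(\<lambda>x. g x * box_bump n a b x) \<in> borel_measurable (lebesgue_on D)" for n
        using g test_functions_measurable[OF box_bump_test_function[OF ab]]
        by (intro borel_measurable_times) (auto intro!: measurable_restrict_space1 measurable_completion)
      show "AE x in lebesgue_on D. (\<lambda>n. g x * box_bump n a b x) \<longlonglongrightarrow> g x * indicator (box a b) x"
        by (intro AE_I2 tendsto_intros box_bump_tendsto)
      show "AE x in lebesgue_on D. norm (g x * box_bump n a b x) \<le> norm (g x)" for n
        using box_bump_range[of n a b] by (auto simp: abs_mult mult_left_le)
    qed (use g meas[OF ab] in auto)
    then have "(LINT x|lebesgue_on D. g x * indicator (box a b) x) = 0"
      using zero[OF box_bump_test_function[OF ab]] by (simp add: LIMSEQ_const_iff)
    then show "(LINT x|lebesgue. indicator D x * g x * indicator (box a b) x) = 0"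
      using integral_restrict_space[of D lebesgue "\<lambda>x. g x * indicator (box a b) x"] by (simp add: mult.assoc)
  qed
  then have "AE x in lebesgue. x \<in> D \<longrightarrow> g x = 0"
    by eventually_elim auto
  then show ?thesis by (simp add: AE_restrict_space_iff)
qed

section \<open>Integration by parts\<close>

lemma directional_DERIV:
  assumes "\<And>x. g differentiable (at x)"
  shows "((\<lambda>t. g (x + t *\<^sub>R axis i 1)) has_real_derivative partial_deriv i g (x + t *\<^sub>R axis i 1)) (at t)"
proof -
  let ?G = "frechet_derivative g (at (x + t *\<^sub>R axis i 1))"
  have G: "(g has_derivative ?G) (at (x + t *\<^sub>R axis i 1))"
    using assms frechet_derivative_works by blast
  have "((\<lambda>t. x + t *\<^sub>R axis i 1) has_derivative (\<lambda>s. s *\<^sub>R axis i 1)) (at t)"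
    by (auto intro!: derivative_eq_intros)
  from has_derivative_compose[OF this G]
  have "((\<lambda>t. g (x + t *\<^sub>R axis i 1)) has_derivative (\<lambda>s. ?G (s *\<^sub>R axis i 1))) (at t)" .
  moreover have "(\<lambda>s. ?G (s *\<^sub>R axis i 1)) = (*) (partial_deriv i g (x + t *\<^sub>R axis i 1))"
    using linear_scale[OF linear_frechet_derivative[OF assms]]
    by (auto simp: partial_deriv_def fun_eq_iff)
  ultimately show ?thesis by (simp add: has_field_derivative_def)
qed

text \<open>
  By translation invariance of Lebesgue measure the difference quotients have integral zero.
  They are dominated by a constant on a ball, by the mean value theorem, and converge to the
  partial derivative.
\<close>

lemma integral_partial_deriv_zero:
  fixes g :: "real^'k \<Rightarrow> real"
  assumes diff: "\<And>x. g differentiable (at x)" and cont: "continuous_on UNIV (partial_deriv i g)"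
    and comp: "compact (closure {x. g x \<noteq> 0})"
  shows "(LINT x|lborel. partial_deriv i g x) = 0"
proof -
  define e :: "real^'k" where "e = axis i 1"
  define h where "h n = 1 / real (Suc n)" for n
  have h: "0 < h n" "h n \<le> 1" for n by (auto simp: h_def)
  define q where "q n x = (g (x + h n *\<^sub>R e) - g x) / h n" for n x
  have gc: "continuous_on UNIV g"
    using diff by (simp add: continuous_at_imp_continuous_on differentiable_imp_continuous_within)
  have gm [measurable]: "g \<in> borel_measurable borel" using gc by (rule borel_measurable_continuous_onI)
  obtain R where R: "closure {x. g x \<noteq> 0} \<subseteq> cball 0 R"
    using compact_imp_bounded[OF comp] by (auto simp: bounded_iff subset_iff)
  have supp: "g x = 0" if "norm x > R" for x
  proof (rule ccontr)
    assume "g x \<noteq> 0"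
    then have "x \<in> closure {x. g x \<noteq> 0}" by (intro subsetD[OF closure_subset]) simp
    then show False using R that by auto
  qed
  have g_int: "integrable lborel g"
  proof -
    have "integrable lborel (\<lambda>x. indicator (cball 0 R) x *\<^sub>R g x)"
      by (rule borel_integrable_compact[OF compact_cball continuous_on_subset[OF gc subset_UNIV]])
    moreover have "(\<lambda>x. indicator (cball 0 R) x *\<^sub>R g x) = g"
      using supp by (auto simp: indicator_def fun_eq_iff not_le)
    ultimately show ?thesis by simp
  qed
  have shift: "integrable lborel (\<lambda>x. g (x + c))" "(LINT x|lborel. g (x + c)) = (LINT x|lborel. g x)" for c
  proof -
    have "integrable (distr lborel borel ((+) c)) g" "(LINT x|distr lborel borel ((+) c). g x) = (LINT x|lborel. g x)"
      using g_int by (simp_all add: lborel_distr_plus)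
    then show "integrable lborel (\<lambda>x. g (x + c))" "(LINT x|lborel. g (x + c)) = (LINT x|lborel. g x)"
      by (simp_all add: integrable_distr_eq integral_distr add.commute)
  qed
  have qzero: "(LINT x|lborel. q n x) = 0" for n
    unfolding q_def using shift g_int by simp
  obtain K where K: "\<And>x. x \<in> cball 0 (R + 2) \<Longrightarrow> \<bar>partial_deriv i g x\<bar> \<le> K"
    using compact_imp_bounded[OF compact_continuous_image[OF continuous_on_subset[OF cont subset_UNIV] compact_cball]]
    unfolding bounded_iff by (metis imageI real_norm_def)
  have ne: "norm (t *\<^sub>R e) = \<bar>t\<bar>" for t by (simp add: e_def)
  have qbound: "norm (q n x) \<le> K * indicator (cball 0 (R + 1)) x" for n x
  proof (cases "x \<in> cball 0 (R + 1)")
    case False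
    then have "norm x > R + 1" by simp
    moreover have "norm x - norm (h n *\<^sub>R e) \<le> norm (x + h n *\<^sub>R e)"
      using norm_triangle_ineq2[of x "- (h n *\<^sub>R e)"] by simp
    ultimately have "norm (x + h n *\<^sub>R e) > R" "norm x > R" using h[of n] ne[of "h n"] by auto
    then show ?thesis using supp False by (simp add: q_def)
  next
    case True
    have "\<exists>z. 0 < z \<and> z < h n \<and> g (x + h n *\<^sub>R e) - g (x + 0 *\<^sub>R e) = (h n - 0) * partial_deriv i g (x + z *\<^sub>R e)"
      using h(1)[of n] directional_DERIV[OF diff] unfolding e_def by (intro MVT2) auto
    then obtain z where z: "0 < z" "z < h n" "g (x + h n *\<^sub>R e) - g x = h n * partial_deriv i g (x + z *\<^sub>R e)"
      by auto
    have "norm (x + z *\<^sub>R e) \<le> norm x + norm (z *\<^sub>R e)" by (rule norm_triangle_ineq)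
    also have "\<dots> \<le> R + 2" using True z h[of n] ne[of z] by simp
    finally have "\<bar>partial_deriv i g (x + z *\<^sub>R e)\<bar> \<le> K" by (intro K) simp
    then show ?thesis using True z h(1)[of n] by (simp add: q_def)
  qed
  have qlim: "(\<lambda>n. q n x) \<longlonglongrightarrow> partial_deriv i g x" for x
  proof -
    have "((\<lambda>t. (g (x + t *\<^sub>R e) - g x) / t) \<longlongrightarrow> partial_deriv i g x) (at 0)"
      using directional_DERIV[OF diff, of x i 0] by (simp add: DERIV_def e_def)
    moreover have "filterlim h (at 0) sequentially"
      unfolding h_def by (intro filterlim_atI lim_inverse_n'[THEN LIMSEQ_Suc]) auto
    ultimately show ?thesis unfolding q_def by (rule filterlim_compose)
  qed
  have "(\<lambda>n. LINT x|lborel. q n x) \<longlonglongrightarrow> (LINT x|lborel. partial_deriv i g x)"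
  proof (rule integral_dominated_convergence[where w = "\<lambda>x. K * indicator (cball 0 (R + 1)) x"])
    show "partial_deriv i g \<in> borel_measurable lborel"
      using borel_measurable_continuous_onI[OF cont] by simp
    show "q n \<in> borel_measurable lborel" for n unfolding q_def by measurable
    show "integrable lborel (\<lambda>x. K * indicator (cball 0 (R + 1)) x)"
      by (intro integrable_mult_right integrable_real_indicator) (simp_all add: emeasure_bounded_finite[simplified])
  qed (use qlim qbound in auto)
  then show ?thesis by (simp add: qzero LIMSEQ_const_iff)
qed

lemma partial_deriv_support:
  assumes "x \<notin> closure {x. g x \<noteq> 0}"
  shows "partial_deriv i g x = 0"
proof -
  have "((\<lambda>_. 0) has_derivative (\<lambda>_. 0)) (at x)" by simp
  then have "(g has_derivative (\<lambda>_. 0)) (at x)"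
    by (rule has_derivative_transform_within_open[where s = "- closure {x. g x \<noteq> 0}"])
       (use assms closure_subset[of "{x. g x \<noteq> 0}"] in auto)
  from partial_deriv_eq[OF this] show ?thesis .
qed

lemma integral_partial_deriv_zero_on:
  fixes g :: "real^'k \<Rightarrow> real"
  assumes D: "open D" and diff: "\<And>x. g differentiable (at x)"
    and cont: "continuous_on UNIV (partial_deriv i g)"
    and comp: "compact (closure {x. g x \<noteq> 0})" and sub: "closure {x. g x \<noteq> 0} \<subseteq> D"
  shows "(LINT x|lebesgue_on D. partial_deriv i g x) = 0"
proof -
  have "(LINT x|lebesgue_on D. partial_deriv i g x) = (LINT x|lebesgue. indicator D x *\<^sub>R partial_deriv i g x)"
    using D by (subst integral_restrict_space) auto
  also have "(\<lambda>x. indicator D x *\<^sub>R partial_deriv i g x) = partial_deriv i g"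
    using sub partial_deriv_support by (auto simp: fun_eq_iff indicator_def)
  also have "(LINT x|lebesgue. partial_deriv i g x) = (LINT x|lborel. partial_deriv i g x)"
    using borel_measurable_continuous_onI[OF cont] by (intro integral_completion) simp
  finally show ?thesis using integral_partial_deriv_zero[OF diff cont comp] by simp
qed

lemma test_functionsD:
  assumes "\<phi> \<in> test_functions D"
  shows "\<phi> differentiable (at x)" "continuous_on UNIV \<phi>" "continuous_on UNIV (partial_deriv i \<phi>)"
    "compact (closure {x. \<phi> x \<noteq> 0})" "closure {x. \<phi> x \<noteq> 0} \<subseteq> D"
proof -
  have "C_diff 0 \<phi>" "C_diff (Suc 0) \<phi>" using assms by (auto simp: test_functions_def simp del: C_diff.simps)
  then show "\<phi> differentiable (at x)" "continuous_on UNIV \<phi>" "continuous_on UNIV (partial_deriv i \<phi>)"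
    by auto
qed (use assms in \<open>auto simp: test_functions_def\<close>)

text \<open>
  With a test function for \<open>g\<close> this identifies the weak gradient of test functions;
  Poincare's inequality takes for \<open>g\<close> the product of a test function with a coordinate.
\<close>

lemma integration_by_parts:
  fixes g \<phi> :: "real^'k \<Rightarrow> real"
  assumes D: "open D" and diff: "\<And>x. g differentiable (at x)"
    and cont: "continuous_on UNIV (partial_deriv i g)" and \<phi>: "\<phi> \<in> test_functions D"
  shows "(LINT x|lebesgue_on D. g x * partial_deriv i \<phi> x + partial_deriv i g x * \<phi> x) = 0"
proof -
  note p = test_functionsD[OF \<phi>]
  have gc: "continuous_on UNIV g"
    using diff by (simp add: continuous_at_imp_continuous_on differentiable_imp_continuous_within)
  have eq: "partial_deriv i (\<lambda>x. g x * \<phi> x) = (\<lambda>x. g x * partial_deriv i \<phi> x + partial_deriv i g x * \<phi> x)"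
    using diff p(1) by (auto simp: partial_deriv_mult)
  have sub: "closure {x. g x * \<phi> x \<noteq> 0} \<subseteq> closure {x. \<phi> x \<noteq> 0}"
    by (rule closure_mono) auto
  have "(LINT x|lebesgue_on D. partial_deriv i (\<lambda>x. g x * \<phi> x) x) = 0"
  proof (rule integral_partial_deriv_zero_on[OF D])
    show "(\<lambda>x. g x * \<phi> x) differentiable (at x)" for x
      using diff p(1) by (auto intro!: derivative_intros)
    show "continuous_on UNIV (partial_deriv i (\<lambda>x. g x * \<phi> x))"
      unfolding eq by (intro continuous_intros gc p cont)
    show "compact (closure {x. g x * \<phi> x \<noteq> 0})"
      using sub p(4) bounded_subset compact_eq_bounded_closed by blast
    show "closure {x. g x * \<phi> x \<noteq> 0} \<subseteq> D" using sub p(5) by blast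
  qed
  then show ?thesis by (simp add: eq)
qed

section \<open>Norms of vector-valued functions\<close>

lemma L2v_mono:
  assumes g: "g \<in> borel_measurable M" and h: "h \<in> L2v M" and le: "AE x in M. norm (g x) \<le> c * norm (h x)"
    and c: "0 \<le> c"
  shows "g \<in> L2v M" "l2_norm M g \<le> c * l2_norm M h"
proof -
  have le2: "AE x in M. (norm (g x))\<^sup>2 \<le> c\<^sup>2 * (norm (h x))\<^sup>2"
    using le
  proof eventually_elim
    case (elim x)
    then have "(norm (g x))\<^sup>2 \<le> (c * norm (h x))\<^sup>2" by (intro power_mono) auto
    then show ?case by (simp add: power_mult_distrib)
  qed
  have int: "integrable M (\<lambda>x. c\<^sup>2 * (norm (h x))\<^sup>2)" using L2v_integrable[OF h] by simp
  have gint: "integrable M (\<lambda>x. (norm (g x))\<^sup>2)"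
    by (rule Bochner_Integration.integrable_bound[OF int]) (use le2 g in auto)
  then show "g \<in> L2v M" using g by (simp add: L2v_def)
  have "(l2_norm M g)\<^sup>2 \<le> (LINT x|M. c\<^sup>2 * (norm (h x))\<^sup>2)"
    unfolding l2_norm_power2 by (rule integral_mono_AE[OF gint int le2])
  also have "\<dots> = (c * l2_norm M h)\<^sup>2" by (simp add: power_mult_distrib l2_norm_power2)
  finally show "l2_norm M g \<le> c * l2_norm M h"
    by (rule power2_le_imp_le) (use c in simp)
qed

lemma l2_norm_cong_AE:
  assumes "g \<in> borel_measurable M" "h \<in> borel_measurable M" "AE x in M. g x = h x"
  shows "l2_norm M g = l2_norm M h"
  unfolding l2_norm_def
  by (intro arg_cong[where f = sqrt] integral_cong_AE) (use assms in auto)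

lemma L2v_vec_iff:
  fixes G :: "'a \<Rightarrow> real^'k"
  shows "G \<in> L2v M \<longleftrightarrow> (\<forall>i. (\<lambda>x. G x $ i) \<in> L2v M)"
proof
  assume G: "G \<in> L2v M"
  show "\<forall>i. (\<lambda>x. G x $ i) \<in> L2v M"
  proof
    fix i
    have "(\<lambda>x. G x \<bullet> axis i 1) \<in> borel_measurable M"
      using L2v_measurable[OF G] by measurable
    then show "(\<lambda>x. G x $ i) \<in> L2v M"
      using component_le_norm_cart[of _ i] by (intro L2v_mono(1)[OF _ G, of _ 1]) (auto simp: inner_axis)
  qed
next
  assume G: "\<forall>i. (\<lambda>x. G x $ i) \<in> L2v M"
  have "(norm (G x))\<^sup>2 = (\<Sum>i\<in>UNIV. (norm (G x $ i))\<^sup>2)" for x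
    unfolding power2_norm_eq_inner inner_vec_def ..
  moreover have "integrable M (\<lambda>x. \<Sum>i\<in>UNIV. (norm (G x $ i))\<^sup>2)"
    using G L2v_integrable by (intro Bochner_Integration.integrable_sum) blast
  moreover have "G \<in> borel_measurable M"
    unfolding borel_measurable_euclidean_space[of G]
    using G by (auto simp: Basis_vec_def inner_axis dest: L2v_measurable)
  ultimately show "G \<in> L2v M" by (simp add: L2v_def)
qed

lemma L2v_Pair_iff: "(\<lambda>x. (v x, G x)) \<in> L2v M \<longleftrightarrow> v \<in> L2v M \<and> G \<in> L2v M"
proof
  assume vG: "(\<lambda>x. (v x, G x)) \<in> L2v M"
  have "(\<lambda>x. fst (v x, G x)) \<in> borel_measurable M" "(\<lambda>x. snd (v x, G x)) \<in> borel_measurable M"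
    by (rule measurable_compose[OF L2v_measurable[OF vG]],
        intro borel_measurable_continuous_onI continuous_intros)+
  then show "v \<in> L2v M \<and> G \<in> L2v M"
    by (intro conjI L2v_mono(1)[OF _ vG, of _ 1]) (auto simp: norm_Pair)
next
  assume "v \<in> L2v M \<and> G \<in> L2v M"
  then show "(\<lambda>x. (v x, G x)) \<in> L2v M"
    by (auto simp: L2v_def norm_Pair intro!: borel_measurable_Pair)
qed

lemma l2_norm_Pair_power2:
  assumes "v \<in> L2v M" "G \<in> L2v M"
  shows "(l2_norm M (\<lambda>x. (v x, G x)))\<^sup>2 = (l2_norm M v)\<^sup>2 + (l2_norm M G)\<^sup>2"
  using L2v_integrable[OF assms(1)] L2v_integrable[OF assms(2)]
  by (simp add: l2_norm_power2 norm_Pair)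

lemma l2_norm_Pair_ge:
  assumes "v \<in> L2v M" "G \<in> L2v M"
  shows "l2_norm M v \<le> l2_norm M (\<lambda>x. (v x, G x))" "l2_norm M G \<le> l2_norm M (\<lambda>x. (v x, G x))"
  by (rule power2_le_imp_le; simp add: l2_norm_Pair_power2[OF assms])+

lemma l2_norm_vec_nth_le:
  fixes G :: "'a \<Rightarrow> real^'k"
  assumes "G \<in> L2v M"
  shows "l2_norm M (\<lambda>x. G x $ i) \<le> l2_norm M G"
  using L2v_mono(2)[of "\<lambda>x. G x $ i" M G 1] assms component_le_norm_cart[of _ i]
    L2v_measurable[OF assms[unfolded L2v_vec_iff, rule_format, of i]] by auto

lemma tendsto_l2_inner:
  assumes "\<And>n. X n \<in> L2v M" "g \<in> L2v M" "h \<in> L2v M" "(\<lambda>n. l2_norm M (X n - g)) \<longlonglongrightarrow> 0"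
  shows "(\<lambda>n. l2_inner M (X n) h) \<longlonglongrightarrow> l2_inner M g h"
proof -
  have "(\<lambda>n. l2_inner M (X n - g) h) \<longlonglongrightarrow> 0"
  proof (rule Lim_null_comparison)
    show "\<forall>\<^sub>F n in sequentially. norm (l2_inner M (X n - g) h) \<le> l2_norm M (X n - g) * l2_norm M h"
      by (simp add: L2.Cauchy_Schwarz assms)
    show "(\<lambda>n. l2_norm M (X n - g) * l2_norm M h) \<longlonglongrightarrow> 0"
      using tendsto_mult_left_zero[OF assms(4)] .
  qed
  then show ?thesis using assms by (simp add: L2.bil LIM_zero_iff)
qed

section \<open>The space of functions with a weak gradient\<close>

locale bounded_open_set =
  fixes D :: "(real^'k) set"
  assumes open_D: "open D" and bounded_D: "bounded D"
begin

abbreviation H1 :: "(real^'k \<Rightarrow> real) set" where "H1 \<equiv> H1_space D"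

abbreviation H10 :: "(real^'k \<Rightarrow> real) set" where "H10 \<equiv> H10_space D"

abbreviation M :: "(real^'k) measure" where "M \<equiv> lebesgue_on D"

lemma finite_M: "finite_measure M"
  using open_D bounded_D lmeasurable_open finite_measure_lebesgue_on by blast

lemma L2_space_eq: "L2_space D = L2v M"
  by (simp add: L2_space_def L2v_def)

lemma continuous_L2v:
  fixes g :: "real^'k \<Rightarrow> real"
  assumes "continuous_on UNIV g"
  shows "g \<in> L2v M"
proof -
  have "compact (closure D)" using bounded_D by simp
  then have "bounded (g ` closure D)"
    using assms by (intro compact_imp_bounded compact_continuous_image) (auto intro: continuous_on_subset)
  then obtain C where C: "\<And>x. x \<in> closure D \<Longrightarrow> norm (g x) \<le> C"
    by (auto simp: bounded_iff)
  have "g \<in> borel_measurable lebesgue"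
    using borel_measurable_continuous_onI[OF assms] by (intro measurable_completion) simp
  then have "g \<in> borel_measurable M"
    by (rule measurable_restrict_space1)
  then show ?thesis
    using C closure_subset[of D] by (intro L2v_AE_bounded[where C = C] finite_M AE_I2) auto
qed

lemma test_L2v: "\<phi> \<in> test_functions D \<Longrightarrow> \<phi> \<in> L2v M" "\<phi> \<in> test_functions D \<Longrightarrow> partial_deriv i \<phi> \<in> L2v M"
  using test_functionsD continuous_L2v by blast+

lemma has_weak_gradient_iff:
  "has_weak_gradient D v G \<longleftrightarrow> G \<in> L2v M \<and>
    (\<forall>i. \<forall>\<phi>\<in>test_functions D. l2_inner M v (partial_deriv i \<phi>) = - l2_inner M (\<lambda>x. G x $ i) \<phi>)"
  by (auto simp: has_weak_gradient_def L2_space_eq L2v_vec_iff[of G] l2_inner_def)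

text \<open>
  This makes the weak gradient, which is defined by choice, a linear operator up to null
  sets.
\<close>

lemma weak_gradient_unique:
  assumes "has_weak_gradient D v G" "has_weak_gradient D v H"
  shows "AE x in M. G x = H x"
proof -
  have GH: "(\<lambda>x. G x $ i) \<in> L2v M" "(\<lambda>x. H x $ i) \<in> L2v M" for i
    using assms by (auto simp: has_weak_gradient_iff L2v_vec_iff)
  have "AE x in M. G x $ i - H x $ i = 0" for i
  proof (rule fundamental_lemma[OF open_D])
    have "(\<lambda>x. G x $ i) - (\<lambda>x. H x $ i) \<in> L2v M" using GH by (intro L2.V_intros(3))
    then have d: "(\<lambda>x. G x $ i - H x $ i) \<in> L2v M" by (simp add: fun_diff_def)
    have "integrable M (\<lambda>x. norm (G x $ i - H x $ i))"
      by (rule L1_le_l2_norm(1)[OF finite_M d])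
    then show "integrable M (\<lambda>x. G x $ i - H x $ i)"
      using L2v_measurable[OF d] integrable_norm_iff by blast
    fix \<phi> assume \<phi>: "\<phi> \<in> test_functions D"
    have "l2_inner M ((\<lambda>x. G x $ i) - (\<lambda>x. H x $ i)) \<phi> = 0"
      using assms \<phi> test_L2v(1)[OF \<phi>] GH by (simp add: L2.bil has_weak_gradient_iff)
    then show "(LINT x|M. (G x $ i - H x $ i) * \<phi> x) = 0" by (simp add: l2_inner_def)
  qed
  then have "AE x in M. \<forall>i\<in>UNIV. G x $ i - H x $ i = 0" by (subst AE_finite_all) auto
  then show ?thesis by eventually_elim (simp add: vec_eq_iff)
qed

lemma has_weak_gradient_linear:
  assumes v: "v \<in> L2v M" "has_weak_gradient D v G" and w: "w \<in> L2v M" "has_weak_gradient D w H"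
  shows "has_weak_gradient D (a *\<^sub>R v + b *\<^sub>R w) (a *\<^sub>R G + b *\<^sub>R H)"
proof -
  have GH: "(\<lambda>x. G x $ i) \<in> L2v M" "(\<lambda>x. H x $ i) \<in> L2v M" for i
    using assms by (auto simp: has_weak_gradient_iff L2v_vec_iff)
  have "l2_inner M (a *\<^sub>R v + b *\<^sub>R w) (partial_deriv i \<phi>)
       = - l2_inner M (\<lambda>x. (a *\<^sub>R G + b *\<^sub>R H) x $ i) \<phi>" if \<phi>: "\<phi> \<in> test_functions D" for i \<phi>
  proof -
    have "(\<lambda>x. (a *\<^sub>R G + b *\<^sub>R H) x $ i) = a *\<^sub>R (\<lambda>x. G x $ i) + b *\<^sub>R (\<lambda>x. H x $ i)"
      by (simp add: fun_eq_iff scaleR_fun)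
    then show ?thesis
      using v w GH[of i] test_L2v[OF \<phi>] \<phi> by (simp add: L2.bil has_weak_gradient_iff algebra_simps)
  qed
  then show ?thesis using v w by (simp add: has_weak_gradient_iff)
qed

text \<open>
  The graph embedding of \<open>H\<^sup>1\<close> into square-integrable pairs. It reduces the norm and
  completeness of \<open>H\<^sup>1\<close> to those of \<open>L\<^sup>2\<close>.
\<close>

definition jet :: "(real^'k \<Rightarrow> real) \<Rightarrow> real^'k \<Rightarrow> real \<times> (real^'k)" where
  "jet v x = (v x, weak_grad D v x)"

lemma H1_L2v: "v \<in> H1 \<Longrightarrow> v \<in> L2v M"
  by (simp add: H1_space_def L2_space_eq)

lemma weak_gradI: "v \<in> H1 \<Longrightarrow> has_weak_gradient D v (weak_grad D v)"
  using someI_ex[of "has_weak_gradient D v"] by (simp add: weak_grad_def H1_space_def)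

lemma weak_grad_L2v: "v \<in> H1 \<Longrightarrow> weak_grad D v \<in> L2v M"
  using weak_gradI has_weak_gradient_iff by blast

lemma H1_I:
  assumes "v \<in> L2v M" "has_weak_gradient D v G"
  shows "v \<in> H1" "AE x in M. weak_grad D v x = G x"
proof -
  show "v \<in> H1" using assms by (auto simp: H1_space_def L2_space_eq)
  from weak_gradI[OF this] show "AE x in M. weak_grad D v x = G x"
    using assms(2) by (rule weak_gradient_unique)
qed

lemma jet_L2v: "v \<in> H1 \<Longrightarrow> jet v \<in> L2v M"
  unfolding jet_def using H1_L2v weak_grad_L2v L2v_Pair_iff by blast

lemma H1_linear:
  assumes "v \<in> H1" "w \<in> H1"
  shows "a *\<^sub>R v + b *\<^sub>R w \<in> H1"
    and "AE x in M. weak_grad D (a *\<^sub>R v + b *\<^sub>R w) x = a *\<^sub>R weak_grad D v x + b *\<^sub>R weak_grad D w x"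
proof -
  have "a *\<^sub>R v + b *\<^sub>R w \<in> L2v M" using assms H1_L2v by auto
  note I = H1_I[OF this has_weak_gradient_linear]
  show "a *\<^sub>R v + b *\<^sub>R w \<in> H1"
    by (rule I(1)) (rule assms H1_L2v weak_gradI)+
  have "AE x in M. weak_grad D (a *\<^sub>R v + b *\<^sub>R w) x = (a *\<^sub>R weak_grad D v + b *\<^sub>R weak_grad D w) x"
    using assms by (intro I(2) H1_L2v weak_gradI)
  then show "AE x in M. weak_grad D (a *\<^sub>R v + b *\<^sub>R w) x = a *\<^sub>R weak_grad D v x + b *\<^sub>R weak_grad D w x"
    by (simp add: scaleR_fun)
qed

lemma H1_0: "0 \<in> H1"
  by (rule H1_I(1)[where G = 0]) (auto simp: has_weak_gradient_iff l2_inner_def zero_fun_def L2v_def)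

lemma H1_subspace: "subspace (H1)"
  unfolding subspace_def
  using H1_0 H1_linear(1)[of _ _ 1 1] H1_linear(1)[OF _ H1_0, of _ _ 0] by auto

lemma weak_grad_add:
  assumes "v \<in> H1" "w \<in> H1"
  shows "AE x in M. weak_grad D (v + w) x = weak_grad D v x + weak_grad D w x"
  using H1_linear(2)[OF assms, of 1 1] by simp

lemma weak_grad_diff:
  assumes "v \<in> H1" "w \<in> H1"
  shows "AE x in M. weak_grad D (v - w) x = weak_grad D v x - weak_grad D w x"
  using H1_linear(2)[OF assms, of 1 "-1"] by simp

lemma weak_grad_scale:
  assumes "v \<in> H1"
  shows "AE x in M. weak_grad D (c *\<^sub>R v) x = c *\<^sub>R weak_grad D v x"
  using H1_linear(2)[OF assms H1_0, of c 0] by simp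

definition h1_norm :: "(real^'k \<Rightarrow> real) \<Rightarrow> real" where "h1_norm v = l2_norm M (jet v)"

definition grad_norm :: "(real^'k \<Rightarrow> real) \<Rightarrow> real" where "grad_norm v = l2_norm M (weak_grad D v)"

lemma l2_inner_cong_AE:
  assumes "g \<in> L2v M" "g' \<in> L2v M" "h \<in> L2v M" "AE x in M. g x = g' x"
  shows "l2_inner M g h = l2_inner M g' h"
  unfolding l2_inner_def
  by (rule integral_cong_AE) (use assms in \<open>auto dest!: L2v_measurable\<close>)

sublocale H1: semi_inner "H1" "\<lambda>v w. l2_inner M (jet v) (jet w)"
  rewrites "semi_inner.nrm (\<lambda>v w. l2_inner M (jet v) (jet w)) = h1_norm"
proof -
  show si: "semi_inner (H1) (\<lambda>v w. l2_inner M (jet v) (jet w))"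
  proof
    show "subspace (H1)" by (rule H1_subspace)
    show "l2_inner M (jet (x + y)) (jet z) = l2_inner M (jet x) (jet z) + l2_inner M (jet y) (jet z)"
      if "x \<in> H1" "y \<in> H1" "z \<in> H1" for x y z
    proof -
      have "AE t in M. jet (x + y) t = (jet x + jet y) t"
        using weak_grad_add[OF that(1,2)] by eventually_elim (simp add: jet_def)
      then have "l2_inner M (jet (x + y)) (jet z) = l2_inner M (jet x + jet y) (jet z)"
        using that H1_subspace by (intro l2_inner_cong_AE L2.V_intros jet_L2v) (auto simp: subspace_add)
      then show ?thesis using that by (simp add: L2.bil jet_L2v)
    qed
    show "l2_inner M (jet (c *\<^sub>R x)) (jet z) = c * l2_inner M (jet x) (jet z)"
      if "x \<in> H1" "z \<in> H1" for c x z
    proof -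
      have "AE t in M. jet (c *\<^sub>R x) t = (c *\<^sub>R jet x) t"
        using weak_grad_scale[OF that(1), of c] by eventually_elim (simp add: jet_def scaleR_fun)
      then have "l2_inner M (jet (c *\<^sub>R x)) (jet z) = l2_inner M (c *\<^sub>R jet x) (jet z)"
        using that H1_subspace by (intro l2_inner_cong_AE L2.V_intros jet_L2v) (auto simp: subspace_scale)
      then show ?thesis using that by (simp add: L2.bil jet_L2v)
    qed
  qed (auto intro: L2.sym L2.nonneg jet_L2v)
  interpret semi_inner "H1" "\<lambda>v w. l2_inner M (jet v) (jet w)" by (rule si)
  show "nrm = h1_norm"
    by (simp add: fun_eq_iff nrm_def h1_norm_def L2.nrm_def[symmetric])
qed

lemma h1_norm_power2: "v \<in> H1 \<Longrightarrow> (h1_norm v)\<^sup>2 = (l2_norm M v)\<^sup>2 + (grad_norm v)\<^sup>2"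
  unfolding h1_norm_def grad_norm_def jet_def
  by (intro l2_norm_Pair_power2 H1_L2v weak_grad_L2v)

lemma grad_norm_nonneg [simp]: "0 \<le> grad_norm v"
  by (simp add: grad_norm_def)

lemma h1_norm_ge: "v \<in> H1 \<Longrightarrow> l2_norm M v \<le> h1_norm v" "v \<in> H1 \<Longrightarrow> grad_norm v \<le> h1_norm v"
  unfolding h1_norm_def grad_norm_def jet_def by (intro l2_norm_Pair_ge H1_L2v weak_grad_L2v; assumption)+

lemma H1_norm_eq: "v \<in> H1 \<Longrightarrow> H1_norm D v = ennreal (h1_norm v)"
  using h1_norm_power2[of v] H1.nrm_nonneg[of v]
  by (simp add: H1_norm_def grad_norm_def l2_norm_power2 real_sqrt_unique)

text \<open>
  The weak gradient is a closed operator: both sides of its defining identity are continuous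
  in \<open>L\<^sup>2\<close>.
\<close>

lemma H1_complete:
  assumes X: "\<And>n. X n \<in> H1"
    and cauchy: "\<And>e. e > 0 \<Longrightarrow> \<exists>N. \<forall>m\<ge>N. \<forall>n\<ge>N. h1_norm (X m - X n) < e"
  shows "\<exists>v\<in>H1. (\<lambda>n. h1_norm (X n - v)) \<longlonglongrightarrow> 0"
proof -
  have jet_diff: "AE t in M. jet (v - w) t = (jet v - jet w) t" if "v \<in> H1" "w \<in> H1" for v w
    using weak_grad_diff[OF that] by eventually_elim (simp add: jet_def)
  have h1_diff: "h1_norm (v - w) = l2_norm M (jet v - jet w)" if "v \<in> H1" "w \<in> H1" for v w
    unfolding h1_norm_def using jet_diff[OF that] that
    by (intro l2_norm_cong_AE) (auto intro!: L2v_measurable jet_L2v L2.V_intros(3) H1.V_intros(3))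
  have "\<exists>g\<in>L2v M. (\<lambda>n. l2_norm M (jet (X n) - g)) \<longlonglongrightarrow> 0"
    by (rule L2v_complete[OF finite_M]) (use X cauchy in \<open>auto simp: jet_L2v h1_diff\<close>)
  then obtain g where g: "g \<in> L2v M" and lim: "(\<lambda>n. l2_norm M (jet (X n) - g)) \<longlonglongrightarrow> 0" by blast
  define v where "v x = fst (g x)" for x
  define G where "G x = snd (g x)" for x
  have gvG: "g = (\<lambda>x. (v x, G x))" by (simp add: v_def G_def)
  have vG: "v \<in> L2v M" "G \<in> L2v M" using g L2v_Pair_iff unfolding gvG by blast+
  have diff_eq: "jet (X n) - g = (\<lambda>x. ((X n - v) x, (weak_grad D (X n) - G) x))" for n
    by (simp add: gvG jet_def fun_eq_iff)
  have diffs: "X n - v \<in> L2v M" "weak_grad D (X n) - G \<in> L2v M" for n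
    using vG X H1_L2v weak_grad_L2v by (auto intro!: L2.V_intros(3))
  have limv: "(\<lambda>n. l2_norm M (X n - v)) \<longlonglongrightarrow> 0"
    by (rule Lim_null_comparison[OF _ lim]) (use l2_norm_Pair_ge(1)[OF diffs] in \<open>simp add: diff_eq\<close>)
  have limG: "(\<lambda>n. l2_norm M (weak_grad D (X n) - G)) \<longlonglongrightarrow> 0"
    by (rule Lim_null_comparison[OF _ lim]) (use l2_norm_Pair_ge(2)[OF diffs] in \<open>simp add: diff_eq\<close>)
  have "has_weak_gradient D v G"
    unfolding has_weak_gradient_iff
  proof (intro conjI allI ballI vG)
    fix i \<phi> assume \<phi>: "\<phi> \<in> test_functions D"
    have "(\<lambda>n. l2_inner M (X n) (partial_deriv i \<phi>)) \<longlonglongrightarrow> l2_inner M v (partial_deriv i \<phi>)"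
      by (rule tendsto_l2_inner) (use X H1_L2v vG test_L2v[OF \<phi>] limv in auto)
    moreover have "l2_inner M (X n) (partial_deriv i \<phi>) = - l2_inner M (\<lambda>x. weak_grad D (X n) x $ i) \<phi>" for n
      using weak_gradI[OF X] \<phi> by (simp add: has_weak_gradient_iff)
    moreover have "(\<lambda>n. - l2_inner M (\<lambda>x. weak_grad D (X n) x $ i) \<phi>) \<longlonglongrightarrow> - l2_inner M (\<lambda>x. G x $ i) \<phi>"
    proof (intro tendsto_minus tendsto_l2_inner)
      show "(\<lambda>n. l2_norm M ((\<lambda>x. weak_grad D (X n) x $ i) - (\<lambda>x. G x $ i))) \<longlonglongrightarrow> 0"
        by (rule Lim_null_comparison[OF _ limG])
           (use l2_norm_vec_nth_le[OF diffs(2), of _ i] in \<open>simp add: fun_diff_def\<close>)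
    qed (use weak_grad_L2v[OF X] vG test_L2v(1)[OF \<phi>] in \<open>auto simp: L2v_vec_iff\<close>)
    ultimately show "l2_inner M v (partial_deriv i \<phi>) = - l2_inner M (\<lambda>x. G x $ i) \<phi>"
      using LIMSEQ_unique by simp
  qed
  note vI = H1_I[OF vG(1) this]
  have "h1_norm (X n - v) = l2_norm M (jet (X n) - g)" for n
  proof -
    have "AE t in M. jet (X n - v) t = (jet (X n) - g) t"
      using jet_diff[OF X vI(1), of n] vI(2) by eventually_elim (simp add: gvG jet_def)
    then show ?thesis unfolding h1_norm_def
      using X vI(1) g by (intro l2_norm_cong_AE) (auto intro!: L2v_measurable jet_L2v L2.V_intros(3) H1.V_intros(3))
  qed
  then have "(\<lambda>n. h1_norm (X n - v)) \<longlonglongrightarrow> 0" using lim by simp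
  then show ?thesis using vI(1) by (rule bexI)
qed

section \<open>Zero boundary values and the Poincare inequality\<close>

lemma test_H1:
  assumes \<phi>: "\<phi> \<in> test_functions D"
  shows "\<phi> \<in> H1" "AE x in M. weak_grad D \<phi> x = (\<chi> i. partial_deriv i \<phi> x)"
proof -
  have "has_weak_gradient D \<phi> (\<lambda>x. \<chi> i. partial_deriv i \<phi> x)"
    unfolding has_weak_gradient_iff
  proof (intro conjI allI ballI)
    show "(\<lambda>x. \<chi> i. partial_deriv i \<phi> x) \<in> L2v M"
      using test_L2v(2)[OF \<phi>] by (simp add: L2v_vec_iff)
    fix i \<eta> assume \<eta>: "\<eta> \<in> test_functions D"
    have "0 = (LINT x|M. \<phi> x * partial_deriv i \<eta> x + partial_deriv i \<phi> x * \<eta> x)"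
      using integration_by_parts[OF open_D test_functionsD(1,3)[OF \<phi>] \<eta>] by simp
    also have "\<dots> = l2_inner M \<phi> (partial_deriv i \<eta>) + l2_inner M (partial_deriv i \<phi>) \<eta>"
      using L2v_integrable_inner[OF test_L2v(1)[OF \<phi>] test_L2v(2)[OF \<eta>, of i]]
        L2v_integrable_inner[OF test_L2v(2)[OF \<phi>, of i] test_L2v(1)[OF \<eta>]]
      by (simp add: l2_inner_def)
    finally show "l2_inner M \<phi> (partial_deriv i \<eta>) = - l2_inner M (\<lambda>x. (\<chi> i. partial_deriv i \<phi> x) $ i) \<eta>"
      by simp
  qed
  from H1_I[OF test_L2v(1)[OF \<phi>] this]
  show "\<phi> \<in> H1" "AE x in M. weak_grad D \<phi> x = (\<chi> i. partial_deriv i \<phi> x)" .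
qed

text \<open>
  On functions with a weak gradient the extended-valued norm of the definition is finite,
  and the condition becomes one about real numbers.
\<close>

lemma H10_iff:
  "v \<in> H10 \<longleftrightarrow> v \<in> H1 \<and> (\<forall>e>0. \<exists>\<phi>\<in>test_functions D. h1_norm (v - \<phi>) < e)"
proof -
  have "H1_norm D (\<lambda>x. v x - \<phi> x) < ennreal e \<longleftrightarrow> h1_norm (v - \<phi>) < e"
    if "v \<in> H1" "\<phi> \<in> test_functions D" "e > 0" for \<phi> e
  proof -
    have d: "v - \<phi> \<in> H1" using that test_H1(1) by (intro H1.V_intros(3))
    then show ?thesis
      using H1_norm_eq[OF d] H1.nrm_nonneg[OF d] by (simp add: fun_diff_def ennreal_less_iff)
  qed
  then show ?thesis by (auto simp: H10_space_def)
qed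

lemma H10_H1: "v \<in> H10 \<Longrightarrow> v \<in> H1"
  by (simp add: H10_iff)

lemma test_functions_subspace:
  assumes "f \<in> test_functions D" "g \<in> test_functions D"
  shows "a *\<^sub>R f + b *\<^sub>R g \<in> test_functions D"
  using test_functions_linear[OF assms, of a b] by (simp add: scaleR_fun plus_fun_def)

lemma H10_subspace: "subspace (H10)"
  unfolding subspace_def
proof (intro conjI ballI allI)
  have "box_bump 0 0 0 \<in> test_functions D"
    by (rule box_bump_test_function) simp
  from test_functions_subspace[OF this this, of 0 0]
  have 0: "(0 :: real^'k \<Rightarrow> real) \<in> test_functions D" by simp
  show zero: "0 \<in> H10" using 0 by (force simp: H10_iff)
  fix v assume v: "v \<in> H10"
  {
    fix w assume w: "w \<in> H10"
    show "v + w \<in> H10" unfolding H10_iff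
    proof (intro conjI allI impI)
      show "v + w \<in> H1" using v w H10_H1 by blast
      fix e :: real assume "e > 0"
      then obtain \<phi> \<eta> where f: "\<phi> \<in> test_functions D" "h1_norm (v - \<phi>) < e / 2"
        "\<eta> \<in> test_functions D" "h1_norm (w - \<eta>) < e / 2"
        using v w unfolding H10_iff by (meson half_gt_zero)
      have "v + w - (\<phi> + \<eta>) = (v - \<phi>) + (w - \<eta>)" by simp
      then have "h1_norm (v + w - (\<phi> + \<eta>)) \<le> h1_norm (v - \<phi>) + h1_norm (w - \<eta>)"
        using H10_H1[OF v] H10_H1[OF w] test_H1(1)[OF f(1)] test_H1(1)[OF f(3)]
        by (simp only:) (intro H1.nrm_triangle H1.V_intros(3))
      then have "h1_norm (v + w - (\<phi> + \<eta>)) < e" using f by linarith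
      then show "\<exists>\<phi>\<in>test_functions D. h1_norm (v + w - \<phi>) < e"
        using test_functions_subspace[OF f(1,3), of 1 1] by auto
    qed
  }
  fix c
  show "c *\<^sub>R v \<in> H10"
  proof (cases "c = 0")
    case False
    show ?thesis unfolding H10_iff
    proof (intro conjI allI impI)
      show "c *\<^sub>R v \<in> H1" using v H10_H1 by blast
      fix e :: real assume "e > 0"
      then have "e / \<bar>c\<bar> > 0" using False by simp
      then obtain \<phi> where f: "\<phi> \<in> test_functions D" "h1_norm (v - \<phi>) < e / \<bar>c\<bar>"
        using v unfolding H10_iff by blast
      have "h1_norm (c *\<^sub>R v - c *\<^sub>R \<phi>) = \<bar>c\<bar> * h1_norm (v - \<phi>)"
        unfolding scaleR_diff_right[symmetric]
        using H10_H1[OF v] test_H1(1)[OF f(1)] by (intro H1.nrm_scale H1.V_intros(3))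
      also have "\<dots> < e" using f(2) False by (simp add: field_simps)
      finally show "\<exists>\<phi>\<in>test_functions D. h1_norm (c *\<^sub>R v - \<phi>) < e"
        using test_functions_subspace[OF f(1) f(1), of c 0] by auto
    qed
  qed (use zero in simp)
qed

lemma H10_closed:
  assumes X: "\<And>n. X n \<in> H10" and v: "v \<in> H1" and lim: "(\<lambda>n. h1_norm (X n - v)) \<longlonglongrightarrow> 0"
  shows "v \<in> H10"
  unfolding H10_iff
proof (intro conjI allI impI v)
  fix e :: real assume "e > 0"
  then obtain n where "norm (h1_norm (X n - v)) < e / 2"
    using LIMSEQ_D[OF lim, of "e / 2"] by auto
  then have n: "h1_norm (v - X n) < e / 2"
    using H1.nrm_minus_commute[OF v H10_H1[OF X]] by simp
  obtain \<phi> where f: "\<phi> \<in> test_functions D" "h1_norm (X n - \<phi>) < e / 2"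
    using X[of n] \<open>e > 0\<close> unfolding H10_iff by (meson half_gt_zero)
  have "h1_norm (v - \<phi>) \<le> h1_norm (v - X n) + h1_norm (X n - \<phi>)"
    by (rule H1.nrm_triangle3[OF v H10_H1[OF X] test_H1(1)[OF f(1)]])
  then show "\<exists>\<phi>\<in>test_functions D. h1_norm (v - \<phi>) < e"
    using n f by (intro bexI[of _ \<phi>]) auto
qed

text \<open>
  Integrating the derivative of \<open>x\<^sub>i \<phi>\<^sup>2\<close> gives \<open>\<integral> \<phi>\<^sup>2 = - 2 \<integral> x\<^sub>i \<phi> \<partial>\<^sub>i \<phi>\<close>, and \<open>x\<^sub>i\<close> is
  bounded on the domain.
\<close>

lemma poincare_test_functions:
  assumes R: "\<And>x. x \<in> D \<Longrightarrow> norm x \<le> R" and "0 \<le> R" and \<phi>: "\<phi> \<in> test_functions D"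
  shows "l2_norm M \<phi> \<le> 2 * R * grad_norm \<phi>"
proof -
  fix i :: 'k
  define g where "g x = x $ i * \<phi> x" for x :: "real^'k"
  note p = test_functionsD[OF \<phi>]
  have nth: "((\<lambda>x. x $ i) has_derivative (\<lambda>v. v $ i)) (at x)" for x :: "real^'k"
    by (rule bounded_linear.has_derivative[OF bounded_linear_vec_nth]) (rule has_derivative_ident)
  then have nd: "(\<lambda>x. x $ i) differentiable (at x)" for x :: "real^'k"
    unfolding differentiable_def by blast
  have pg: "partial_deriv i g = (\<lambda>x. x $ i * partial_deriv i \<phi> x + \<phi> x)"
    unfolding g_def using partial_deriv_mult[OF nd p(1)] partial_deriv_eq[OF nth] by (simp add: fun_eq_iff axis_def)
  have gc: "continuous_on UNIV g" unfolding g_def by (intro continuous_intros p)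
  (* Integration by parts against the product of phi with a coordinate. *)
  have "0 = (LINT x|M. g x * partial_deriv i \<phi> x + partial_deriv i g x * \<phi> x)"
  proof (rule integration_by_parts[OF open_D _ _ \<phi>, symmetric])
    show "g differentiable (at x)" for x
      unfolding g_def[abs_def] using p nd by (intro derivative_intros)
    show "continuous_on UNIV (partial_deriv i g)"
      unfolding pg by (intro continuous_intros p)
  qed
  also have "\<dots> = (LINT x|M. 2 * (g x * partial_deriv i \<phi> x) + (norm (\<phi> x))\<^sup>2)"
    by (intro Bochner_Integration.integral_cong) (auto simp: pg g_def power2_eq_square algebra_simps)
  also have "\<dots> = 2 * l2_inner M g (partial_deriv i \<phi>) + (l2_norm M \<phi>)\<^sup>2"
    using L2v_integrable_inner[OF continuous_L2v[OF gc] test_L2v(2)[OF \<phi>, of i]] L2v_integrable[OF test_L2v(1)[OF \<phi>]]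
    by (simp add: l2_inner_def l2_norm_power2)
  finally have "(l2_norm M \<phi>)\<^sup>2 = - 2 * l2_inner M g (partial_deriv i \<phi>)" by simp
  also have "\<dots> \<le> 2 * (l2_norm M g * l2_norm M (partial_deriv i \<phi>))"
    using L2.Cauchy_Schwarz[OF continuous_L2v[OF gc] test_L2v(2)[OF \<phi>, of i]] by (simp add: abs_le_iff)
  also have "\<dots> \<le> 2 * ((R * l2_norm M \<phi>) * grad_norm \<phi>)"
  proof (intro mult_left_mono mult_mono)
    show "l2_norm M g \<le> R * l2_norm M \<phi>"
    proof (rule L2v_mono(2)[OF L2v_measurable[OF continuous_L2v[OF gc]] test_L2v(1)[OF \<phi>] AE_I2 \<open>0 \<le> R\<close>])
      fix x assume "x \<in> space M"
      then have "norm x \<le> R" using R by simp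
      then have "\<bar>x $ i\<bar> \<le> R" using component_le_norm_cart[of x i] by linarith
      then show "norm (g x) \<le> R * norm (\<phi> x)" by (simp add: g_def abs_mult mult_right_mono)
    qed
    have "l2_norm M (partial_deriv i \<phi>) = l2_norm M (\<lambda>x. weak_grad D \<phi> x $ i)"
    proof (rule l2_norm_cong_AE)
      show "AE x in M. partial_deriv i \<phi> x = weak_grad D \<phi> x $ i"
        using test_H1(2)[OF \<phi>] by eventually_elim simp
      show "(\<lambda>x. weak_grad D \<phi> x $ i) \<in> borel_measurable M"
        using weak_grad_L2v[OF test_H1(1)[OF \<phi>]] unfolding L2v_vec_iff by (intro L2v_measurable) simp
    qed (rule L2v_measurable[OF test_L2v(2)[OF \<phi>]])
    also have "\<dots> \<le> grad_norm \<phi>"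
      unfolding grad_norm_def by (rule l2_norm_vec_nth_le[OF weak_grad_L2v[OF test_H1(1)[OF \<phi>]]])
    finally show "l2_norm M (partial_deriv i \<phi>) \<le> grad_norm \<phi>" .
  qed (use \<open>0 \<le> R\<close> in auto)
  finally have "l2_norm M \<phi> * l2_norm M \<phi> \<le> l2_norm M \<phi> * (2 * R * grad_norm \<phi>)"
    by (simp add: power2_eq_square algebra_simps)
  then show ?thesis
    using \<open>0 \<le> R\<close> l2_norm_ge_0[of M \<phi>] by (cases "l2_norm M \<phi> = 0") (simp_all add: mult_le_cancel_left)
qed

lemma poincare:
  obtains P where "P \<ge> 1" "\<And>v. v \<in> H10 \<Longrightarrow> h1_norm v \<le> P * grad_norm v"
proof -
  obtain R where R: "\<And>x. x \<in> D \<Longrightarrow> norm x \<le> R" "0 \<le> R"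
    using bounded_D unfolding bounded_iff by (metis norm_ge_zero order.trans linear)
  have main: "l2_norm M v \<le> 2 * R * grad_norm v" if v: "v \<in> H10" for v
  proof (rule field_le_epsilon)
    fix e :: real assume "e > 0"
    (* Chosen such that 2 R d + d = e. *)
    define d where "d = e / (2 * R + 1)"
    have "d > 0" using \<open>e > 0\<close> R(2) by (simp add: d_def)
    then obtain \<phi> where f: "\<phi> \<in> test_functions D" "h1_norm (v - \<phi>) < d"
      using v unfolding H10_iff by blast
    note m = H10_H1[OF v] test_H1(1)[OF f(1)]
    note d = H1.V_intros(3)[OF m]
    have 1: "l2_norm M (v - \<phi>) < d" "grad_norm (v - \<phi>) < d" using h1_norm_ge[OF d] f(2) by auto
    have 2: "l2_norm M v \<le> l2_norm M \<phi> + l2_norm M (v - \<phi>)"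
      using L2.nrm_triangle_sub[OF H1_L2v[OF m(1)] H1_L2v[OF m(2)]] by linarith
    have "grad_norm (v - \<phi>) = l2_norm M (weak_grad D v - weak_grad D \<phi>)"
      unfolding grad_norm_def
      using weak_grad_diff[OF m] weak_grad_L2v[OF m(1)] weak_grad_L2v[OF m(2)] weak_grad_L2v[OF d]
      by (intro l2_norm_cong_AE) (auto intro!: L2v_measurable L2.V_intros(3))
    then have 3: "grad_norm \<phi> \<le> grad_norm v + grad_norm (v - \<phi>)"
      using L2.nrm_triangle_sub[OF weak_grad_L2v[OF m(1)] weak_grad_L2v[OF m(2)]] unfolding grad_norm_def by linarith
    have "l2_norm M v \<le> 2 * R * grad_norm \<phi> + d"
      using poincare_test_functions[OF R f(1)] 1 2 by linarith
    also have "\<dots> \<le> 2 * R * (grad_norm v + d) + d"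
      using 3 1(2) R(2) by (intro add_right_mono mult_left_mono) auto
    also have "\<dots> = 2 * R * grad_norm v + d * (2 * R + 1)" by (simp add: algebra_simps)
    also have "d * (2 * R + 1) = e" using R(2) by (simp add: d_def)
    finally show "l2_norm M v \<le> 2 * R * grad_norm v + e" .
  qed
  show thesis
  proof (rule that[of "2 * R + 1"])
    fix v assume v: "v \<in> H10"
    have "(h1_norm v)\<^sup>2 \<le> (2 * R * grad_norm v)\<^sup>2 + (grad_norm v)\<^sup>2"
      unfolding h1_norm_power2[OF H10_H1[OF v]] by (intro add_right_mono power_mono main v) simp
    also have "\<dots> \<le> ((2 * R + 1) * grad_norm v)\<^sup>2"
      using R(2) by (simp add: power2_eq_square algebra_simps)
    finally show "h1_norm v \<le> (2 * R + 1) * grad_norm v"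
      by (rule power2_le_imp_le) (use R(2) in simp)
  qed (use R in simp)
qed

text \<open>
  Poincare's inequality upgrades a Cauchy sequence for the gradient norm to one for the full
  norm.
\<close>

lemma H10_complete:
  assumes X: "\<And>n. X n \<in> H10"
    and cauchy: "\<And>e. e > 0 \<Longrightarrow> \<exists>N. \<forall>m\<ge>N. \<forall>n\<ge>N. grad_norm (X m - X n) < e"
  shows "\<exists>v\<in>H10. (\<lambda>n. grad_norm (X n - v)) \<longlonglongrightarrow> 0"
proof -
  obtain P where P: "P \<ge> 1" "\<And>v. v \<in> H10 \<Longrightarrow> h1_norm v \<le> P * grad_norm v"
    using poincare by blast
  have "\<exists>v\<in>H1. (\<lambda>n. h1_norm (X n - v)) \<longlonglongrightarrow> 0"
  proof (rule H1_complete)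
    fix e :: real assume "e > 0"
    then obtain N where N: "\<forall>m\<ge>N. \<forall>n\<ge>N. grad_norm (X m - X n) < e / P"
      using cauchy[of "e / P"] P(1) by auto
    have "h1_norm (X m - X n) < e" if "m \<ge> N" "n \<ge> N" for m n
    proof -
      have "h1_norm (X m - X n) \<le> P * grad_norm (X m - X n)"
        by (intro P(2) subspace_diff[OF H10_subspace] X)
      also have "\<dots> < e" using N that P(1) by (auto simp: field_simps)
      finally show ?thesis .
    qed
    then show "\<exists>N. \<forall>m\<ge>N. \<forall>n\<ge>N. h1_norm (X m - X n) < e" by blast
  qed (rule H10_H1[OF X])
  then obtain v where v: "v \<in> H1" and lim: "(\<lambda>n. h1_norm (X n - v)) \<longlonglongrightarrow> 0" by blast
  have "(\<lambda>n. grad_norm (X n - v)) \<longlonglongrightarrow> 0"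
    by (rule Lim_null_comparison[OF _ lim])
       (use h1_norm_ge(2)[OF H1.V_intros(3)[OF H10_H1[OF X] v]] in simp)
  then show ?thesis using H10_closed[OF X v lim] by blast
qed

section \<open>Weighted gradient forms\<close>

definition bil :: "(real^'k \<Rightarrow> real) \<Rightarrow> (real^'k \<Rightarrow> real) \<Rightarrow> (real^'k \<Rightarrow> real) \<Rightarrow> real" where
  "bil a v w = (LINT x|M. a x * (weak_grad D v x \<bullet> weak_grad D w x))"

lemma H10_weak_grad: "v \<in> H10 \<Longrightarrow> weak_grad D v \<in> L2v M"
  by (intro weak_grad_L2v H10_H1)

lemma Linf_scale_L2v:
  assumes a: "a \<in> Linf_space D" and g: "g \<in> L2v M"
  shows "(\<lambda>x. a x *\<^sub>R g x) \<in> L2v M"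
proof -
  obtain C where C: "AE x in M. \<bar>a x\<bar> \<le> C" and [measurable]: "a \<in> borel_measurable M"
    using a by (auto simp: Linf_space_def)
  have [measurable]: "g \<in> borel_measurable M" using g by (rule L2v_measurable)
  have "AE x in M. norm (a x *\<^sub>R g x) \<le> \<bar>C\<bar> * norm (g x)"
    using C by eventually_elim (auto intro!: mult_right_mono)
  then show ?thesis by (intro L2v_mono(1)[OF _ g]) auto
qed

lemma bil_integrable:
  assumes "a \<in> Linf_space D" "v \<in> H10" "w \<in> H10"
  shows "integrable M (\<lambda>x. a x * (weak_grad D v x \<bullet> weak_grad D w x))"
  using L2v_integrable_inner[OF Linf_scale_L2v[OF assms(1) H10_weak_grad[OF assms(2)]] H10_weak_grad[OF assms(3)]]
  by simp

lemma bil_sym_bilinear: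
  assumes a: "a \<in> Linf_space D"
  shows "sym_bilinear (H10) (bil a)"
proof
  show "subspace (H10)" by (rule H10_subspace)
  have am: "a \<in> borel_measurable M" using a by (simp add: Linf_space_def)
  fix x y z c assume xz: "x \<in> H10" "z \<in> H10"
  have cx: "c *\<^sub>R x \<in> H10" using xz H10_subspace by (simp add: subspace_scale)
  have "bil a (c *\<^sub>R x) z = (LINT t|M. c * (a t * (weak_grad D x t \<bullet> weak_grad D z t)))"
    unfolding bil_def
  proof (rule integral_cong_AE)
    show "AE t in M. a t * (weak_grad D (c *\<^sub>R x) t \<bullet> weak_grad D z t) = c * (a t * (weak_grad D x t \<bullet> weak_grad D z t))"
      using weak_grad_scale[OF H10_H1[OF xz(1)], of c] by eventually_elim simp
  qed (use bil_integrable[OF a cx xz(2)] bil_integrable[OF a xz] in auto)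
  then show "bil a (c *\<^sub>R x) z = c * bil a x z" by (simp add: bil_def)
  show "bil a x z = bil a z x" by (simp add: bil_def inner_commute)
  assume y: "y \<in> H10"
  have xy: "x + y \<in> H10" using xz y H10_subspace by (simp add: subspace_add)
  have "bil a (x + y) z = (LINT t|M. a t * (weak_grad D x t \<bullet> weak_grad D z t) + a t * (weak_grad D y t \<bullet> weak_grad D z t))"
    unfolding bil_def
  proof (rule integral_cong_AE)
    show "AE t in M. a t * (weak_grad D (x + y) t \<bullet> weak_grad D z t)
        = a t * (weak_grad D x t \<bullet> weak_grad D z t) + a t * (weak_grad D y t \<bullet> weak_grad D z t)"
      using weak_grad_add[OF H10_H1[OF xz(1)] H10_H1[OF y]]
      by eventually_elim (simp add: inner_add_left algebra_simps)
  qed (use bil_integrable[OF a xy xz(2)] bil_integrable[OF a xz] bil_integrable[OF a y xz(2)] in auto)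
  then show "bil a (x + y) z = bil a x z + bil a y z"
    using bil_integrable[OF a xz] bil_integrable[OF a y xz(2)] by (simp add: bil_def)
qed

lemma bil_mono:
  assumes "a \<in> Linf_space D" "b \<in> Linf_space D" "v \<in> H10" "AE x in M. a x \<le> b x"
  shows "bil a v v \<le> bil b v v"
  unfolding bil_def
proof (rule integral_mono_AE)
  show "AE x in M. a x * (weak_grad D v x \<bullet> weak_grad D v x) \<le> b x * (weak_grad D v x \<bullet> weak_grad D v x)"
    using assms(4) by eventually_elim (simp add: mult_right_mono)
qed (use assms bil_integrable in auto)

lemma Linf_const: "(\<lambda>_. c) \<in> Linf_space D"
  by (auto simp: Linf_space_def)

lemma bil_const: "bil (\<lambda>_. c) v v = c * (grad_norm v)\<^sup>2"
  by (simp add: bil_def grad_norm_def l2_norm_power2 power2_norm_eq_inner)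

lemma bil_coercive:
  assumes "a \<in> Linf_space D" "v \<in> H10" "AE x in M. r \<le> a x"
  shows "r * (grad_norm v)\<^sup>2 \<le> bil a v v"
  using bil_mono[OF Linf_const assms(1,2,3)] by (simp add: bil_const)

lemma bil_le:
  assumes "a \<in> Linf_space D" "v \<in> H10" "AE x in M. a x \<le> C"
  shows "bil a v v \<le> C * (grad_norm v)\<^sup>2"
  using bil_mono[OF assms(1) Linf_const assms(2,3)] by (simp add: bil_const)

lemma bil_bounded:
  assumes a: "a \<in> Linf_space D" and vw: "v \<in> H10" "w \<in> H10" and C: "AE x in M. \<bar>a x\<bar> \<le> C" "0 \<le> C"
  shows "\<bar>bil a v w\<bar> \<le> C * grad_norm v * grad_norm w"
proof -
  note g = H10_weak_grad[OF vw(1)] and h = H10_weak_grad[OF vw(2)]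
  note s = Linf_scale_L2v[OF a g]
  have "\<bar>bil a v w\<bar> = \<bar>l2_inner M (\<lambda>x. a x *\<^sub>R weak_grad D v x) (weak_grad D w)\<bar>"
    by (simp add: bil_def l2_inner_def)
  also have "\<dots> \<le> l2_norm M (\<lambda>x. a x *\<^sub>R weak_grad D v x) * grad_norm w"
    unfolding grad_norm_def by (rule L2.Cauchy_Schwarz[OF s h])
  also have "\<dots> \<le> (C * grad_norm v) * grad_norm w"
  proof (rule mult_right_mono)
    have "AE x in M. norm (a x *\<^sub>R weak_grad D v x) \<le> C * norm (weak_grad D v x)"
      using C(1) by eventually_elim (simp add: mult_right_mono)
    from L2v_mono(2)[OF L2v_measurable[OF s] g this C(2)]
    show "l2_norm M (\<lambda>x. a x *\<^sub>R weak_grad D v x) \<le> C * grad_norm v" by (simp add: grad_norm_def)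
  qed simp
  finally show ?thesis by simp
qed

lemma bil_linear_coeff:
  assumes "a \<in> Linf_space D" "b \<in> Linf_space D" "v \<in> H10" "w \<in> H10"
    and "AE x in M. c x = s * a x + t * b x" "c \<in> Linf_space D"
  shows "bil c v w = s * bil a v w + t * bil b v w"
proof -
  have "bil c v w = (LINT x|M. s * (a x * (weak_grad D v x \<bullet> weak_grad D w x)) + t * (b x * (weak_grad D v x \<bullet> weak_grad D w x)))"
    unfolding bil_def
  proof (rule integral_cong_AE)
    show "AE x in M. c x * (weak_grad D v x \<bullet> weak_grad D w x)
       = s * (a x * (weak_grad D v x \<bullet> weak_grad D w x)) + t * (b x * (weak_grad D v x \<bullet> weak_grad D w x))"
      using assms(5) by eventually_elim (simp add: algebra_simps)
  qed (use bil_integrable[of _ v w] assms in auto)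
  then show ?thesis
    using bil_integrable[of a v w] bil_integrable[of b v w] assms by (simp add: bil_def)
qed

lemma bil_sum_coeff:
  assumes "\<And>j. j \<in> J \<Longrightarrow> b j \<in> Linf_space D" "v \<in> H10" "w \<in> H10"
  shows "bil (\<lambda>x. \<Sum>j\<in>J. b j x) v w = (\<Sum>j\<in>J. bil (b j) v w)"
  using bil_integrable[OF assms(1) assms(2,3)]
  by (simp add: bil_def sum_distrib_right)

lemma bil_scale_coeff: "bil (\<lambda>x. s * a x) v w = s * bil a v w"
  by (simp add: bil_def mult.assoc)

lemma Linf_add:
  assumes "a \<in> Linf_space D" "b \<in> Linf_space D"
  shows "(\<lambda>x. a x + b x) \<in> Linf_space D"
proof -
  obtain A B where "AE x in M. \<bar>a x\<bar> \<le> A" "AE x in M. \<bar>b x\<bar> \<le> B"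
    using assms by (auto simp: Linf_space_def)
  then have "AE x in M. \<bar>a x + b x\<bar> \<le> A + B"
    by eventually_elim (auto intro: abs_triangle_ineq[THEN order_trans])
  then show ?thesis using assms by (auto simp: Linf_space_def)
qed

lemma Linf_sum:
  assumes "finite J" "\<And>j. j \<in> J \<Longrightarrow> b j \<in> Linf_space D"
  shows "(\<lambda>x. \<Sum>j\<in>J. b j x) \<in> Linf_space D"
  using assms by (induction J rule: finite_induct) (auto intro: Linf_const Linf_add)

lemma Linf_scale: "a \<in> Linf_space D \<Longrightarrow> (\<lambda>x. c * a x) \<in> Linf_space D"
proof -
  assume a: "a \<in> Linf_space D"
  then obtain B where B: "AE x in M. \<bar>a x\<bar> \<le> B" by (auto simp: Linf_space_def)
  have "AE x in M. \<bar>c * a x\<bar> \<le> \<bar>c\<bar> * B"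
    using B by eventually_elim (simp add: abs_mult mult_left_mono)
  then show ?thesis using a by (auto simp: Linf_space_def)
qed

lemma Linf_abs: "a \<in> Linf_space D \<Longrightarrow> (\<lambda>x. \<bar>a x\<bar>) \<in> Linf_space D"
  by (auto simp: Linf_space_def)

text \<open>
  Young's inequality applied pointwise under the integral. It is essential for the weighted
  estimate that \<open>|a|\<close> remains inside the integral, because only the sum of all \<open>|\<psi>\<^sub>j|\<close> is
  under control pointwise.
\<close>

lemma bil_young:
  assumes a: "a \<in> Linf_space D" and vw: "v \<in> H10" "w \<in> H10"
  shows "2 * \<bar>bil a v w\<bar> \<le> bil (\<lambda>x. \<bar>a x\<bar>) v v + bil (\<lambda>x. \<bar>a x\<bar>) w w"
proof -
  have "2 * \<bar>bil a v w\<bar> \<le> 2 * (LINT x|M. \<bar>a x * (weak_grad D v x \<bullet> weak_grad D w x)\<bar>)"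
    unfolding bil_def by simp
  also have "\<dots> = (LINT x|M. 2 * \<bar>a x * (weak_grad D v x \<bullet> weak_grad D w x)\<bar>)" by simp
  also have "\<dots> \<le> (LINT x|M. \<bar>a x\<bar> * (weak_grad D v x \<bullet> weak_grad D v x) + \<bar>a x\<bar> * (weak_grad D w x \<bullet> weak_grad D w x))"
  proof (rule integral_mono_AE)
    show "AE x in M. 2 * \<bar>a x * (weak_grad D v x \<bullet> weak_grad D w x)\<bar>
        \<le> \<bar>a x\<bar> * (weak_grad D v x \<bullet> weak_grad D v x) + \<bar>a x\<bar> * (weak_grad D w x \<bullet> weak_grad D w x)"
    proof (intro AE_I2)
      fix x
      have "\<bar>weak_grad D v x \<bullet> weak_grad D w x\<bar> \<le> norm (weak_grad D v x) * norm (weak_grad D w x)"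
        by (rule Cauchy_Schwarz_ineq2)
      moreover have "2 * (norm (weak_grad D v x) * norm (weak_grad D w x)) \<le> (norm (weak_grad D v x))\<^sup>2 + (norm (weak_grad D w x))\<^sup>2"
        using sum_squares_bound[of "norm (weak_grad D v x)" "norm (weak_grad D w x)"] by simp
      ultimately have "2 * \<bar>weak_grad D v x \<bullet> weak_grad D w x\<bar>
          \<le> weak_grad D v x \<bullet> weak_grad D v x + weak_grad D w x \<bullet> weak_grad D w x"
        by (simp add: power2_norm_eq_inner)
      from mult_left_mono[OF this, of "\<bar>a x\<bar>"]
      show "2 * \<bar>a x * (weak_grad D v x \<bullet> weak_grad D w x)\<bar>
        \<le> \<bar>a x\<bar> * (weak_grad D v x \<bullet> weak_grad D v x) + \<bar>a x\<bar> * (weak_grad D w x \<bullet> weak_grad D w x)"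
        by (simp add: abs_mult algebra_simps)
    qed
  qed (use bil_integrable[OF a vw] bil_integrable[OF Linf_abs[OF a] vw(1) vw(1)]
        bil_integrable[OF Linf_abs[OF a] vw(2) vw(2)] in auto)
  also have "\<dots> = bil (\<lambda>x. \<bar>a x\<bar>) v v + bil (\<lambda>x. \<bar>a x\<bar>) w w"
    using bil_integrable[OF Linf_abs[OF a] vw(1) vw(1)] bil_integrable[OF Linf_abs[OF a] vw(2) vw(2)]
    by (simp add: bil_def)
  finally show ?thesis .
qed

text \<open>
  The \<open>L\<^sup>2\<close> norm of the gradient, with its triangle inequality, as a seminorm on \<open>H\<^sup>1\<^sub>0\<close>.
\<close>

sublocale V: semi_inner "H10" "bil (\<lambda>_. 1)"
  rewrites "semi_inner.nrm (bil (\<lambda>_. 1)) = grad_norm"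
proof -
  interpret sym_bilinear "H10" "bil (\<lambda>_. 1)" by (rule bil_sym_bilinear[OF Linf_const])
  show si: "semi_inner (H10) (bil (\<lambda>_. 1))"
    by unfold_locales (simp add: bil_const)
  show "semi_inner.nrm (bil (\<lambda>_. 1)) = grad_norm"
    by (simp add: fun_eq_iff semi_inner.nrm_def[OF si] bil_const)
qed

text \<open>
  For a symmetric coercive form the Lax-Milgram lemma is Riesz representation with respect
  to the form itself, whose norm is equivalent to the gradient norm.
\<close>

lemma lax_milgram:
  assumes a: "a \<in> Linf_space D" and r: "0 < r" "AE x in M. r \<le> a x"
    and l_add: "\<And>x y. \<lbrakk>x \<in> H10; y \<in> H10\<rbrakk> \<Longrightarrow> l (x + y) = l x + l y"
    and l_scale: "\<And>c x. x \<in> H10 \<Longrightarrow> l (c *\<^sub>R x) = c * l x"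
    and bounded: "\<And>x. x \<in> H10 \<Longrightarrow> \<bar>l x\<bar> \<le> C * grad_norm x"
  shows "\<exists>w\<in>H10. \<forall>v\<in>H10. bil a w v = l v"
proof -
  interpret sym_bilinear "H10" "bil a" by (rule bil_sym_bilinear[OF a])
  interpret semi_inner "H10" "bil a"
  proof
    show "0 \<le> bil a x x" if "x \<in> H10" for x
    proof -
      have "0 \<le> r * (grad_norm x)\<^sup>2" using r(1) by simp
      then show ?thesis using bil_coercive[OF a that r(2)] by linarith
    qed
  qed
  obtain K where K: "AE x in M. \<bar>a x\<bar> \<le> K" using a by (auto simp: Linf_space_def)
  then have K': "AE x in M. a x \<le> \<bar>K\<bar>" by eventually_elim linarith
  have low: "sqrt r * grad_norm x \<le> nrm x" if "x \<in> H10" for x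
  proof (rule power2_le_imp_le)
    show "(sqrt r * grad_norm x)\<^sup>2 \<le> (nrm x)\<^sup>2"
      using bil_coercive[OF a that r(2)] r(1) that by (simp add: power_mult_distrib nrm_sq)
  qed (use that in simp)
  have up: "nrm x \<le> sqrt \<bar>K\<bar> * grad_norm x" if "x \<in> H10" for x
  proof (rule power2_le_imp_le)
    show "(nrm x)\<^sup>2 \<le> (sqrt \<bar>K\<bar> * grad_norm x)\<^sup>2"
      using bil_le[OF a that K'] that by (simp add: power_mult_distrib nrm_sq)
  qed simp
  have sr: "sqrt r > 0" using r by simp
  show ?thesis
  proof (rule riesz_representation[where C = "\<bar>C\<bar> / sqrt r"])
    fix X :: "nat \<Rightarrow> real^'k \<Rightarrow> real"
    assume X: "\<And>n. X n \<in> H10" and cau: "\<And>e. e > 0 \<Longrightarrow> \<exists>N. \<forall>m\<ge>N. \<forall>n\<ge>N. nrm (X m - X n) < e"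
    have "\<exists>v\<in>H10. (\<lambda>n. grad_norm (X n - v)) \<longlonglongrightarrow> 0"
    proof (rule H10_complete[OF X])
      fix e :: real assume "e > 0"
      then obtain N where N: "\<forall>m\<ge>N. \<forall>n\<ge>N. nrm (X m - X n) < sqrt r * e"
        using cau[of "sqrt r * e"] sr by auto
      have "grad_norm (X m - X n) < e" if "m \<ge> N" "n \<ge> N" for m n
      proof -
        have "sqrt r * grad_norm (X m - X n) < sqrt r * e"
          using N that low[OF V_intros(3)[OF X X]] le_less_trans by blast
        then show ?thesis using sr by simp
      qed
      then show "\<exists>N. \<forall>m\<ge>N. \<forall>n\<ge>N. grad_norm (X m - X n) < e" by blast
    qed
    then obtain v where v: "v \<in> H10" and lim: "(\<lambda>n. grad_norm (X n - v)) \<longlonglongrightarrow> 0" by blast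
    have "(\<lambda>n. nrm (X n - v)) \<longlonglongrightarrow> 0"
      by (rule Lim_null_comparison[OF _ tendsto_mult_right_zero[OF lim, of "sqrt \<bar>K\<bar>"]])
         (use up[OF V_intros(3)[OF X v]] nrm_nonneg[OF V_intros(3)[OF X v]] in simp)
    then show "\<exists>x\<in>H10. (\<lambda>n. nrm (X n - x)) \<longlonglongrightarrow> 0" using v by blast
  next
    fix x assume x: "x \<in> H10"
    have "\<bar>l x\<bar> \<le> \<bar>C\<bar> * grad_norm x"
      using bounded[OF x] mult_right_mono[OF abs_ge_self[of C] grad_norm_nonneg[of x]] by linarith
    also have "\<dots> \<le> \<bar>C\<bar> * (nrm x / sqrt r)"
      using low[OF x] sr by (intro mult_left_mono) (auto simp: field_simps)
    finally show "\<bar>l x\<bar> \<le> \<bar>C\<bar> / sqrt r * nrm x" by simp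
  qed (use l_add l_scale in auto)
qed

text \<open>
  The a priori estimate behind every convergence proof below: coercivity absorbs one factor
  of the norm.
\<close>

lemma energy_bound:
  assumes a: "a \<in> Linf_space D" and w: "w \<in> H10" and r: "0 < r" "AE x in M. r \<le> a x"
    and bd: "bil a w w \<le> C * grad_norm w" and C: "0 \<le> C"
  shows "grad_norm w \<le> C / r"
proof (cases "grad_norm w = 0")
  case False
  then have "grad_norm w > 0" using grad_norm_nonneg[of w] by linarith
  have "r * (grad_norm w * grad_norm w) \<le> C * grad_norm w"
    using bil_coercive[OF a w r(2)] bd by (simp add: power2_eq_square)
  then have "r * grad_norm w \<le> C" using \<open>grad_norm w > 0\<close> by (simp flip: mult.assoc)
  then show ?thesis using r by (simp add: field_simps)
qed (use C r in simp)

end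

section \<open>Multi-indices and monomials\<close>

text \<open>
  Multi-indices of order \<open>k\<close> in the first \<open>m\<close> coordinates. Fixing \<open>m\<close> makes the levels
  finite; the estimates are uniform in \<open>m\<close>.
\<close>

definition level_set :: "nat \<Rightarrow> nat \<Rightarrow> (nat \<Rightarrow> nat) set" where
  "level_set m k = {\<nu>. (\<forall>j\<ge>m. \<nu> j = 0) \<and> (\<Sum>j<m. \<nu> j) = k}"

lemma level_set_supp:
  assumes "\<nu> \<in> level_set m k"
  shows "{j. \<nu> j \<noteq> 0} \<subseteq> {..<m}"
proof
  fix j assume "j \<in> {j. \<nu> j \<noteq> 0}"
  then have "\<not> m \<le> j" using assms by (auto simp: level_set_def)
  then show "j \<in> {..<m}" by simp
qed

lemma level_set_multi: "\<nu> \<in> level_set m k \<Longrightarrow> \<nu> \<in> multi_indices"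
  using finite_subset[OF level_set_supp[of \<nu> m k]] by (simp add: multi_indices_def)

lemma finite_level_set: "finite (level_set m k)"
proof (rule finite_subset)
  show "level_set m k \<subseteq> {\<nu>. \<forall>j. (j \<in> {..<m} \<longrightarrow> \<nu> j \<in> {..k}) \<and> (j \<notin> {..<m} \<longrightarrow> \<nu> j = 0)}"
  proof (intro subsetI CollectI allI conjI impI)
    fix \<nu> j assume n: "\<nu> \<in> level_set m k" and j: "j \<in> {..<m}"
    have "\<nu> j \<le> (\<Sum>j<m. \<nu> j)" using j by (intro member_le_sum) auto
    then show "\<nu> j \<in> {..k}" using n by (simp add: level_set_def)
  qed (auto simp: level_set_def)
  show "finite {\<nu>. \<forall>j. (j \<in> {..<m} \<longrightarrow> \<nu> j \<in> {..k}) \<and> (j \<notin> {..<m} \<longrightarrow> \<nu> j = 0)}"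
    by (intro finite_set_of_finite_funs) auto
qed

lemma level_set_disjoint: "k \<noteq> l \<Longrightarrow> level_set m k \<inter> level_set m l = {}"
  by (auto simp: level_set_def)

lemma level_set_0: "level_set m 0 = {\<lambda>_. 0}"
proof (intro equalityI subsetI)
  fix \<nu> assume \<nu>: "\<nu> \<in> level_set m 0"
  have "\<nu> j = 0" for j using \<nu> by (cases "j < m") (auto simp: level_set_def)
  then show "\<nu> \<in> {\<lambda>_. 0}" by auto
qed (auto simp: level_set_def)

lemma level_set_raise:
  assumes "\<mu> \<in> level_set m k" "j < m"
  shows "\<mu>(j := Suc (\<mu> j)) \<in> level_set m (Suc k)"
proof -
  have "(\<Sum>i<m. (\<mu>(j := Suc (\<mu> j))) i) = Suc (\<mu> j) + (\<Sum>i\<in>{..<m} - {j}. \<mu> i)"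
    using assms(2) by (subst sum.remove[of _ j]) auto
  also have "\<dots> = Suc (\<Sum>i<m. \<mu> i)"
    using assms(2) by (subst (2) sum.remove[of _ j]) auto
  finally show ?thesis using assms by (auto simp: level_set_def)
qed

lemma level_set_lower:
  assumes "\<nu> \<in> level_set m (Suc k)" "\<nu> j \<noteq> 0"
  shows "\<nu>(j := \<nu> j - 1) \<in> level_set m k" "j < m"
proof -
  show j: "j < m" using level_set_supp[OF assms(1)] assms(2) by auto
  have "(\<Sum>i<m. \<nu> i) = Suc (\<Sum>i<m. (\<nu>(j := \<nu> j - 1)) i)"
    using j assms(2) by (subst (1 2) sum.remove[of _ j]) auto
  then show "\<nu>(j := \<nu> j - 1) \<in> level_set m k" using assms j by (auto simp: level_set_def)
qed

text \<open>
  Removing a unit from coordinate \<open>j\<close> is a bijection between the pairs of some \<open>\<nu>\<close> on level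
  \<open>k + 1\<close> with \<open>j\<close> in its support, and all pairs of some \<open>\<mu>\<close> on level \<open>k\<close> with a coordinate
  \<open>j < m\<close>.
\<close>

lemma sum_level_set_Suc:
  fixes G :: "nat \<Rightarrow> (nat \<Rightarrow> nat) \<Rightarrow> 'a::comm_monoid_add"
  shows "(\<Sum>\<nu>\<in>level_set m (Suc k). \<Sum>j | \<nu> j \<noteq> 0. G j \<nu>)
       = (\<Sum>\<mu>\<in>level_set m k. \<Sum>j<m. G j (\<mu>(j := Suc (\<mu> j))))"
proof -
  have fin: "finite {j. \<nu> j \<noteq> 0}" if "\<nu> \<in> level_set m (Suc k)" for \<nu>
    using level_set_supp[OF that] finite_subset by blast
  have "(\<Sum>\<nu>\<in>level_set m (Suc k). \<Sum>j | \<nu> j \<noteq> 0. G j \<nu>)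
      = (\<Sum>(\<nu>, j)\<in>(SIGMA \<nu>:level_set m (Suc k). {j. \<nu> j \<noteq> 0}). G j \<nu>)"
    by (rule sum.Sigma[OF finite_level_set]) (use fin in blast)
  also have "\<dots> = (\<Sum>(\<mu>, j)\<in>(level_set m k \<times> {..<m}). G j (\<mu>(j := Suc (\<mu> j))))"
    by (rule sum.reindex_bij_witness[where i = "\<lambda>(\<mu>, j). (\<mu>(j := Suc (\<mu> j)), j)" and j = "\<lambda>(\<nu>, j). (\<nu>(j := \<nu> j - 1), j)"])
       (auto simp: level_set_lower[unfolded One_nat_def] level_set_raise)
  also have "\<dots> = (\<Sum>\<mu>\<in>level_set m k. \<Sum>j<m. G j (\<mu>(j := Suc (\<mu> j))))"
    by (rule sum.Sigma[symmetric]) (auto simp: finite_level_set)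
  finally show ?thesis .
qed

lemma multi_power_superset:
  assumes "finite J" "{j. \<nu> j \<noteq> 0} \<subseteq> J"
  shows "multi_power y \<nu> = (\<Prod>j\<in>J. y j ^ \<nu> j)"
  unfolding multi_power_def by (rule prod.mono_neutral_left) (use assms in auto)

lemma multi_power_raise:
  assumes "\<mu> \<in> multi_indices"
  shows "multi_power y (\<mu>(j := Suc (\<mu> j))) = y j * multi_power y \<mu>"
proof -
  let ?J = "insert j {i. \<mu> i \<noteq> 0}"
  have J: "finite ?J" using assms by (simp add: multi_indices_def)
  have "multi_power y (\<mu>(j := Suc (\<mu> j))) = (\<Prod>i\<in>?J. y i ^ (\<mu>(j := Suc (\<mu> j))) i)"
    by (rule multi_power_superset[OF J]) auto
  also have "\<dots> = y j ^ Suc (\<mu> j) * (\<Prod>i\<in>?J - {j}. y i ^ \<mu> i)"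
    using J by (subst prod.remove[of _ j]) auto
  also have "\<dots> = y j * (\<Prod>i\<in>?J. y i ^ \<mu> i)"
    using J by (subst (2) prod.remove[of _ j]) auto
  also have "(\<Prod>i\<in>?J. y i ^ \<mu> i) = multi_power y \<mu>"
    by (rule multi_power_superset[OF J, symmetric]) auto
  finally show ?thesis .
qed

lemma multi_power_pos: "(\<And>j. 0 < b j) \<Longrightarrow> 0 < multi_power b \<nu>"
  unfolding multi_power_def by (intro prod_pos) simp

lemma multi_power_inverse: "multi_power (\<lambda>j. inverse (b j)) \<nu> = inverse (multi_power b \<nu>)"
  unfolding multi_power_def power_inverse by (rule prod_inversef[unfolded comp_def])

lemma multi_power_powr:
  assumes "\<And>j. 0 < b j"
  shows "multi_power (\<lambda>j. b j powr q) \<nu> = multi_power b \<nu> powr q"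
proof -
  have "(b j powr q) ^ n = (b j ^ n) powr q" for j n
    using assms[of j] by (simp add: powr_realpow[symmetric] powr_powr mult.commute)
  then show ?thesis
    unfolding multi_power_def using assms by (simp add: prod_powr_distrib less_imp_le)
qed

lemma multi_power_abs_le_1:
  assumes "y \<in> param_domain"
  shows "\<bar>multi_power y \<nu>\<bar> \<le> 1"
proof -
  have "\<bar>y j\<bar> \<le> 1" for j using assms by (auto simp: param_domain_def abs_le_iff)
  then show ?thesis
    unfolding multi_power_def abs_prod power_abs by (intro prod_le_1) (auto simp: power_le_one)
qed

text \<open>
  Expanding a product of geometric series enumerates the monomials in the first \<open>m\<close>
  variables.
\<close>

lemma sum_multi_power_le_prod:
  fixes \<beta> :: "nat \<Rightarrow> real"
  assumes \<beta>: "\<And>j. 0 < \<beta> j" "\<And>j. \<beta> j < 1"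
  shows "finite G \<Longrightarrow> (\<And>\<nu> j. \<nu> \<in> G \<Longrightarrow> j \<ge> m \<Longrightarrow> \<nu> j = 0)
    \<Longrightarrow> (\<Sum>\<nu>\<in>G. multi_power \<beta> \<nu>) \<le> (\<Prod>j<m. 1 / (1 - \<beta> j))"
proof (induction m arbitrary: G)
  case 0
  then have "G \<subseteq> {\<lambda>_. 0}" by auto
  then have "(\<Sum>\<nu>\<in>G. multi_power \<beta> \<nu>) \<le> (\<Sum>\<nu>\<in>{\<lambda>_. 0}. multi_power \<beta> \<nu>)"
    using multi_power_pos[of \<beta>, OF \<beta>(1)] by (intro sum_mono2) (auto intro: less_imp_le)
  then show ?case by (simp add: multi_power_def)
next
  case (Suc m)
  define h where "h \<nu> = (\<nu> m, \<nu>(m := 0))" for \<nu> :: "nat \<Rightarrow> nat"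
  define K where "K = (\<lambda>\<nu>. \<nu> m) ` G"
  define G' where "G' = (\<lambda>\<nu>. \<nu>(m := 0)) ` G"
  have fin: "finite K" "finite G'" using Suc.prems(1) by (auto simp: K_def G'_def)
  have inj: "inj_on h G"
    by (auto simp: inj_on_def h_def fun_eq_iff)
  have mp: "multi_power \<beta> \<nu> = \<beta> m ^ \<nu> m * multi_power \<beta> (\<nu>(m := 0))" if "\<nu> \<in> G" for \<nu>
  proof -
    have "j < Suc m" if "\<nu> j \<noteq> 0" for j using Suc.prems(2)[OF \<open>\<nu> \<in> G\<close>, of j] that by force
    then have s: "{j. \<nu> j \<noteq> 0} \<subseteq> {..<Suc m}" "{j. (\<nu>(m := 0)) j \<noteq> 0} \<subseteq> {..<m}"
      by (auto simp: less_Suc_eq)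
    then show ?thesis by (simp add: multi_power_superset[OF _ s(1)] multi_power_superset[OF _ s(2)])
  qed
  have "(\<Sum>\<nu>\<in>G. multi_power \<beta> \<nu>) = (\<Sum>\<nu>\<in>G. (\<lambda>(k, \<mu>). \<beta> m ^ k * multi_power \<beta> \<mu>) (h \<nu>))"
    by (intro sum.cong refl) (simp only: h_def case_prod_conv, rule mp)
  also have "\<dots> = (\<Sum>(k, \<mu>)\<in>h ` G. \<beta> m ^ k * multi_power \<beta> \<mu>)"
    by (simp only: sum.reindex[OF inj] comp_def)
  also have "\<dots> \<le> (\<Sum>(k, \<mu>)\<in>K \<times> G'. \<beta> m ^ k * multi_power \<beta> \<mu>)"
  proof (rule sum_mono2)
    show "h ` G \<subseteq> K \<times> G'" by (auto simp: h_def K_def G'_def)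
    show "0 \<le> (case p of (k, \<mu>) \<Rightarrow> \<beta> m ^ k * multi_power \<beta> \<mu>)" for p
      using multi_power_pos[of \<beta> "snd p", OF \<beta>(1)] \<beta>(1)[of m] by (simp add: case_prod_unfold)
  qed (use fin in simp)
  also have "\<dots> = (\<Sum>k\<in>K. \<beta> m ^ k) * (\<Sum>\<mu>\<in>G'. multi_power \<beta> \<mu>)"
    by (simp add: sum_product sum.cartesian_product)
  also have "\<dots> \<le> (1 / (1 - \<beta> m)) * (\<Prod>j<m. 1 / (1 - \<beta> j))"
  proof (rule mult_mono)
    have "(\<Sum>k\<in>K. \<beta> m ^ k) \<le> (\<Sum>k. \<beta> m ^ k)"
      using \<beta>[of m] fin(1) by (intro sum_le_suminf summable_geometric) auto
    then show "(\<Sum>k\<in>K. \<beta> m ^ k) \<le> 1 / (1 - \<beta> m)"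
      using \<beta>[of m] by (simp add: suminf_geometric)
    show "(\<Sum>\<mu>\<in>G'. multi_power \<beta> \<mu>) \<le> (\<Prod>j<m. 1 / (1 - \<beta> j))"
      using Suc.prems(2) by (intro Suc.IH fin) (auto simp: G'_def)
    show "0 \<le> (\<Sum>\<mu>\<in>G'. multi_power \<beta> \<mu>)"
      by (intro sum_nonneg less_imp_le multi_power_pos \<beta>(1))
    show "0 \<le> 1 / (1 - \<beta> m)" using \<beta>(2)[of m] by simp
  qed
  finally show ?case by (simp add: mult.commute)
qed

text \<open>
  The products \<open>\<Prod> 1 / (1 - \<beta>\<^sub>j)\<close> are bounded by \<open>exp (\<Sum> \<beta>\<^sub>j / (1 - \<beta>\<^sub>j))\<close>, and this series
  converges since \<open>\<beta>\<^sub>j / (1 - \<beta>\<^sub>j) \<le> 2 \<beta>\<^sub>j\<close> for large \<open>j\<close>.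
\<close>

lemma sum_multi_power_bounded:
  fixes \<beta> :: "nat \<Rightarrow> real"
  assumes \<beta>: "\<And>j. 0 < \<beta> j" "\<And>j. \<beta> j < 1" and summ: "summable \<beta>"
  shows "\<exists>Z. Z > 0 \<and> (\<forall>G. finite G \<longrightarrow> G \<subseteq> multi_indices \<longrightarrow> (\<Sum>\<nu>\<in>G. multi_power \<beta> \<nu>) \<le> Z)"
proof -
  have "\<beta> \<longlonglongrightarrow> 0" by (rule summable_LIMSEQ_zero[OF summ])
  then have "\<forall>\<^sub>F j in sequentially. \<beta> j < 1 / 2" by (rule order_tendstoD) simp
  then have "\<forall>\<^sub>F j in sequentially. norm (\<beta> j / (1 - \<beta> j)) \<le> 2 * \<beta> j"
  proof eventually_elim
    case (elim j)
    have "1 / (1 - \<beta> j) \<le> 2" using elim by (simp add: field_simps)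
    from mult_left_mono[OF this, of "\<beta> j"] show ?case using \<beta>[of j] by simp
  qed
  then have summ': "summable (\<lambda>j. \<beta> j / (1 - \<beta> j))"
    by (rule summable_comparison_test_ev) (rule summable_mult[OF summ])
  define Z where "Z = exp (\<Sum>j. \<beta> j / (1 - \<beta> j))"
  show ?thesis
  proof (intro exI[of _ Z] conjI allI impI)
    show "Z > 0" by (simp add: Z_def)
    fix G :: "(nat \<Rightarrow> nat) set" assume G: "finite G" "G \<subseteq> multi_indices"
    then have "finite (\<Union>\<nu>\<in>G. {j. \<nu> j \<noteq> 0})" by (auto simp: multi_indices_def)
    then obtain m where m: "\<forall>j\<in>(\<Union>\<nu>\<in>G. {j. \<nu> j \<noteq> 0}). j < m"
      unfolding finite_nat_set_iff_bounded by (rule exE)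
    have "(\<Sum>\<nu>\<in>G. multi_power \<beta> \<nu>) \<le> (\<Prod>j<m. 1 / (1 - \<beta> j))"
      using m by (intro sum_multi_power_le_prod \<beta> G(1)) (force simp: not_le)
    also have "\<dots> \<le> (\<Prod>j<m. exp (\<beta> j / (1 - \<beta> j)))"
    proof (rule prod_mono)
      fix j
      have "1 / (1 - \<beta> j) = 1 + \<beta> j / (1 - \<beta> j)" using \<beta>(2)[of j] by (simp add: field_simps)
      then have "1 / (1 - \<beta> j) \<le> exp (\<beta> j / (1 - \<beta> j))"
        using exp_ge_add_one_self[of "\<beta> j / (1 - \<beta> j)"] by simp
      moreover have "0 \<le> 1 / (1 - \<beta> j)" using \<beta>(2)[of j] by simp
      ultimately show "0 \<le> 1 / (1 - \<beta> j) \<and> 1 / (1 - \<beta> j) \<le> exp (\<beta> j / (1 - \<beta> j))" by blast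
    qed
    also have "\<dots> = exp (\<Sum>j<m. \<beta> j / (1 - \<beta> j))" by (simp add: exp_sum)
    also have "\<dots> \<le> Z"
      unfolding Z_def using \<beta> by (auto intro!: sum_le_suminf summ' divide_nonneg_pos simp: less_imp_le)
    finally show "(\<Sum>\<nu>\<in>G. multi_power \<beta> \<nu>) \<le> Z" .
  qed
qed

section \<open>Tails and partial sums of sequences in \<open>\<ell>\<^sup>q\<close>\<close>

text \<open>
  Every value off \<open>\<Lambda>\<close> is at most each of the \<open>n\<close> values on \<open>\<Lambda>\<close>, hence at most
  \<open>(Z / n)\<^sup>1\<^sup>/\<^sup>q\<close>; writing a square as \<open>\<kappa>\<^sup>2\<^sup>-\<^sup>q \<kappa>\<^sup>q\<close> then gives the bound on the tail.
\<close>

lemma stechkin: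
  fixes \<kappa> :: "'i \<Rightarrow> real"
  assumes q: "0 < q" "q \<le> 2" and \<kappa>: "\<And>\<nu>. 0 < \<kappa> \<nu>"
    and Z: "\<And>G. \<lbrakk>finite G; G \<subseteq> I\<rbrakk> \<Longrightarrow> (\<Sum>\<nu>\<in>G. \<kappa> \<nu> powr q) \<le> Z"
    and \<Lambda>: "finite \<Lambda>" "\<Lambda> \<subseteq> I" "card \<Lambda> = n" "n \<ge> 1"
    and largest: "\<And>\<nu> \<mu>. \<lbrakk>\<nu> \<in> \<Lambda>; \<mu> \<in> I - \<Lambda>\<rbrakk> \<Longrightarrow> \<kappa> \<mu> \<le> \<kappa> \<nu>"
    and G: "finite G" "G \<subseteq> I - \<Lambda>"
  shows "sqrt (\<Sum>\<nu>\<in>G. (\<kappa> \<nu>)\<^sup>2) \<le> Z powr (1 / q) * real n powr - (1 / q - 1 / 2)"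
proof -
  have Z0: "0 \<le> Z" using Z[of "{}"] by simp
  have n: "real n > 0" using \<Lambda> by simp
  have small: "\<kappa> \<mu> \<le> (Z / n) powr (1 / q)" if "\<mu> \<in> G" for \<mu>
  proof -
    have "real n * \<kappa> \<mu> powr q = (\<Sum>\<nu>\<in>\<Lambda>. \<kappa> \<mu> powr q)" using \<Lambda> by simp
    also have "\<dots> \<le> (\<Sum>\<nu>\<in>\<Lambda>. \<kappa> \<nu> powr q)"
      using largest that G \<kappa> q by (intro sum_mono powr_mono2) (auto intro: less_imp_le)
    also have "\<dots> \<le> Z" by (rule Z) (use \<Lambda> in auto)
    finally have "\<kappa> \<mu> powr q \<le> Z / n" using n by (simp add: field_simps)
    then have "(\<kappa> \<mu> powr q) powr (1 / q) \<le> (Z / n) powr (1 / q)" using q by (intro powr_mono2) auto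
    then show ?thesis using q \<kappa>[of \<mu>] by (simp add: powr_powr)
  qed
  have "(\<Sum>\<nu>\<in>G. (\<kappa> \<nu>)\<^sup>2) \<le> (\<Sum>\<nu>\<in>G. ((Z / n) powr (1 / q)) powr (2 - q) * \<kappa> \<nu> powr q)"
  proof (rule sum_mono)
    fix \<nu> assume "\<nu> \<in> G"
    have "(\<kappa> \<nu>)\<^sup>2 = \<kappa> \<nu> powr (2 - q) * \<kappa> \<nu> powr q"
      using \<kappa>[of \<nu>] by (simp add: powr_add[symmetric])
    also have "\<dots> \<le> ((Z / n) powr (1 / q)) powr (2 - q) * \<kappa> \<nu> powr q"
      using small[OF \<open>\<nu> \<in> G\<close>] \<kappa>[of \<nu>] q by (intro mult_right_mono powr_mono2) auto
    finally show "(\<kappa> \<nu>)\<^sup>2 \<le> ((Z / n) powr (1 / q)) powr (2 - q) * \<kappa> \<nu> powr q" .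
  qed
  also have "\<dots> \<le> ((Z / n) powr (1 / q)) powr (2 - q) * Z"
    unfolding sum_distrib_left[symmetric] using G by (intro mult_left_mono Z) auto
  also have "\<dots> = (Z powr (1 / q) * real n powr - (1 / q - 1 / 2))\<^sup>2"
  proof (cases "Z = 0")
    case False
    then have Zp: "Z > 0" using Z0 by simp
    have e1: "1 / q * (2 - q) = 2 / q - 1" using q by (simp add: field_simps)
    have "((Z / n) powr (1 / q)) powr (2 - q) * Z = (Z / n) powr (2 / q - 1) * Z"
      by (simp only: powr_powr e1)
    also have "\<dots> = Z powr (2 / q) * n powr - (2 / q - 1)"
      using Zp n by (simp add: powr_divide powr_diff powr_minus field_simps)
    also have "\<dots> = (Z powr (1 / q) * real n powr - (1 / q - 1 / 2))\<^sup>2"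
    proof -
      have e2: "2 / q = 1 / q + 1 / q" "- (1 / q + 1 / q - 1) = - (1 / q - 1 / 2) + - (1 / q - 1 / 2)" by simp_all
      show ?thesis unfolding e2 powr_add power_mult_distrib power2_eq_square by (simp only: mult_ac)
    qed
    finally show ?thesis .
  qed simp
  finally have "sqrt (\<Sum>\<nu>\<in>G. (\<kappa> \<nu>)\<^sup>2) \<le> sqrt ((Z powr (1 / q) * real n powr - (1 / q - 1 / 2))\<^sup>2)"
    by (rule real_sqrt_le_mono)
  then show ?thesis by simp
qed

text \<open>
  The counterpart of Stechkin's lemma for \<open>q \<ge> 2\<close>, where \<open>n\<close> terms of an \<open>\<ell>\<^sup>q\<close> sequence have
  an \<open>\<ell>\<^sup>2\<close> norm that may grow with \<open>n\<close>. Up to the constant this is Hoelder's inequality,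
  proved by splitting the terms at the size \<open>n\<^sup>-\<^sup>1\<^sup>/\<^sup>q\<close>.
\<close>

lemma l2_le_lq_growth:
  fixes \<kappa> :: "'i \<Rightarrow> real"
  assumes q: "2 \<le> q" and \<kappa>: "\<And>\<nu>. 0 < \<kappa> \<nu>"
    and Z: "(\<Sum>\<nu>\<in>\<Lambda>. \<kappa> \<nu> powr q) \<le> Z" and \<Lambda>: "finite \<Lambda>" "card \<Lambda> = n" "n \<ge> 1"
  shows "sqrt (\<Sum>\<nu>\<in>\<Lambda>. (\<kappa> \<nu>)\<^sup>2) \<le> sqrt (1 + Z) * real n powr - (1 / q - 1 / 2)"
proof -
  have n: "real n > 0" using \<Lambda> by simp
  (* Terms below this size contribute at most n times its square, terms above it are bounded by their q-th powers. *)
  define \<tau> where "\<tau> = real n powr - (1 / q)"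
  have \<tau>: "\<tau> > 0" using n by (simp add: \<tau>_def)
  have \<tau>2: "\<tau> powr (2 - q) = real n powr (1 - 2 / q)" "\<tau>\<^sup>2 * real n = real n powr (1 - 2 / q)"
  proof -
    have "- (1 / q) * (2 - q) = 1 - 2 / q" using q by (simp add: field_simps)
    then show "\<tau> powr (2 - q) = real n powr (1 - 2 / q)" by (simp add: \<tau>_def powr_powr)
    have "\<tau>\<^sup>2 * real n = real n powr - (1 / q) * real n powr - (1 / q) * real n powr 1"
      using n by (simp add: \<tau>_def power2_eq_square)
    also have "\<dots> = real n powr (1 - 2 / q)"
      unfolding powr_add[symmetric] by simp
    finally show "\<tau>\<^sup>2 * real n = real n powr (1 - 2 / q)" .
  qed
  have "(\<Sum>\<nu>\<in>\<Lambda>. (\<kappa> \<nu>)\<^sup>2) \<le> (\<Sum>\<nu>\<in>\<Lambda>. \<tau>\<^sup>2 + \<tau> powr (2 - q) * \<kappa> \<nu> powr q)"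
  proof (rule sum_mono)
    fix \<nu>
    show "(\<kappa> \<nu>)\<^sup>2 \<le> \<tau>\<^sup>2 + \<tau> powr (2 - q) * \<kappa> \<nu> powr q"
    proof (cases "\<kappa> \<nu> \<le> \<tau>")
      case True
      then have "(\<kappa> \<nu>)\<^sup>2 \<le> \<tau>\<^sup>2" using \<kappa>[of \<nu>] by (intro power_mono) auto
      then show ?thesis by (simp add: add_increasing2)
    next
      case False
      have "(\<kappa> \<nu>)\<^sup>2 = \<kappa> \<nu> powr (2 - q) * \<kappa> \<nu> powr q"
        using \<kappa>[of \<nu>] by (simp add: powr_add[symmetric])
      also have "\<dots> \<le> \<tau> powr (2 - q) * \<kappa> \<nu> powr q"
        using False \<tau> q by (intro mult_right_mono powr_mono2') auto
      finally show ?thesis by (simp add: add_increasing)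
    qed
  qed
  also have "\<dots> = \<tau>\<^sup>2 * real n + \<tau> powr (2 - q) * (\<Sum>\<nu>\<in>\<Lambda>. \<kappa> \<nu> powr q)"
    using \<Lambda> by (simp add: sum.distrib sum_distrib_left)
  also have "\<dots> \<le> real n powr (1 - 2 / q) + real n powr (1 - 2 / q) * Z"
    unfolding \<tau>2 using Z by (intro add_left_mono mult_left_mono) auto
  also have "\<dots> = (1 + Z) * real n powr (2 * - (1 / q - 1 / 2))" by (simp add: algebra_simps)
  finally have "sqrt (\<Sum>\<nu>\<in>\<Lambda>. (\<kappa> \<nu>)\<^sup>2) \<le> sqrt ((1 + Z) * real n powr (2 * - (1 / q - 1 / 2)))"
    by (rule real_sqrt_le_mono)
  also have "\<dots> = sqrt (1 + Z) * sqrt ((real n powr - (1 / q - 1 / 2))\<^sup>2)"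
    using n by (simp only: real_sqrt_mult power2_eq_square powr_add[symmetric] mult_2)
  finally show ?thesis by simp
qed

section \<open>The parametric elliptic problem\<close>

locale elliptic_family = bounded_open_set D for D :: "(real^'k) set" +
  fixes f abar :: "real^'k \<Rightarrow> real" and \<psi> :: "nat \<Rightarrow> real^'k \<Rightarrow> real"
    and u :: "(nat \<Rightarrow> real) \<Rightarrow> real^'k \<Rightarrow> real" and \<rho> :: "nat \<Rightarrow> real" and r :: real
  assumes f: "f \<in> L2_space D" and abar: "abar \<in> Linf_space D" and psi: "\<And>j. \<psi> j \<in> Linf_space D"
    and sol: "\<And>y. y \<in> param_domain \<Longrightarrow> weak_solution D (affine_coeff abar \<psi> y) f (u y)"
    and r_pos: "r > 0"
    and weights: "AE x in lebesgue_on D.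
           summable (\<lambda>j. \<rho> j * \<bar>\<psi> j x\<bar>) \<and> (\<Sum>j. \<rho> j * \<bar>\<psi> j x\<bar>) \<le> abar x - r"
    and rho_gt_1: "\<And>j. \<rho> j > 1"
begin

abbreviation A :: "(nat \<Rightarrow> real) \<Rightarrow> real^'k \<Rightarrow> real" where "A \<equiv> affine_coeff abar \<psi>"

text \<open>
  The admissible parameters are allowed to fill the larger box given by \<open>\<rho>\<close>; the unit box is
  contained in it.
\<close>

lemma param_series:
  assumes y: "\<And>j. \<bar>y j\<bar> \<le> \<rho> j"
  shows "AE x in M. summable (\<lambda>j. y j * \<psi> j x) \<and> \<bar>\<Sum>j. y j * \<psi> j x\<bar> \<le> abar x - r"
  using weights
proof eventually_elim
  case (elim x)
  have le: "norm (y j * \<psi> j x) \<le> \<rho> j * \<bar>\<psi> j x\<bar>" for j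
    using y[of j] by (simp add: abs_mult mult_right_mono)
  have s: "summable (\<lambda>j. norm (y j * \<psi> j x))"
    by (rule summable_comparison_test'[where g = "\<lambda>j. \<rho> j * \<bar>\<psi> j x\<bar>" and N = 0]) (use elim le in auto)
  have "\<bar>\<Sum>j. y j * \<psi> j x\<bar> \<le> (\<Sum>j. norm (y j * \<psi> j x))" using summable_norm[OF s] by simp
  also have "\<dots> \<le> (\<Sum>j. \<rho> j * \<bar>\<psi> j x\<bar>)" by (rule suminf_le[OF le s]) (use elim in auto)
  finally show ?case using elim summable_norm_cancel[OF s] by simp
qed

lemma param_le_rho:
  assumes "y \<in> param_domain"
  shows "\<bar>y j\<bar> \<le> \<rho> j"
proof -
  have "y j \<in> {-1..1}" using assms by (simp add: param_domain_def Pi_iff)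
  then show ?thesis using rho_gt_1[of j] by auto
qed

lemmas param_domain_series = param_series[OF param_le_rho]

lemma A_lower:
  assumes "y \<in> param_domain"
  shows "AE x in M. r \<le> A y x"
  using param_domain_series[OF assms] by eventually_elim (auto simp: affine_coeff_def)

lemma A_Linf:
  assumes "y \<in> param_domain"
  shows "A y \<in> Linf_space D"
proof -
  have m [measurable]: "abar \<in> borel_measurable M" "\<psi> j \<in> borel_measurable M" for j
    using abar psi by (auto simp: Linf_space_def)
  obtain K where K: "AE x in M. \<bar>abar x\<bar> \<le> K" using abar by (auto simp: Linf_space_def)
  have "AE x in M. \<bar>A y x\<bar> \<le> 2 * K"
    using param_domain_series[OF assms] K
    by eventually_elim (use r_pos in \<open>auto simp: affine_coeff_def\<close>)
  moreover have "A y \<in> borel_measurable M"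
    unfolding affine_coeff_def[abs_def] by measurable
  ultimately show ?thesis by (auto simp: Linf_space_def)
qed

lemma zero_param: "(\<lambda>_. 0) \<in> param_domain"
  by (simp add: param_domain_def)

lemma A_0: "A (\<lambda>_. 0) = abar"
  by (simp add: affine_coeff_def fun_eq_iff)

text \<open>
  The coefficient is affine in each parameter. This identity is what is differentiated
  below.
\<close>

lemma bil_A_update:
  assumes y: "y \<in> param_domain" and y': "y(j := y j + h) \<in> param_domain"
    and vw: "v \<in> H10" "w \<in> H10"
  shows "bil (A (y(j := y j + h))) v w = bil (A y) v w + h * bil (\<psi> j) v w"
proof -
  have "AE x in M. A (y(j := y j + h)) x = 1 * A y x + h * \<psi> j x"
    using param_domain_series[OF y]
  proof eventually_elim
    case (elim x)
    have "(\<lambda>i. y i * \<psi> i x + (if i = j then h * \<psi> i x else 0)) sums ((\<Sum>i. y i * \<psi> i x) + h * \<psi> j x)"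
      using elim by (intro sums_add summable_sums sums_single) auto
    then have "(\<lambda>i. (y(j := y j + h)) i * \<psi> i x) sums ((\<Sum>i. y i * \<psi> i x) + h * \<psi> j x)"
      by (rule sums_cong[THEN iffD1, rotated]) (auto simp: algebra_simps)
    then show ?case by (simp add: affine_coeff_def sums_iff)
  qed
  from bil_linear_coeff[OF A_Linf[OF y] psi[of j] vw this A_Linf[OF y']] show ?thesis by simp
qed

lemma bil_left:
  assumes a: "a \<in> Linf_space D" and v: "v \<in> H10"
  shows "x \<in> H10 \<Longrightarrow> z \<in> H10 \<Longrightarrow> bil a (x + z) v = bil a x v + bil a z v"
    "x \<in> H10 \<Longrightarrow> z \<in> H10 \<Longrightarrow> bil a (x - z) v = bil a x v - bil a z v"
    "x \<in> H10 \<Longrightarrow> bil a (c *\<^sub>R x) v = c * bil a x v"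
    "(\<And>i. i \<in> I \<Longrightarrow> g i \<in> H10) \<Longrightarrow> bil a (sum g I) v = (\<Sum>i\<in>I. bil a (g i) v)"
proof -
  interpret sym_bilinear "H10" "bil a" by (rule bil_sym_bilinear[OF a])
  show "x \<in> H10 \<Longrightarrow> z \<in> H10 \<Longrightarrow> bil a (x + z) v = bil a x v + bil a z v"
    "x \<in> H10 \<Longrightarrow> z \<in> H10 \<Longrightarrow> bil a (x - z) v = bil a x v - bil a z v"
    "x \<in> H10 \<Longrightarrow> bil a (c *\<^sub>R x) v = c * bil a x v"
    "(\<And>i. i \<in> I \<Longrightarrow> g i \<in> H10) \<Longrightarrow> bil a (sum g I) v = (\<Sum>i\<in>I. bil a (g i) v)"
    using v by (simp_all add: add_left diff_left scale_left sum_left)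
qed

lemma psi_bound:
  obtains C where "C \<ge> 0" "\<And>v w. v \<in> H10 \<Longrightarrow> w \<in> H10 \<Longrightarrow> \<bar>bil (\<psi> j) v w\<bar> \<le> C * grad_norm v * grad_norm w"
proof -
  obtain B where B: "AE x in M. \<bar>\<psi> j x\<bar> \<le> B" using psi[of j] by (auto simp: Linf_space_def)
  have "AE x in M. \<bar>\<psi> j x\<bar> \<le> \<bar>B\<bar>" using B by eventually_elim linarith
  then show thesis using that[of "\<bar>B\<bar>"] bil_bounded[OF psi[of j]] by simp
qed

text \<open>
  A bound of the form with coefficient \<open>\<psi>\<^sub>j\<close> with respect to the gradient norm. It enters
  qualitative limits only, so any choice serves.
\<close>

definition psi_const :: "nat \<Rightarrow> real" where
  "psi_const j = (SOME C. C \<ge> 0 \<and> (\<forall>v\<in>H10. \<forall>w\<in>H10. \<bar>bil (\<psi> j) v w\<bar> \<le> C * grad_norm v * grad_norm w))"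

lemma psi_const:
  shows "psi_const j \<ge> 0"
    and "v \<in> H10 \<Longrightarrow> w \<in> H10 \<Longrightarrow> \<bar>bil (\<psi> j) v w\<bar> \<le> psi_const j * grad_norm v * grad_norm w"
proof -
  have "\<exists>C. C \<ge> 0 \<and> (\<forall>v\<in>H10. \<forall>w\<in>H10. \<bar>bil (\<psi> j) v w\<bar> \<le> C * grad_norm v * grad_norm w)"
    using psi_bound[of j] by metis
  from someI_ex[OF this] show "psi_const j \<ge> 0"
    "v \<in> H10 \<Longrightarrow> w \<in> H10 \<Longrightarrow> \<bar>bil (\<psi> j) v w\<bar> \<le> psi_const j * grad_norm v * grad_norm w"
    unfolding psi_const_def[symmetric] by auto
qed

section \<open>Normalised derivatives of the solution map\<close>

definition msize :: "(nat \<Rightarrow> nat) \<Rightarrow> nat" where "msize \<nu> = (\<Sum>j | \<nu> j \<noteq> 0. \<nu> j)"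

lemma upd_multi_indices: "\<nu> \<in> multi_indices \<Longrightarrow> \<nu>(j := n) \<in> multi_indices"
  unfolding multi_indices_def by (auto intro: finite_subset[of _ "insert j {j. \<nu> j \<noteq> 0}"])

lemma msize_lower:
  assumes \<nu>: "\<nu> \<in> multi_indices" and j: "\<nu> j \<noteq> 0"
  shows "msize \<nu> = Suc (msize (\<nu>(j := \<nu> j - 1)))"
proof -
  let ?S = "{j. \<nu> j \<noteq> 0}"
  have fin: "finite ?S" using \<nu> by (simp add: multi_indices_def)
  have "msize (\<nu>(j := \<nu> j - 1)) = (\<Sum>i\<in>?S. (\<nu>(j := \<nu> j - 1)) i)"
    unfolding msize_def using fin j by (intro sum.mono_neutral_left) auto
  also have "\<dots> = (\<nu> j - 1) + (\<Sum>i\<in>?S - {j}. \<nu> i)"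
    using fin j by (subst sum.remove[of _ j]) auto
  finally show ?thesis
    unfolding msize_def using fin j by (subst sum.remove[of _ j]) auto
qed

lemma msize_0: "msize \<nu> = 0 \<Longrightarrow> \<nu> \<in> multi_indices \<Longrightarrow> \<nu> = (\<lambda>_. 0)"
  by (auto simp: msize_def multi_indices_def fun_eq_iff)

text \<open>
  The solution of the equation that \<open>\<partial>\<^sup>\<nu> u / \<nu>!\<close> has to satisfy, for \<open>\<nu>\<close> of order \<open>k + 1\<close>,
  given the solutions of order \<open>k\<close>. Lowering any coordinate of \<open>\<nu>\<close> lowers its order by one,
  so the recursion is on the order.
\<close>

primrec T_level :: "nat \<Rightarrow> (nat \<Rightarrow> nat) \<Rightarrow> (nat \<Rightarrow> real) \<Rightarrow> real^'k \<Rightarrow> real" where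
  "T_level 0 \<nu> y = u y"
| "T_level (Suc k) \<nu> y = (SOME w. w \<in> H10 \<and> (\<forall>v\<in>H10. bil (A y) w v
      = - (\<Sum>j | \<nu> j \<noteq> 0. bil (\<psi> j) (T_level k (\<nu>(j := \<nu> j - 1)) y) v)))"

definition T :: "(nat \<Rightarrow> nat) \<Rightarrow> (nat \<Rightarrow> real) \<Rightarrow> real^'k \<Rightarrow> real" where
  "T \<nu> = T_level (msize \<nu>) \<nu>"

text \<open>
  The right-hand side enters the equation of the undifferentiated solution only.
\<close>

definition load :: "(nat \<Rightarrow> nat) \<Rightarrow> (real^'k \<Rightarrow> real) \<Rightarrow> real" where
  "load \<nu> v = (if \<nu> = (\<lambda>_. 0) then LINT x|M. f x * v x else 0)"

lemma u_H10: "y \<in> param_domain \<Longrightarrow> u y \<in> H10"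
  using sol by (simp add: weak_solution_def)

lemma solve_step:
  assumes y: "y \<in> param_domain" and g: "\<And>j. j \<in> J \<Longrightarrow> g j \<in> H10"
  shows "\<exists>w. w \<in> H10 \<and> (\<forall>v\<in>H10. bil (A y) w v = - (\<Sum>j\<in>J. bil (\<psi> j) (g j) v))"
proof -
  have "\<exists>w\<in>H10. \<forall>v\<in>H10. bil (A y) w v = - (\<Sum>j\<in>J. bil (\<psi> j) (g j) v)"
  proof (rule lax_milgram[OF A_Linf[OF y] r_pos A_lower[OF y], where C = "\<Sum>j\<in>J. psi_const j * grad_norm (g j)"])
    fix x z c assume x: "x \<in> H10"
    have lin: "bil (\<psi> j) (g j) (c *\<^sub>R x) = c * bil (\<psi> j) (g j) x"
      "z \<in> H10 \<Longrightarrow> bil (\<psi> j) (g j) (x + z) = bil (\<psi> j) (g j) x + bil (\<psi> j) (g j) z" if "j \<in> J" for j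
    proof -
      interpret sym_bilinear "H10" "bil (\<psi> j)" by (rule bil_sym_bilinear[OF psi])
      show "bil (\<psi> j) (g j) (c *\<^sub>R x) = c * bil (\<psi> j) (g j) x"
        "z \<in> H10 \<Longrightarrow> bil (\<psi> j) (g j) (x + z) = bil (\<psi> j) (g j) x + bil (\<psi> j) (g j) z"
        using x g[OF that] by (simp_all add: scale_right add_right)
    qed
    show "- (\<Sum>j\<in>J. bil (\<psi> j) (g j) (c *\<^sub>R x)) = c * - (\<Sum>j\<in>J. bil (\<psi> j) (g j) x)"
      using lin(1) by (simp add: sum_distrib_left)
    show "- (\<Sum>j\<in>J. bil (\<psi> j) (g j) (x + z)) = - (\<Sum>j\<in>J. bil (\<psi> j) (g j) x) + - (\<Sum>j\<in>J. bil (\<psi> j) (g j) z)"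
      if "z \<in> H10" using lin(2) that by (simp add: sum.distrib)
    have "\<bar>- (\<Sum>j\<in>J. bil (\<psi> j) (g j) x)\<bar> \<le> (\<Sum>j\<in>J. \<bar>bil (\<psi> j) (g j) x\<bar>)" by simp
    also have "\<dots> \<le> (\<Sum>j\<in>J. psi_const j * grad_norm (g j) * grad_norm x)"
      using g x by (intro sum_mono psi_const(2))
    finally show "\<bar>- (\<Sum>j\<in>J. bil (\<psi> j) (g j) x)\<bar> \<le> (\<Sum>j\<in>J. psi_const j * grad_norm (g j)) * grad_norm x"
      by (simp add: sum_distrib_right)
  qed
  then show ?thesis by blast
qed

lemma T_level_props:
  assumes y: "y \<in> param_domain"
  shows "\<nu> \<in> multi_indices \<Longrightarrow> T_level k \<nu> y \<in> H10 \<and>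
    (\<forall>k'. k = Suc k' \<longrightarrow> (\<forall>v\<in>H10. bil (A y) (T_level k \<nu> y) v
      = - (\<Sum>j | \<nu> j \<noteq> 0. bil (\<psi> j) (T_level k' (\<nu>(j := \<nu> j - 1)) y) v)))"
proof (induction k arbitrary: \<nu>)
  case 0
  then show ?case using u_H10[OF y] by simp
next
  case (Suc k)
  have "\<exists>w. w \<in> H10 \<and> (\<forall>v\<in>H10. bil (A y) w v
      = - (\<Sum>j | \<nu> j \<noteq> 0. bil (\<psi> j) (T_level k (\<nu>(j := \<nu> j - 1)) y) v))"
    using Suc upd_multi_indices by (intro solve_step[OF y]) blast
  from someI_ex[OF this, folded T_level.simps(2)] show ?case by blast
qed

lemma T_H10: "y \<in> param_domain \<Longrightarrow> \<nu> \<in> multi_indices \<Longrightarrow> T \<nu> y \<in> H10"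
  using T_level_props by (simp add: T_def)

lemma T_0: "T (\<lambda>_. 0) = u"
  by (simp add: T_def msize_def fun_eq_iff)

lemma deriv_equation:
  assumes y: "y \<in> param_domain" and \<nu>: "\<nu> \<in> multi_indices" and v: "v \<in> H10"
  shows "bil (A y) (T \<nu> y) v = load \<nu> v - (\<Sum>j | \<nu> j \<noteq> 0. bil (\<psi> j) (T (\<nu>(j := \<nu> j - 1)) y) v)"
proof (cases "msize \<nu>")
  case 0
  then have 0: "\<nu> = (\<lambda>_. 0)" using msize_0 \<nu> by blast
  have "bil (A y) (u y) v = (LINT x|M. f x * v x)"
    using sol[OF y] v by (simp add: weak_solution_def bil_def)
  then show ?thesis by (simp add: 0 T_0 load_def)
next
  case (Suc k)
  then have "\<nu> \<noteq> (\<lambda>_. 0)" by (auto simp: msize_def)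
  moreover have "T (\<nu>(j := \<nu> j - 1)) y = T_level k (\<nu>(j := \<nu> j - 1)) y" if "\<nu> j \<noteq> 0" for j
    using msize_lower[OF \<nu> that] Suc by (simp add: T_def)
  ultimately show ?thesis
    using T_level_props[OF y \<nu>, of "Suc k"] v Suc by (simp add: T_def load_def)
qed

text \<open>
  The combinatorial content of differentiating the recursion once more in direction \<open>j\<close>: the
  derivative of each term, together with the term that comes from the coefficient, adds up
  to the recursion of the raised multi-index, multiplied by \<open>\<nu>\<^sub>j + 1\<close>.
\<close>

lemma raised_product_rule:
  fixes G :: "nat \<Rightarrow> (nat \<Rightarrow> nat) \<Rightarrow> real" and j :: nat
  assumes \<nu>: "\<nu> \<in> multi_indices"
  defines "\<mu> \<equiv> \<nu>(j := Suc (\<nu> j))"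
  shows "real (Suc (\<nu> j)) * (\<Sum>i | \<mu> i \<noteq> 0. G i (\<mu>(i := \<mu> i - 1)))
    = (\<Sum>i | \<nu> i \<noteq> 0. let \<nu>' = \<nu>(i := \<nu> i - 1) in real (Suc (\<nu>' j)) * G i (\<nu>'(j := Suc (\<nu>' j)))) + G j \<nu>"
proof -
  let ?S = "{i. \<nu> i \<noteq> 0}"
  have fin: "finite ?S" using \<nu> by (simp add: multi_indices_def)
  have S: "{i. \<mu> i \<noteq> 0} = insert j (?S - {j})" by (auto simp: \<mu>_def)
  have \<mu>j: "\<mu>(j := \<mu> j - 1) = \<nu>" by (simp add: \<mu>_def)
  have other: "\<mu>(i := \<mu> i - 1) = (\<nu>(i := \<nu> i - 1))(j := Suc (\<nu> j))" if "i \<noteq> j" for i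
    using that by (auto simp: \<mu>_def)
  have L: "(\<Sum>i | \<mu> i \<noteq> 0. G i (\<mu>(i := \<mu> i - 1)))
      = G j \<nu> + (\<Sum>i\<in>?S - {j}. G i ((\<nu>(i := \<nu> i - 1))(j := Suc (\<nu> j))))"
  proof -
    have "(\<Sum>i\<in>insert j (?S - {j}). G i (\<mu>(i := \<mu> i - 1)))
        = G j (\<mu>(j := \<mu> j - 1)) + (\<Sum>i\<in>?S - {j}. G i (\<mu>(i := \<mu> i - 1)))"
      using fin by (intro sum.insert) auto
    also have "(\<Sum>i\<in>?S - {j}. G i (\<mu>(i := \<mu> i - 1))) = (\<Sum>i\<in>?S - {j}. G i ((\<nu>(i := \<nu> i - 1))(j := Suc (\<nu> j))))"
      by (intro sum.cong refl) (use other in force)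
    finally show ?thesis unfolding S \<mu>j .
  qed
  define H where "H i = (let \<nu>' = \<nu>(i := \<nu> i - 1) in real (Suc (\<nu>' j)) * G i (\<nu>'(j := Suc (\<nu>' j))))" for i
  have H: "H i = real (Suc (\<nu> j)) * G i ((\<nu>(i := \<nu> i - 1))(j := Suc (\<nu> j)))" if "i \<noteq> j" for i
    using that by (simp add: H_def Let_def)
  have Hj: "H j = real (\<nu> j) * G j \<nu>" if "\<nu> j \<noteq> 0"
    using that by (simp add: H_def Let_def)
  have "(\<Sum>i\<in>?S. H i) = real (\<nu> j) * G j \<nu> + (\<Sum>i\<in>?S - {j}. H i)"
  proof (cases "\<nu> j = 0")
    case False
    then show ?thesis using fin Hj by (subst sum.remove[of _ j]) auto
  qed simp
  also have "(\<Sum>i\<in>?S - {j}. H i) = real (Suc (\<nu> j)) * (\<Sum>i\<in>?S - {j}. G i ((\<nu>(i := \<nu> i - 1))(j := Suc (\<nu> j))))"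
    unfolding sum_distrib_left by (intro sum.cong) (auto simp: H)
  finally show ?thesis unfolding L H_def[symmetric] by (simp add: algebra_simps)
qed

text \<open>
  The expected partial derivative of \<open>\<partial>\<^sup>\<nu> u / \<nu>!\<close> in direction \<open>j\<close>: the factor \<open>\<nu>\<^sub>j + 1\<close>
  comes from the factorials.
\<close>

definition dT :: "nat \<Rightarrow> (nat \<Rightarrow> nat) \<Rightarrow> (nat \<Rightarrow> real) \<Rightarrow> real^'k \<Rightarrow> real" where
  "dT j \<nu> y = real (Suc (\<nu> j)) *\<^sub>R T (\<nu>(j := Suc (\<nu> j))) y"

lemma dT_H10: "y \<in> param_domain \<Longrightarrow> \<nu> \<in> multi_indices \<Longrightarrow> dT j \<nu> y \<in> H10"
  unfolding dT_def by (intro V.V_intros(4) T_H10 upd_multi_indices)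

text \<open>
  The error of the difference quotient of order \<open>\<nu>\<close> solves the equation with coefficient at
  the shifted parameter, whose right-hand side consists of the errors of lower order and a
  term of size \<open>h\<close>. The a priori estimate and induction on the order conclude. Working with
  the shifted coefficient avoids a separate proof of continuity.
\<close>

lemma T_has_derivative:
  assumes y: "y \<in> param_domain" and \<nu>: "\<nu> \<in> multi_indices"
  shows "((\<lambda>h. grad_norm ((1 / h) *\<^sub>R (T \<nu> (y(j := y j + h)) - T \<nu> y) - dT j \<nu> y)) \<longlongrightarrow> 0)
     (at 0 within {h. y(j := y j + h) \<in> param_domain})"
  using \<nu>
proof (induction "msize \<nu>" arbitrary: \<nu> rule: less_induct)
  case less
  define F where "F = (at 0 within {h. y(j := y j + h) \<in> param_domain})"
  define E where "E \<mu> h = (1 / h) *\<^sub>R (T \<mu> (y(j := y j + h)) - T \<mu> y) - dT j \<mu> y" for \<mu> h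
  define low where "low i = \<nu>(i := \<nu> i - 1)" for i
  have low: "low i \<in> multi_indices" for i unfolding low_def by (rule upd_multi_indices[OF less.prems])
  have IH: "((\<lambda>h. grad_norm (E (low i) h)) \<longlongrightarrow> 0) F" if "\<nu> i \<noteq> 0" for i
    unfolding F_def E_def using less.hyps[OF _ low] msize_lower[OF less.prems that] by (simp add: low_def)
  define B where "B h = ((\<Sum>i | \<nu> i \<noteq> 0. psi_const i * grad_norm (E (low i) h)) + \<bar>h\<bar> * (psi_const j * grad_norm (dT j \<nu> y))) / r" for h
  have "(B \<longlongrightarrow> ((\<Sum>i | \<nu> i \<noteq> 0. psi_const i * 0) + \<bar>0\<bar> * (psi_const j * grad_norm (dT j \<nu> y))) / r) F"
    unfolding B_def using r_pos IH by (intro tendsto_intros) (auto simp: F_def intro: tendsto_ident_at)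
  then have B: "(B \<longlongrightarrow> 0) F" by simp
  have bound: "grad_norm (E \<nu> h) \<le> B h" if h: "y(j := y j + h) \<in> param_domain" "h \<noteq> 0" for h
    unfolding B_def
  proof (rule energy_bound[OF A_Linf[OF h(1)] _ r_pos A_lower[OF h(1)]])
    let ?yh = "y(j := y j + h)"
    have EH: "E \<mu> h \<in> H10" if "\<mu> \<in> multi_indices" for \<mu>
      unfolding E_def by (intro V.V_intros(3) V.V_intros(4) T_H10 dT_H10 that y h(1))
    then show e: "E \<nu> h \<in> H10" using less.prems by blast
    have id: "bil (A ?yh) (E \<nu> h) v = - (\<Sum>i | \<nu> i \<noteq> 0. bil (\<psi> i) (E (low i) h) v) - h * bil (\<psi> j) (dT j \<nu> y) v"
      if v: "v \<in> H10" for v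
    proof -
      note m = T_H10[OF h(1) less.prems] T_H10[OF y less.prems] dT_H10[OF y less.prems, of j]
      note ml = T_H10[OF h(1) low] T_H10[OF y low] dT_H10[OF y low, of j]
      note L = bil_left[OF A_Linf[OF h(1)] v]
      have 1: "bil (A ?yh) (T \<nu> ?yh) v - bil (A ?yh) (T \<nu> y) v
        = - (\<Sum>i | \<nu> i \<noteq> 0. bil (\<psi> i) (T (low i) ?yh) v - bil (\<psi> i) (T (low i) y) v) - h * bil (\<psi> j) (T \<nu> y) v"
        using deriv_equation[OF h(1) less.prems v] deriv_equation[OF y less.prems v] bil_A_update[OF y h(1) m(2) v]
        by (simp add: low_def sum_subtractf)
      have 2: "bil (A y) (dT j \<nu> y) v = - (\<Sum>i | \<nu> i \<noteq> 0. bil (\<psi> i) (dT j (low i) y) v) - bil (\<psi> j) (T \<nu> y) v"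
      proof -
        define \<mu> where "\<mu> = \<nu>(j := Suc (\<nu> j))"
        have \<mu>: "\<mu> \<in> multi_indices" unfolding \<mu>_def by (rule upd_multi_indices[OF less.prems])
        have "load \<mu> v = 0" by (auto simp: load_def \<mu>_def fun_eq_iff)
        then have "bil (A y) (dT j \<nu> y) v = - (real (Suc (\<nu> j)) * (\<Sum>i | \<mu> i \<noteq> 0. bil (\<psi> i) (T (\<mu>(i := \<mu> i - 1)) y) v))"
          unfolding dT_def \<mu>_def[symmetric] bil_left(3)[OF A_Linf[OF y] v T_H10[OF y \<mu>]] deriv_equation[OF y \<mu> v] by simp
        also have "\<dots> = - (\<Sum>i | \<nu> i \<noteq> 0. bil (\<psi> i) (dT j (low i) y) v) - bil (\<psi> j) (T \<nu> y) v"
          unfolding \<mu>_def raised_product_rule[OF less.prems, of j "\<lambda>i \<mu>. bil (\<psi> i) (T \<mu> y) v"]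
          by (simp add: dT_def low_def Let_def bil_left(3)[OF psi v T_H10[OF y upd_multi_indices[OF upd_multi_indices[OF less.prems]]]])
        finally show ?thesis .
      qed
      have 3: "bil (A ?yh) (dT j \<nu> y) v = bil (A y) (dT j \<nu> y) v + h * bil (\<psi> j) (dT j \<nu> y) v"
        by (rule bil_A_update[OF y h(1) m(3) v])
      have "bil (A ?yh) (E \<nu> h) v = (1 / h) * (bil (A ?yh) (T \<nu> ?yh) v - bil (A ?yh) (T \<nu> y) v) - bil (A ?yh) (dT j \<nu> y) v"
        unfolding E_def using m by (simp add: L)
      also have "\<dots> = - (\<Sum>i | \<nu> i \<noteq> 0. (1 / h) * (bil (\<psi> i) (T (low i) ?yh) v - bil (\<psi> i) (T (low i) y) v))
            + (\<Sum>i | \<nu> i \<noteq> 0. bil (\<psi> i) (dT j (low i) y) v) - h * bil (\<psi> j) (dT j \<nu> y) v"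
        unfolding 1 2 3 sum_distrib_left[symmetric] using h(2) by (simp add: field_simps)
      also have "\<dots> = - (\<Sum>i | \<nu> i \<noteq> 0. bil (\<psi> i) (E (low i) h) v) - h * bil (\<psi> j) (dT j \<nu> y) v"
      proof -
        have "bil (\<psi> i) (E (low i) h) v = (1 / h) * (bil (\<psi> i) (T (low i) ?yh) v - bil (\<psi> i) (T (low i) y) v) - bil (\<psi> i) (dT j (low i) y) v" for i
          unfolding E_def using ml by (simp add: bil_left[OF psi v])
        then show ?thesis by (simp add: sum_subtractf)
      qed
      finally show ?thesis .
    qed
    have "bil (A ?yh) (E \<nu> h) (E \<nu> h)
      \<le> (\<Sum>i | \<nu> i \<noteq> 0. \<bar>bil (\<psi> i) (E (low i) h) (E \<nu> h)\<bar>) + \<bar>h\<bar> * \<bar>bil (\<psi> j) (dT j \<nu> y) (E \<nu> h)\<bar>"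
    proof -
      have "- (\<Sum>i | \<nu> i \<noteq> 0. bil (\<psi> i) (E (low i) h) (E \<nu> h)) \<le> (\<Sum>i | \<nu> i \<noteq> 0. \<bar>bil (\<psi> i) (E (low i) h) (E \<nu> h)\<bar>)"
        unfolding sum_negf[symmetric] by (intro sum_mono) simp
      moreover have "- (h * bil (\<psi> j) (dT j \<nu> y) (E \<nu> h)) \<le> \<bar>h\<bar> * \<bar>bil (\<psi> j) (dT j \<nu> y) (E \<nu> h)\<bar>"
        unfolding abs_mult[symmetric] by simp
      ultimately show ?thesis unfolding id[OF e] by linarith
    qed
    also have "\<dots> \<le> (\<Sum>i | \<nu> i \<noteq> 0. psi_const i * grad_norm (E (low i) h) * grad_norm (E \<nu> h))
        + \<bar>h\<bar> * (psi_const j * grad_norm (dT j \<nu> y) * grad_norm (E \<nu> h))"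
      by (intro add_mono sum_mono mult_left_mono psi_const(2) EH low e dT_H10 y less.prems) simp
    finally show "bil (A ?yh) (E \<nu> h) (E \<nu> h)
      \<le> ((\<Sum>i | \<nu> i \<noteq> 0. psi_const i * grad_norm (E (low i) h)) + \<bar>h\<bar> * (psi_const j * grad_norm (dT j \<nu> y))) * grad_norm (E \<nu> h)"
      by (simp only: sum_distrib_right distrib_right mult.assoc)
    show "0 \<le> (\<Sum>i | \<nu> i \<noteq> 0. psi_const i * grad_norm (E (low i) h)) + \<bar>h\<bar> * (psi_const j * grad_norm (dT j \<nu> y))"
      by (intro add_nonneg_nonneg sum_nonneg mult_nonneg_nonneg psi_const(1) grad_norm_nonneg abs_ge_zero)
  qed
  have "((\<lambda>h. grad_norm (E \<nu> h)) \<longlongrightarrow> 0) F"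
  proof (rule Lim_null_comparison[OF _ B])
    show "\<forall>\<^sub>F h in F. norm (grad_norm (E \<nu> h)) \<le> B h"
      unfolding F_def eventually_at_filter using bound by (intro always_eventually) auto
  qed
  then show ?case by (simp add: E_def F_def)
qed

section \<open>Identification of the Taylor coefficients\<close>

text \<open>
  A family that agrees with a multiple of \<open>\<partial>\<^sup>\<nu> u / \<nu>!\<close> as elements of \<open>H\<^sup>1\<^sub>0\<close>, for all
  admissible parameters. Equality of representatives cannot be expected, since partial
  derivatives are defined by choice.
\<close>

definition represents :: "((nat \<Rightarrow> real) \<Rightarrow> real^'k \<Rightarrow> real) \<Rightarrow> real \<Rightarrow> (nat \<Rightarrow> nat) \<Rightarrow> bool" where
  "represents w c \<nu> \<longleftrightarrow>
     (\<forall>y\<in>param_domain. w y \<in> H10 \<and> grad_norm (w y - c *\<^sub>R T \<nu> y) = 0)"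

text \<open>
  Even on a face of the parameter domain there are admissible increments on one side, so
  limits along them are unique.
\<close>

lemma increments_nontrivial:
  assumes y: "y \<in> param_domain"
  shows "at 0 within {h. y(j := y j + h) \<in> param_domain} \<noteq> bot"
proof -
  have yi: "-1 \<le> y i \<and> y i \<le> 1" for i using y by (simp add: param_domain_def Pi_iff)
  then have "{h. y(j := y j + h) \<in> param_domain} = {-1 - y j..1 - y j}"
    by (auto simp: param_domain_def Pi_iff)
  moreover have "0 islimpt {-1 - y j..1 - y j}" using yi[of j] by simp
  ultimately show ?thesis by (simp add: trivial_limit_within)
qed

lemma H1_norm_difference_quotient:
  assumes "a \<in> H10" "b \<in> H10" "g \<in> H10"
  shows "H1_norm D (\<lambda>x. (a x - b x) / h - g x) = ennreal (h1_norm ((1 / h) *\<^sub>R (a - b) - g))"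
proof -
  have "(\<lambda>x. (a x - b x) / h - g x) = (1 / h) *\<^sub>R (a - b) - g"
    by (simp add: fun_eq_iff scaleR_fun)
  moreover have "(1 / h) *\<^sub>R (a - b) - g \<in> H10"
    using assms by (intro V.V_intros(3) V.V_intros(4))
  ultimately show ?thesis by (simp add: H1_norm_eq[OF H10_H1])
qed

lemma represents_has_param_partial:
  assumes w: "represents w c \<nu>" and \<nu>: "\<nu> \<in> multi_indices" and y: "y \<in> param_domain"
  shows "has_param_partial D j w y (c *\<^sub>R dT j \<nu> y)"
proof -
  obtain P where P: "P \<ge> 1" "\<And>v. v \<in> H10 \<Longrightarrow> h1_norm v \<le> P * grad_norm v"
    using poincare by blast
  let ?I = "{h. y(j := y j + h) \<in> param_domain}"
  define Q where "Q h = (1 / h) *\<^sub>R (T \<nu> (y(j := y j + h)) - T \<nu> y) - dT j \<nu> y" for h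
  have g: "c *\<^sub>R dT j \<nu> y \<in> H10" by (intro V.V_intros(4) dT_H10 y \<nu>)
  have wH: "w z \<in> H10" "grad_norm (w z - c *\<^sub>R T \<nu> z) = 0" if "z \<in> param_domain" for z
    using w that by (auto simp: represents_def)
  have le: "H1_norm D (\<lambda>x. (w (y(j := y j + h)) x - w y x) / h - (c *\<^sub>R dT j \<nu> y) x) \<le> ennreal (P * (\<bar>c\<bar> * grad_norm (Q h)))"
    if h: "y(j := y j + h) \<in> param_domain" for h
  proof -
    let ?yh = "y(j := y j + h)"
    let ?R = "(1 / h) *\<^sub>R (w ?yh - w y) - c *\<^sub>R dT j \<nu> y"
    let ?d = "\<lambda>z. w z - c *\<^sub>R T \<nu> z"
    note m = wH(1)[OF h] wH(1)[OF y] T_H10[OF h \<nu>] T_H10[OF y \<nu>] dT_H10[OF y \<nu>, of j]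
    have dH: "?d ?yh \<in> H10" "?d y \<in> H10" using m by (auto intro!: V.V_intros(3) V.V_intros(4))
    have QH: "Q h \<in> H10" unfolding Q_def using m by (intro V.V_intros(3) V.V_intros(4))
    have "?R = c *\<^sub>R Q h + (1 / h) *\<^sub>R (?d ?yh - ?d y)"
      by (simp add: Q_def fun_eq_iff scaleR_fun algebra_simps)
    then have "grad_norm ?R \<le> grad_norm (c *\<^sub>R Q h) + grad_norm ((1 / h) *\<^sub>R (?d ?yh - ?d y))"
      using V.nrm_triangle[OF V.V_intros(4)[OF QH] V.V_intros(4)[OF V.V_intros(3)[OF dH]], of c "1 / h"] by (simp only:)
    also have "\<dots> = \<bar>c\<bar> * grad_norm (Q h) + \<bar>1 / h\<bar> * grad_norm (?d ?yh - ?d y)"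
      using dH QH by (simp add: V.nrm_scale)
    also have "grad_norm (?d ?yh - ?d y) = 0"
      using V.nrm_triangle_diff[OF dH] wH(2)[OF h] wH(2)[OF y] grad_norm_nonneg[of "?d ?yh - ?d y"] by linarith
    finally have "grad_norm ?R \<le> \<bar>c\<bar> * grad_norm (Q h)" by (simp only: mult_zero_right add_0_right)
    then have "P * grad_norm ?R \<le> P * (\<bar>c\<bar> * grad_norm (Q h))" using P(1) by (intro mult_left_mono) auto
    moreover have "h1_norm ?R \<le> P * grad_norm ?R" using m g by (intro P(2) V.V_intros(3) V.V_intros(4))
    ultimately have "h1_norm ?R \<le> P * (\<bar>c\<bar> * grad_norm (Q h))" by linarith
    then show ?thesis unfolding H1_norm_difference_quotient[OF m(1,2) g] by (rule ennreal_leI)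
  qed
  have "((\<lambda>h. P * (\<bar>c\<bar> * grad_norm (Q h))) \<longlongrightarrow> P * (\<bar>c\<bar> * 0)) (at 0 within ?I)"
    unfolding Q_def by (intro tendsto_intros T_has_derivative y \<nu>)
  then have "((\<lambda>h. ennreal (P * (\<bar>c\<bar> * grad_norm (Q h)))) \<longlongrightarrow> ennreal 0) (at 0 within ?I)"
    by (intro tendsto_ennrealI) simp
  then have "((\<lambda>h. H1_norm D (\<lambda>x. (w (y(j := y j + h)) x - w y x) / h - (c *\<^sub>R dT j \<nu> y) x)) \<longlongrightarrow> 0) (at 0 within ?I)"
    unfolding ennreal_0
  proof (rule tendsto_sandwich[OF _ _ tendsto_const, rotated 2])
    show "\<forall>\<^sub>F h in at 0 within ?I. H1_norm D (\<lambda>x. (w (y(j := y j + h)) x - w y x) / h - (c *\<^sub>R dT j \<nu> y) x)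
        \<le> ennreal (P * (\<bar>c\<bar> * grad_norm (Q h)))"
      unfolding eventually_at_filter using le by (intro always_eventually) auto
  qed auto
  then show ?thesis using g by (simp add: has_param_partial_def)
qed

text \<open>
  Both candidates are limits of the same difference quotients.
\<close>

lemma param_partial_unique:
  assumes y: "y \<in> param_domain" and w: "\<And>z. z \<in> param_domain \<Longrightarrow> w z \<in> H10"
    and g: "has_param_partial D j w y g" and g': "has_param_partial D j w y g'"
  shows "grad_norm (g - g') = 0"
proof -
  let ?F = "at 0 within {h. y(j := y j + h) \<in> param_domain}"
  let ?Q = "\<lambda>g h. (1 / h) *\<^sub>R (w (y(j := y j + h)) - w y) - g"
  have gH: "g \<in> H10" "g' \<in> H10" using g g' by (auto simp: has_param_partial_def)
  have lim: "((\<lambda>h. h1_norm (?Q k h)) \<longlongrightarrow> 0) ?F" if k: "has_param_partial D j w y k" for k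
  proof -
    have kH: "k \<in> H10" using k by (simp add: has_param_partial_def)
    have QH: "?Q k h \<in> H10" if "y(j := y j + h) \<in> param_domain" for h
      using w[OF that] w[OF y] kH by (intro V.V_intros(3) V.V_intros(4))
    have "((\<lambda>h. H1_norm D (\<lambda>x. (w (y(j := y j + h)) x - w y x) / h - k x)) \<longlongrightarrow> 0) ?F"
      using k by (simp add: has_param_partial_def)
    moreover have "\<forall>\<^sub>F h in ?F. H1_norm D (\<lambda>x. (w (y(j := y j + h)) x - w y x) / h - k x) = ennreal (h1_norm (?Q k h))"
      unfolding eventually_at_filter using H1_norm_difference_quotient w y kH by (intro always_eventually) auto
    ultimately have "((\<lambda>h. ennreal (h1_norm (?Q k h))) \<longlongrightarrow> ennreal 0) ?F"
      by (simp add: tendsto_cong)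
    then show ?thesis
    proof (rule tendsto_ennrealD)
      show "\<forall>\<^sub>F h in ?F. 0 \<le> h1_norm (?Q k h)"
        unfolding eventually_at_filter using QH by (intro always_eventually) (auto intro!: H1.nrm_nonneg H10_H1)
    qed simp
  qed
  have "((\<lambda>h. h1_norm (?Q g' h) + h1_norm (?Q g h)) \<longlongrightarrow> 0 + 0) ?F"
    by (intro tendsto_add lim g g')
  moreover have "\<forall>\<^sub>F h in ?F. grad_norm (g - g') \<le> h1_norm (?Q g' h) + h1_norm (?Q g h)"
    unfolding eventually_at_filter
  proof (intro always_eventually allI impI)
    fix h assume "h \<in> {h. y(j := y j + h) \<in> param_domain}"
    then have h: "y(j := y j + h) \<in> param_domain" by simp
    have QH: "?Q k h \<in> H10" if "k \<in> H10" for k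
      using w[OF h] w[OF y] that by (intro V.V_intros(3) V.V_intros(4))
    have "g - g' = ?Q g' h - ?Q g h" by simp
    then have "grad_norm (g - g') \<le> grad_norm (?Q g' h) + grad_norm (?Q g h)"
      using V.nrm_triangle_diff[OF QH[OF gH(2)] QH[OF gH(1)]] by simp
    also have "\<dots> \<le> h1_norm (?Q g' h) + h1_norm (?Q g h)"
      by (intro add_mono h1_norm_ge(2) H10_H1 QH gH)
    finally show "grad_norm (g - g') \<le> h1_norm (?Q g' h) + h1_norm (?Q g h)" .
  qed
  ultimately have "grad_norm (g - g') \<le> 0 + 0"
    by (rule tendsto_lowerbound) (rule increments_nontrivial[OF y])
  then show ?thesis using grad_norm_nonneg[of "g - g'"] by linarith
qed

lemma represents_param_partial:
  assumes w: "represents w c \<nu>" and \<nu>: "\<nu> \<in> multi_indices"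
  shows "represents (param_partial D j w) (c * real (Suc (\<nu> j))) (\<nu>(j := Suc (\<nu> j)))"
  unfolding represents_def
proof
  fix y assume y: "y \<in> param_domain"
  have wH: "\<And>z. z \<in> param_domain \<Longrightarrow> w z \<in> H10" using w by (simp add: represents_def)
  note p = represents_has_param_partial[OF w \<nu> y, of j]
  have p': "has_param_partial D j w y (param_partial D j w y)"
    unfolding param_partial_def by (rule someI[of "has_param_partial D j w y", OF p])
  have "grad_norm (param_partial D j w y - c *\<^sub>R dT j \<nu> y) = 0"
    by (rule param_partial_unique[OF y wH p' p])
  moreover have "param_partial D j w y \<in> H10" using p' by (simp add: has_param_partial_def)
  ultimately show "param_partial D j w y \<in> H10 \<and>
      grad_norm (param_partial D j w y - (c * real (Suc (\<nu> j))) *\<^sub>R T (\<nu>(j := Suc (\<nu> j))) y) = 0"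
    by (simp add: dT_def)
qed

lemma represents_funpow:
  assumes w: "represents w c \<nu>" and \<nu>: "\<nu> \<in> multi_indices" "\<nu> j = 0"
  shows "represents ((param_partial D j ^^ n) w) (c * fact n) (\<nu>(j := n))"
proof (induction n)
  case 0
  have "\<nu>(j := 0) = \<nu>" using \<nu>(2) by auto
  then show ?case using w by simp
next
  case (Suc n)
  have "(\<nu>(j := n))(j := Suc ((\<nu>(j := n)) j)) = \<nu>(j := Suc n)"
    "c * fact n * real (Suc ((\<nu>(j := n)) j)) = c * fact (Suc n)" by simp_all
  then show ?case
    using represents_param_partial[OF Suc upd_multi_indices[OF \<nu>(1)], of j]
    by (simp only: funpow.simps comp_apply)
qed

text \<open>
  The coordinates are treated one after the other; the directions already treated form the
  multi-index restricted to them, and the factorials accumulate in the constant.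
\<close>

lemma represents_mixed_partial:
  assumes "\<nu> \<in> multi_indices"
  shows "represents (mixed_partial D \<nu> u) (multi_fact \<nu>) \<nu>"
proof -
  have main: "represents (foldr (\<lambda>j. param_partial D j ^^ \<nu> j) js u) (\<Prod>j\<in>set js. fact (\<nu> j))
      (\<lambda>j. if j \<in> set js then \<nu> j else 0)" if "distinct js" for js
    using that
  proof (induction js)
    case Nil
    have "grad_norm 0 = 0" by simp
    then show ?case by (simp add: represents_def T_0 u_H10)
  next
    case (Cons j js)
    let ?\<mu> = "\<lambda>j. if j \<in> set js then \<nu> j else 0"
    have m: "?\<mu> \<in> multi_indices"
      unfolding multi_indices_def by (auto intro: finite_subset[of _ "set js"])
    have "represents ((param_partial D j ^^ \<nu> j) (foldr (\<lambda>j. param_partial D j ^^ \<nu> j) js u))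
      ((\<Prod>j\<in>set js. fact (\<nu> j)) * fact (\<nu> j)) (?\<mu>(j := \<nu> j))"
      using Cons m by (intro represents_funpow) auto
    moreover have "?\<mu>(j := \<nu> j) = (\<lambda>i. if i \<in> set (j # js) then \<nu> i else 0)" by auto
    moreover have "(\<Prod>i\<in>set js. fact (\<nu> i)) * fact (\<nu> j) = (\<Prod>i\<in>set (j # js). fact (\<nu> i) :: real)"
      using Cons.prems by simp
    ultimately show ?case by simp
  qed
  have fin: "finite {j. \<nu> j \<noteq> 0}" using assms by (simp add: multi_indices_def)
  have "(\<lambda>j. if \<nu> j \<noteq> 0 then \<nu> j else 0) = \<nu>" by auto
  then show ?thesis
    using main[of "sorted_list_of_set {j. \<nu> j \<noteq> 0}"] fin
    by (simp add: mixed_partial_def multi_fact_def del: neq0_conv)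
qed

abbreviation t :: "(nat \<Rightarrow> nat) \<Rightarrow> real^'k \<Rightarrow> real" where "t \<nu> \<equiv> T \<nu> (\<lambda>_. 0)"

abbreviation weighted_norm :: "(nat \<Rightarrow> nat) \<Rightarrow> real" where
  "weighted_norm \<nu> \<equiv> multi_power \<rho> \<nu> * grad_norm (t \<nu>)"

lemma t_H10: "\<nu> \<in> multi_indices \<Longrightarrow> t \<nu> \<in> H10"
  by (rule T_H10[OF zero_param])

lemma taylor_coeff_eq:
  assumes "\<nu> \<in> multi_indices"
  shows "taylor_coeff D u \<nu> \<in> H10" "grad_norm (taylor_coeff D u \<nu> - t \<nu>) = 0"
proof -
  let ?w = "mixed_partial D \<nu> u (\<lambda>_. 0)"
  have w: "?w \<in> H10" "grad_norm (?w - multi_fact \<nu> *\<^sub>R t \<nu>) = 0"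
    using represents_mixed_partial[OF assms] zero_param by (auto simp: represents_def)
  have nz: "multi_fact \<nu> \<noteq> 0" by (cases "finite {j. \<nu> j \<noteq> 0}") (auto simp: multi_fact_def)
  have eq: "taylor_coeff D u \<nu> = (1 / multi_fact \<nu>) *\<^sub>R ?w"
    by (simp add: fun_eq_iff taylor_coeff_def scaleR_fun)
  show "taylor_coeff D u \<nu> \<in> H10" unfolding eq by (intro V.V_intros(4) w)
  have "taylor_coeff D u \<nu> - t \<nu> = (1 / multi_fact \<nu>) *\<^sub>R (?w - multi_fact \<nu> *\<^sub>R t \<nu>)"
    using nz by (simp add: eq fun_eq_iff scaleR_fun field_simps)
  then show "grad_norm (taylor_coeff D u \<nu> - t \<nu>) = 0"
    using V.nrm_scale[OF V.V_intros(3)[OF w(1) V.V_intros(4)[OF t_H10[OF assms]]]] w(2) by simp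
qed

section \<open>Weighted square summability of the Taylor coefficients\<close>

lemma taylor_equation:
  assumes "\<nu> \<in> multi_indices" "v \<in> H10" "\<nu> \<noteq> (\<lambda>_. 0)"
  shows "bil abar (t \<nu>) v = - (\<Sum>j | \<nu> j \<noteq> 0. bil (\<psi> j) (t (\<nu>(j := \<nu> j - 1))) v)"
  using deriv_equation[OF zero_param assms(1,2)] assms(3) by (simp add: A_0 load_def)

lemma abar_bound: obtains K where "K \<ge> r" "AE x in M. abar x \<le> K"
proof -
  obtain B where B: "AE x in M. \<bar>abar x\<bar> \<le> B" using abar by (auto simp: Linf_space_def)
  have "AE x in M. abar x \<le> max r B" using B by eventually_elim auto
  then show thesis using that[of "max r B"] by simp
qed

text \<open>
  The source of the geometric decay: \<open>\<Sum>\<^sub>j \<rho>\<^sub>j |\<psi>\<^sub>j| \<le> abar - r \<le> (1 - r / K) abar\<close> if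
  \<open>abar \<le> K\<close>.
\<close>

lemma contraction_factor:
  "\<exists>\<delta>. 0 \<le> \<delta> \<and> \<delta> < 1 \<and>
    (\<forall>m. \<forall>v\<in>H10. (\<Sum>j<m. \<rho> j * bil (\<lambda>x. \<bar>\<psi> j x\<bar>) v v) \<le> \<delta> * bil abar v v)"
proof -
  obtain K where K: "K \<ge> r" "AE x in M. abar x \<le> K" using abar_bound by blast
  define \<delta> where "\<delta> = 1 - r / K"
  have "K > 0" using K r_pos by simp
  then have d: "0 \<le> \<delta>" "\<delta> < 1" using K r_pos by (auto simp: \<delta>_def)
  have "(\<Sum>j<m. \<rho> j * bil (\<lambda>x. \<bar>\<psi> j x\<bar>) v v) \<le> \<delta> * bil abar v v" if v: "v \<in> H10" for m v
  proof -
    have L: "(\<lambda>x. \<rho> j * \<bar>\<psi> j x\<bar>) \<in> Linf_space D" for j by (intro Linf_scale Linf_abs psi)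
    have "(\<Sum>j<m. \<rho> j * bil (\<lambda>x. \<bar>\<psi> j x\<bar>) v v) = bil (\<lambda>x. \<Sum>j<m. \<rho> j * \<bar>\<psi> j x\<bar>) v v"
      using L v by (subst bil_sum_coeff) (auto simp: bil_scale_coeff)
    also have "\<dots> \<le> bil (\<lambda>x. \<delta> * abar x) v v"
    proof (rule bil_mono[OF Linf_sum[OF _ L] Linf_scale[OF abar] v])
      show "AE x in M. (\<Sum>j<m. \<rho> j * \<bar>\<psi> j x\<bar>) \<le> \<delta> * abar x"
        using weights K(2)
      proof eventually_elim
        case (elim x)
        have "0 \<le> \<rho> j * \<bar>\<psi> j x\<bar>" for j using rho_gt_1[of j] by simp
        then have "(\<Sum>j<m. \<rho> j * \<bar>\<psi> j x\<bar>) \<le> (\<Sum>j. \<rho> j * \<bar>\<psi> j x\<bar>)" using elim by (intro sum_le_suminf) auto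
        moreover have "(r / K) * abar x \<le> (r / K) * K" using elim r_pos \<open>K > 0\<close> by (intro mult_left_mono) auto
        ultimately show ?case using elim \<open>K > 0\<close> by (simp add: \<delta>_def algebra_simps)
      qed
    qed simp
    finally show ?thesis by (simp add: bil_scale_coeff)
  qed
  then show ?thesis using d by blast
qed

definition scaled :: "(nat \<Rightarrow> nat) \<Rightarrow> real^'k \<Rightarrow> real" where
  "scaled \<nu> = multi_power \<rho> \<nu> *\<^sub>R t \<nu>"

lemma rho_pos': "0 < \<rho> j"
  using rho_gt_1[of j] by simp

lemma scaled_H10: "\<nu> \<in> multi_indices \<Longrightarrow> scaled \<nu> \<in> H10"
  unfolding scaled_def by (intro V.V_intros(4) t_H10)

lemma grad_norm_scaled: "\<nu> \<in> multi_indices \<Longrightarrow> grad_norm (scaled \<nu>) = weighted_norm \<nu>"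
  using multi_power_pos[of \<rho> \<nu>, OF rho_pos'] by (simp add: scaled_def V.nrm_scale[OF t_H10])

text \<open>
  The recursion tested with the coefficient itself. The weight \<open>\<rho>\<^sup>\<nu>\<close> splits as
  \<open>\<rho>\<^sub>j \<rho>\<^sup>\<nu>\<^sup>-\<^sup>e\<^sup>j\<close>, which rescales \<open>\<psi>\<^sub>j\<close> by \<open>\<rho>\<^sub>j\<close>, and the mixed terms are separated by
  Young's inequality.
\<close>

lemma scaled_energy:
  assumes \<nu>: "\<nu> \<in> level_set m (Suc k)"
  shows "2 * bil abar (scaled \<nu>) (scaled \<nu>)
    \<le> (\<Sum>j | \<nu> j \<noteq> 0. \<rho> j * bil (\<lambda>x. \<bar>\<psi> j x\<bar>) (scaled (\<nu>(j := \<nu> j - 1))) (scaled (\<nu>(j := \<nu> j - 1))))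
    + (\<Sum>j<m. \<rho> j * bil (\<lambda>x. \<bar>\<psi> j x\<bar>) (scaled \<nu>) (scaled \<nu>))"
proof -
  let ?low = "\<lambda>j. \<nu>(j := \<nu> j - 1)"
  let ?s = "scaled \<nu>"
  have n: "\<nu> \<in> multi_indices" "\<nu> \<noteq> (\<lambda>_. 0)" using \<nu> level_set_multi by (auto simp: level_set_def)
  note sH = scaled_H10[OF n(1)]
  have low: "?low j \<in> multi_indices" for j by (rule upd_multi_indices[OF n(1)])
  have mp: "multi_power \<rho> \<nu> = \<rho> j * multi_power \<rho> (?low j)" if "\<nu> j \<noteq> 0" for j
    using multi_power_raise[OF low, of \<rho> j j] that by simp
  have "bil abar ?s ?s = multi_power \<rho> \<nu> * bil abar (t \<nu>) ?s"
    unfolding scaled_def by (rule bil_left(3)[OF abar]) (use sH t_H10[OF n(1)] in \<open>simp_all add: scaled_def\<close>)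
  also have "\<dots> = - (\<Sum>j | \<nu> j \<noteq> 0. \<rho> j * bil (\<psi> j) (scaled (?low j)) ?s)"
  proof -
    have "multi_power \<rho> \<nu> * bil (\<psi> j) (t (?low j)) ?s = \<rho> j * bil (\<psi> j) (scaled (?low j)) ?s" if "\<nu> j \<noteq> 0" for j
      unfolding mp[OF that] scaled_def[of "?low j"] bil_left(3)[OF psi sH t_H10[OF low]] by simp
    then show ?thesis unfolding taylor_equation[OF n(1) sH n(2)] by (simp add: sum_distrib_left)
  qed
  also have "\<dots> \<le> (\<Sum>j | \<nu> j \<noteq> 0. \<rho> j * \<bar>bil (\<psi> j) (scaled (?low j)) ?s\<bar>)"
    unfolding sum_negf[symmetric]
  proof (rule sum_mono)
    fix j
    have "\<rho> j * - bil (\<psi> j) (scaled (?low j)) ?s \<le> \<rho> j * \<bar>bil (\<psi> j) (scaled (?low j)) ?s\<bar>"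
      using rho_pos'[of j] by (intro mult_left_mono) auto
    then show "- (\<rho> j * bil (\<psi> j) (scaled (?low j)) ?s) \<le> \<rho> j * \<bar>bil (\<psi> j) (scaled (?low j)) ?s\<bar>" by simp
  qed
  finally have "2 * bil abar ?s ?s \<le> 2 * (\<Sum>j | \<nu> j \<noteq> 0. \<rho> j * \<bar>bil (\<psi> j) (scaled (?low j)) ?s\<bar>)"
    by simp
  also have "\<dots> = (\<Sum>j | \<nu> j \<noteq> 0. \<rho> j * (2 * \<bar>bil (\<psi> j) (scaled (?low j)) ?s\<bar>))"
    by (simp only: sum_distrib_left mult.left_commute)
  also have "\<dots> \<le> (\<Sum>j | \<nu> j \<noteq> 0. \<rho> j * (bil (\<lambda>x. \<bar>\<psi> j x\<bar>) (scaled (?low j)) (scaled (?low j)) + bil (\<lambda>x. \<bar>\<psi> j x\<bar>) ?s ?s))"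
    using rho_pos' by (intro sum_mono mult_left_mono bil_young psi scaled_H10 low sH less_imp_le)
  also have "\<dots> = (\<Sum>j | \<nu> j \<noteq> 0. \<rho> j * bil (\<lambda>x. \<bar>\<psi> j x\<bar>) (scaled (?low j)) (scaled (?low j)))
      + (\<Sum>j | \<nu> j \<noteq> 0. \<rho> j * bil (\<lambda>x. \<bar>\<psi> j x\<bar>) ?s ?s)"
    by (simp only: distrib_left sum.distrib)
  finally have main: "2 * bil abar ?s ?s \<le> \<dots>" .
  have "(\<Sum>j | \<nu> j \<noteq> 0. \<rho> j * bil (\<lambda>x. \<bar>\<psi> j x\<bar>) ?s ?s) \<le> (\<Sum>j<m. \<rho> j * bil (\<lambda>x. \<bar>\<psi> j x\<bar>) ?s ?s)"
  proof (rule sum_mono2[OF _ level_set_supp[OF \<nu>]])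
    fix j
    have "0 \<le> bil (\<lambda>x. \<bar>\<psi> j x\<bar>) ?s ?s"
      using bil_coercive[OF Linf_abs[OF psi[of j]] sH, of 0] by simp
    then show "0 \<le> \<rho> j * bil (\<lambda>x. \<bar>\<psi> j x\<bar>) ?s ?s" using rho_pos'[of j] by simp
  qed simp
  with main show ?thesis by linarith
qed

text \<open>
  Summing the previous estimate over a level, the first sum is reindexed to the preceding
  level. Both sums are then controlled by the contraction factor, giving
  \<open>2 S\<^sub>k\<^sub>+\<^sub>1 \<le> \<delta> S\<^sub>k + \<delta> S\<^sub>k\<^sub>+\<^sub>1\<close>.
\<close>

lemma energy_decay:
  "\<exists>\<delta>. 0 \<le> \<delta> \<and> \<delta> < 1 \<and> (\<forall>m k. (\<Sum>\<nu>\<in>level_set m k. (weighted_norm \<nu>)\<^sup>2) \<le> \<delta> ^ k * (bil abar (t (\<lambda>_. 0)) (t (\<lambda>_. 0)) / r))"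
proof -
  obtain \<delta> where d: "0 \<le> \<delta>" "\<delta> < 1" and
    "\<forall>m. \<forall>v\<in>H10. (\<Sum>j<m. \<rho> j * bil (\<lambda>x. \<bar>\<psi> j x\<bar>) v v) \<le> \<delta> * bil abar v v"
    using contraction_factor by (elim exE conjE)
  then have \<delta>: "\<And>m v. v \<in> H10 \<Longrightarrow> (\<Sum>j<m. \<rho> j * bil (\<lambda>x. \<bar>\<psi> j x\<bar>) v v) \<le> \<delta> * bil abar v v"
    by simp
  define E where "E \<nu> = bil abar (scaled \<nu>) (scaled \<nu>)" for \<nu>
  define S where "S m k = (\<Sum>\<nu>\<in>level_set m k. E \<nu>)" for m k
  have E_ge: "r * (grad_norm (scaled \<nu>))\<^sup>2 \<le> E \<nu>" if "\<nu> \<in> multi_indices" for \<nu>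
    unfolding E_def using A_lower[OF zero_param] by (intro bil_coercive abar scaled_H10 that) (simp add: A_0)
  have E0: "0 \<le> E \<nu>" if "\<nu> \<in> multi_indices" for \<nu>
  proof -
    have "0 \<le> r * (grad_norm (scaled \<nu>))\<^sup>2" using r_pos by simp
    then show ?thesis using E_ge[OF that] by linarith
  qed
  have S0: "0 \<le> S m k" for m k unfolding S_def by (intro sum_nonneg E0) (rule level_set_multi)
  have step: "S m (Suc k) \<le> \<delta> * S m k" for m k
  proof -
    define Q where "Q j \<mu> = \<rho> j * bil (\<lambda>x. \<bar>\<psi> j x\<bar>) (scaled \<mu>) (scaled \<mu>)" for j \<mu>
    have Q: "(\<Sum>j<m. Q j \<mu>) \<le> \<delta> * E \<mu>" if "\<mu> \<in> level_set m l" for \<mu> l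
      unfolding Q_def E_def by (intro \<delta> scaled_H10 level_set_multi[OF that])
    have "2 * S m (Suc k) \<le> (\<Sum>\<nu>\<in>level_set m (Suc k). (\<Sum>j | \<nu> j \<noteq> 0. Q j (\<nu>(j := \<nu> j - 1))) + (\<Sum>j<m. Q j \<nu>))"
      unfolding S_def sum_distrib_left E_def Q_def by (intro sum_mono scaled_energy)
    also have "\<dots> = (\<Sum>\<mu>\<in>level_set m k. \<Sum>j<m. Q j \<mu>) + (\<Sum>\<nu>\<in>level_set m (Suc k). \<Sum>j<m. Q j \<nu>)"
      unfolding sum.distrib sum_level_set_Suc by simp
    also have "\<dots> \<le> (\<Sum>\<mu>\<in>level_set m k. \<delta> * E \<mu>) + (\<Sum>\<nu>\<in>level_set m (Suc k). \<delta> * E \<nu>)"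
      by (intro add_mono sum_mono Q)
    also have "\<dots> = \<delta> * S m k + \<delta> * S m (Suc k)"
      by (simp add: S_def sum_distrib_left)
    finally have "(2 - \<delta>) * S m (Suc k) \<le> \<delta> * S m k" by (simp add: algebra_simps)
    (* The factor delta / (2 - delta) is replaced by the simpler delta. *)
    moreover have "1 * S m (Suc k) \<le> (2 - \<delta>) * S m (Suc k)" using d S0 by (intro mult_right_mono) auto
    ultimately show ?thesis by simp
  qed
  have S_le: "S m k \<le> \<delta> ^ k * bil abar (t (\<lambda>_. 0)) (t (\<lambda>_. 0))" for m k
  proof (induction k)
    case 0
    show ?case by (simp add: level_set_0 S_def E_def scaled_def multi_power_def)
  next
    case (Suc k)
    then show ?case using step[of m k] mult_left_mono[OF Suc d(1)] by simp
  qed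
  show ?thesis
  proof (intro exI conjI allI)
    show "0 \<le> \<delta>" "\<delta> < 1" by (rule d)+
    fix m k
    have "(\<Sum>\<nu>\<in>level_set m k. (weighted_norm \<nu>)\<^sup>2) \<le> (\<Sum>\<nu>\<in>level_set m k. E \<nu> / r)"
    proof (rule sum_mono)
      fix \<nu> assume "\<nu> \<in> level_set m k"
      then have \<nu>: "\<nu> \<in> multi_indices" by (rule level_set_multi)
      show "(weighted_norm \<nu>)\<^sup>2 \<le> E \<nu> / r"
        using E_ge[OF \<nu>] r_pos unfolding grad_norm_scaled[OF \<nu>] by (simp add: field_simps)
    qed
    also have "\<dots> \<le> \<delta> ^ k * (bil abar (t (\<lambda>_. 0)) (t (\<lambda>_. 0)) / r)"
      using S_le[of m k] r_pos by (simp add: S_def sum_divide_distrib[symmetric] divide_right_mono)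
    finally show "(\<Sum>\<nu>\<in>level_set m k. (weighted_norm \<nu>)\<^sup>2) \<le> \<delta> ^ k * (bil abar (t (\<lambda>_. 0)) (t (\<lambda>_. 0)) / r)" .
  qed
qed

lemma finite_multi_indices_bounded:
  assumes "finite G" "G \<subseteq> multi_indices"
  shows "\<exists>m N. \<forall>m'\<ge>m. \<forall>N'\<ge>N. G \<subseteq> (\<Union>k\<le>N'. level_set m' k)"
proof -
  have "finite (\<Union>\<nu>\<in>G. {j. \<nu> j \<noteq> 0})" using assms by (auto simp: multi_indices_def)
  then obtain m where m: "\<forall>j\<in>(\<Union>\<nu>\<in>G. {j. \<nu> j \<noteq> 0}). j < m"
    unfolding finite_nat_set_iff_bounded by (rule exE)
  show ?thesis
  proof (rule exI[of _ m], rule exI[of _ "\<Sum>\<nu>\<in>G. msize \<nu>"], intro allI impI subsetI)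
    fix m' N' \<nu> assume m': "m' \<ge> m" and N': "N' \<ge> (\<Sum>\<nu>\<in>G. msize \<nu>)" and \<nu>: "\<nu> \<in> G"
    have z: "\<nu> j = 0" if "j \<ge> m'" for j
    proof (rule ccontr)
      assume "\<nu> j \<noteq> 0" then have "j < m" using m \<nu> by blast
      then show False using that m' by simp
    qed
    have "(\<Sum>j<m'. \<nu> j) = msize \<nu>" unfolding msize_def
    proof (rule sum.mono_neutral_right)
      show "{j. \<nu> j \<noteq> 0} \<subseteq> {..<m'}"
      proof
        fix j assume "j \<in> {j. \<nu> j \<noteq> 0}"
        then show "j \<in> {..<m'}" using z[of j] by (cases "m' \<le> j") auto
      qed
    qed auto
    moreover have "msize \<nu> \<le> N'" using member_le_sum[OF \<nu>, of msize] assms(1) N' by simp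
    ultimately show "\<nu> \<in> (\<Union>k\<le>N'. level_set m' k)" using z by (auto simp: level_set_def)
  qed
qed

lemma sum_levels: "(\<Sum>\<nu>\<in>(\<Union>k\<le>N. level_set m k). g \<nu>) = (\<Sum>k\<le>N. \<Sum>\<nu>\<in>level_set m k. g \<nu>)"
  by (rule sum.UNION_disjoint) (auto simp: finite_level_set level_set_disjoint)

lemma weighted_l2_summable:
  "\<exists>B\<ge>0. \<forall>G. finite G \<longrightarrow> G \<subseteq> multi_indices \<longrightarrow> (\<Sum>\<nu>\<in>G. (weighted_norm \<nu>)\<^sup>2) \<le> B"
proof -
  obtain \<delta> where d: "0 \<le> \<delta>" "\<delta> < 1" and \<delta>:
    "\<forall>m k. (\<Sum>\<nu>\<in>level_set m k. (weighted_norm \<nu>)\<^sup>2) \<le> \<delta> ^ k * (bil abar (t (\<lambda>_. 0)) (t (\<lambda>_. 0)) / r)"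
    using energy_decay by (elim exE conjE)
  define b where "b = bil abar (t (\<lambda>_. 0)) (t (\<lambda>_. 0)) / r"
  have "0 \<le> (\<Sum>\<nu>\<in>level_set 0 0. (weighted_norm \<nu>)\<^sup>2)" by (intro sum_nonneg) simp
  then have b: "b \<ge> 0" using \<delta>[rule_format, of 0 0] unfolding b_def[symmetric] by simp
  show ?thesis
  proof (intro exI[of _ "b / (1 - \<delta>)"] conjI allI impI)
    show "0 \<le> b / (1 - \<delta>)" using b d by simp
    fix G :: "(nat \<Rightarrow> nat) set" assume G: "finite G" "G \<subseteq> multi_indices"
    obtain m N where "\<forall>m'\<ge>m. \<forall>N'\<ge>N. G \<subseteq> (\<Union>k\<le>N'. level_set m' k)"
      using finite_multi_indices_bounded[OF G] by (elim exE)
    then have "G \<subseteq> (\<Union>k\<le>N. level_set m k)" by blast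
    then have "(\<Sum>\<nu>\<in>G. (weighted_norm \<nu>)\<^sup>2) \<le> (\<Sum>\<nu>\<in>(\<Union>k\<le>N. level_set m k). (weighted_norm \<nu>)\<^sup>2)"
      by (intro sum_mono2) (auto simp: finite_level_set)
    also have "\<dots> \<le> (\<Sum>k\<le>N. \<delta> ^ k * b)"
      unfolding sum_levels b_def by (intro sum_mono \<delta>[rule_format])
    also have "\<dots> = (\<Sum>k\<le>N. \<delta> ^ k) * b" by (simp add: sum_distrib_right)
    also have "\<dots> \<le> (1 / (1 - \<delta>)) * b"
    proof (rule mult_right_mono[OF _ b])
      have "(\<Sum>k\<le>N. \<delta> ^ k) \<le> (\<Sum>k. \<delta> ^ k)" using d by (intro sum_le_suminf summable_geometric) auto
      then show "(\<Sum>k\<le>N. \<delta> ^ k) \<le> 1 / (1 - \<delta>)" using d by (simp add: suminf_geometric)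
    qed
    finally show "(\<Sum>\<nu>\<in>G. (weighted_norm \<nu>)\<^sup>2) \<le> b / (1 - \<delta>)" by simp
  qed
qed

lemma sum_grad_norm_le:
  assumes B: "(\<Sum>\<nu>\<in>G. (weighted_norm \<nu>)\<^sup>2) \<le> B"
  shows "(\<Sum>\<nu>\<in>G. grad_norm (t \<nu>)) \<le> sqrt B * sqrt (\<Sum>\<nu>\<in>G. (inverse (multi_power \<rho> \<nu>))\<^sup>2)"
proof -
  have "(weighted_norm \<nu>) * inverse (multi_power \<rho> \<nu>) = grad_norm (t \<nu>)" for \<nu>
    using multi_power_pos[of \<rho> \<nu>, OF rho_pos'] by simp
  then have "(\<Sum>\<nu>\<in>G. grad_norm (t \<nu>))\<^sup>2 = (\<Sum>\<nu>\<in>G. (weighted_norm \<nu>) * inverse (multi_power \<rho> \<nu>))\<^sup>2" by (simp only:)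
  also have "\<dots> \<le> (\<Sum>\<nu>\<in>G. (weighted_norm \<nu>)\<^sup>2) * (\<Sum>\<nu>\<in>G. (inverse (multi_power \<rho> \<nu>))\<^sup>2)"
    by (rule Cauchy_Schwarz_ineq_sum)
  also have "\<dots> \<le> B * (\<Sum>\<nu>\<in>G. (inverse (multi_power \<rho> \<nu>))\<^sup>2)"
    by (intro mult_right_mono B sum_nonneg) simp
  finally show ?thesis by (simp add: real_le_rsqrt real_sqrt_mult[symmetric])
qed

section \<open>Convergence of the Taylor series\<close>

lemma bil_A_finite:
  assumes y: "y \<in> param_domain" and supp: "\<And>j. j \<ge> m \<Longrightarrow> y j = 0"
    and vw: "w \<in> H10" "v \<in> H10"
  shows "bil (A y) w v = bil abar w v + (\<Sum>j<m. y j * bil (\<psi> j) w v)"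
proof -
  have L: "(\<lambda>x. y j * \<psi> j x) \<in> Linf_space D" for j by (intro Linf_scale psi)
  have "A y x = 1 * abar x + 1 * (\<Sum>j<m. y j * \<psi> j x)" for x
    unfolding affine_coeff_def using supp by (subst suminf_finite[of "{..<m}"]) auto
  then have "bil (A y) w v = 1 * bil abar w v + 1 * bil (\<lambda>x. \<Sum>j<m. y j * \<psi> j x) w v"
    by (intro bil_linear_coeff abar Linf_sum L vw A_Linf y AE_I2) auto
  also have "bil (\<lambda>x. \<Sum>j<m. y j * \<psi> j x) w v = (\<Sum>j<m. y j * bil (\<psi> j) w v)"
    using L vw by (subst bil_sum_coeff) (auto simp: bil_scale_coeff)
  finally show ?thesis by simp
qed

definition partial_sum :: "nat \<Rightarrow> nat \<Rightarrow> (nat \<Rightarrow> real) \<Rightarrow> real^'k \<Rightarrow> real" where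
  "partial_sum m N y = (\<Sum>k\<le>N. \<Sum>\<nu>\<in>level_set m k. multi_power y \<nu> *\<^sub>R t \<nu>)"

lemma level_term_H10:
  assumes "\<nu> \<in> level_set m k" shows "c *\<^sub>R t \<nu> \<in> H10"
  using level_set_multi[OF assms] by (intro V.V_intros(4) t_H10)

lemma level_sum_H10: "(\<Sum>\<nu>\<in>level_set m k. multi_power y \<nu> *\<^sub>R t \<nu>) \<in> H10"
  by (intro V.sum_in_V level_term_H10)

lemma partial_sum_H10: "partial_sum m N y \<in> H10"
  unfolding partial_sum_def by (intro V.sum_in_V level_sum_H10)

text \<open>
  If only the first \<open>m\<close> parameters are nonzero, the residual of the Taylor polynomial of
  degree \<open>N\<close> telescopes over the levels and only the top level remains.
\<close>

lemma residual_equation: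
  assumes y: "y \<in> param_domain" and supp: "\<And>j. j \<ge> m \<Longrightarrow> y j = 0" and v: "v \<in> H10"
  shows "bil (A y) (u y - partial_sum m N y) v
    = - (\<Sum>\<mu>\<in>level_set m N. \<Sum>j<m. y j * multi_power y \<mu> * bil (\<psi> j) (t \<mu>) v)"
proof (induction N)
  note L = bil_left[OF A_Linf[OF y] v]
  have uH: "u y \<in> H10" "u (\<lambda>_. 0) \<in> H10" by (intro u_H10 y zero_param)+
  case 0
  have p0: "partial_sum m 0 y = u (\<lambda>_. 0)"
    by (simp add: partial_sum_def level_set_0 T_0 multi_power_def)
  have "bil (A y) (u y) v = bil abar (u (\<lambda>_. 0)) v"
    using sol[OF y] sol[OF zero_param] v by (simp add: weak_solution_def bil_def A_0)
  moreover have "bil (A y) (u (\<lambda>_. 0)) v = bil abar (u (\<lambda>_. 0)) v + (\<Sum>j<m. y j * bil (\<psi> j) (u (\<lambda>_. 0)) v)"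
    by (rule bil_A_finite[OF y supp uH(2) v])
  ultimately show ?case
    unfolding p0 L(2)[OF uH] by (simp add: level_set_0 T_0 multi_power_def)
next
  note L = bil_left[OF A_Linf[OF y] v]
  case (Suc N)
  define R where "R = (\<Sum>\<nu>\<in>level_set m (Suc N). multi_power y \<nu> *\<^sub>R t \<nu>)"
  have RH: "R \<in> H10" unfolding R_def by (rule level_sum_H10)
  have pH: "u y - partial_sum m N y \<in> H10" by (intro V.V_intros(3) u_H10 y partial_sum_H10)
  have next_sum: "u y - partial_sum m (Suc N) y = (u y - partial_sum m N y) - R"
    by (simp add: partial_sum_def R_def)
  have 1: "bil (A y) (u y - partial_sum m (Suc N) y) v
      = - (\<Sum>\<mu>\<in>level_set m N. \<Sum>j<m. y j * multi_power y \<mu> * bil (\<psi> j) (t \<mu>) v) - bil (A y) R v"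
    unfolding next_sum L(2)[OF pH RH] Suc ..
  have "bil (A y) R v = (\<Sum>\<nu>\<in>level_set m (Suc N). multi_power y \<nu> * bil (A y) (t \<nu>) v)"
    unfolding R_def using L(4)[of "level_set m (Suc N)" "\<lambda>\<nu>. multi_power y \<nu> *\<^sub>R t \<nu>", OF level_term_H10]
    by (auto simp: L(3)[OF t_H10[OF level_set_multi]] intro!: sum.cong)
  also have "\<dots> = (\<Sum>\<nu>\<in>level_set m (Suc N). - (\<Sum>j | \<nu> j \<noteq> 0. multi_power y \<nu> * bil (\<psi> j) (t (\<nu>(j := \<nu> j - 1))) v)
        + (\<Sum>j<m. y j * multi_power y \<nu> * bil (\<psi> j) (t \<nu>) v))"
  proof (rule sum.cong[OF refl])
    fix \<nu> assume n: "\<nu> \<in> level_set m (Suc N)"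
    then have \<nu>: "\<nu> \<in> multi_indices" "\<nu> \<noteq> (\<lambda>_. 0)" using level_set_multi by (auto simp: level_set_def)
    have split: "bil (A y) (t \<nu>) v = bil abar (t \<nu>) v + (\<Sum>j<m. y j * bil (\<psi> j) (t \<nu>) v)"
      by (rule bil_A_finite[OF y supp t_H10[OF \<nu>(1)] v])
    have "multi_power y \<nu> * bil (A y) (t \<nu>) v
      = multi_power y \<nu> * - (\<Sum>j | \<nu> j \<noteq> 0. bil (\<psi> j) (t (\<nu>(j := \<nu> j - 1))) v)
        + multi_power y \<nu> * (\<Sum>j<m. y j * bil (\<psi> j) (t \<nu>) v)"
      unfolding split taylor_equation[OF \<nu>(1) v \<nu>(2)] by (rule distrib_left)
    then show "multi_power y \<nu> * bil (A y) (t \<nu>) v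
      = - (\<Sum>j | \<nu> j \<noteq> 0. multi_power y \<nu> * bil (\<psi> j) (t (\<nu>(j := \<nu> j - 1))) v)
        + (\<Sum>j<m. y j * multi_power y \<nu> * bil (\<psi> j) (t \<nu>) v)"
      by (simp only: sum_distrib_left mult_minus_right mult_ac)
  qed
  also have "\<dots> = - (\<Sum>\<nu>\<in>level_set m (Suc N). \<Sum>j | \<nu> j \<noteq> 0. multi_power y \<nu> * bil (\<psi> j) (t (\<nu>(j := \<nu> j - 1))) v)
        + (\<Sum>\<nu>\<in>level_set m (Suc N). \<Sum>j<m. y j * multi_power y \<nu> * bil (\<psi> j) (t \<nu>) v)"
    by (simp only: sum.distrib sum_negf)
  also have "(\<Sum>\<nu>\<in>level_set m (Suc N). \<Sum>j | \<nu> j \<noteq> 0. multi_power y \<nu> * bil (\<psi> j) (t (\<nu>(j := \<nu> j - 1))) v)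
      = (\<Sum>\<mu>\<in>level_set m N. \<Sum>j<m. y j * multi_power y \<mu> * bil (\<psi> j) (t \<mu>) v)"
    unfolding sum_level_set_Suc[where G = "\<lambda>j \<nu>. multi_power y \<nu> * bil (\<psi> j) (t (\<nu>(j := \<nu> j - 1))) v"]
    by (intro sum.cong refl) (simp add: multi_power_raise[OF level_set_multi])
  finally show ?case unfolding 1 by simp
qed

text \<open>
  The residual is bounded by the sum of \<open>\<parallel>t\<^sub>\<mu>\<parallel>\<close> over level \<open>N\<close>, which tends to zero by the
  Cauchy-Schwarz inequality and the geometric decay of the weighted energies.
\<close>

lemma partial_sum_converges:
  assumes y: "y \<in> param_domain" and supp: "\<And>j. j \<ge> m \<Longrightarrow> y j = 0"
    and Z: "\<And>G. \<lbrakk>finite G; G \<subseteq> multi_indices\<rbrakk> \<Longrightarrow> (\<Sum>\<nu>\<in>G. (inverse (multi_power \<rho> \<nu>))\<^sup>2) \<le> Z"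
  shows "(\<lambda>N. grad_norm (u y - partial_sum m N y)) \<longlonglongrightarrow> 0"
proof -
  define b where "b = bil abar (t (\<lambda>_. 0)) (t (\<lambda>_. 0)) / r"
  obtain \<delta> where d: "0 \<le> \<delta>" "\<delta> < 1" and \<delta>:
    "\<forall>m k. (\<Sum>\<nu>\<in>level_set m k. (weighted_norm \<nu>)\<^sup>2) \<le> \<delta> ^ k * b"
    unfolding b_def using energy_decay by (elim exE conjE)
  have "0 \<le> (\<Sum>\<nu>\<in>level_set 0 0. (weighted_norm \<nu>)\<^sup>2)" by (intro sum_nonneg) simp
  then have b: "b \<ge> 0" using \<delta>[rule_format, of 0 0] by simp
  define C where "C = (\<Sum>j<m. psi_const j)"
  have C: "C \<ge> 0" unfolding C_def by (intro sum_nonneg psi_const(1))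
  have level: "(\<Sum>\<nu>\<in>level_set m N. grad_norm (t \<nu>)) \<le> sqrt (\<delta> ^ N * b * Z)" for N
  proof -
    have lv: "finite (level_set m N)" "level_set m N \<subseteq> multi_indices"
      using finite_level_set level_set_multi by auto
    have "(\<Sum>\<nu>\<in>level_set m N. grad_norm (t \<nu>))
        \<le> sqrt (\<delta> ^ N * b) * sqrt (\<Sum>\<nu>\<in>level_set m N. (inverse (multi_power \<rho> \<nu>))\<^sup>2)"
      using \<delta> by (intro sum_grad_norm_le) blast
    also have "\<dots> \<le> sqrt (\<delta> ^ N * b) * sqrt Z"
      using Z[OF lv] d b by (intro mult_left_mono real_sqrt_le_mono) auto
    finally show ?thesis by (simp only: real_sqrt_mult)
  qed
  have bound: "grad_norm (u y - partial_sum m N y) \<le> C * sqrt (\<delta> ^ N * b * Z) / r" for N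
  proof (rule energy_bound[OF A_Linf[OF y] _ r_pos A_lower[OF y]])
    let ?e = "u y - partial_sum m N y"
    show e: "?e \<in> H10" by (intro V.V_intros(3) u_H10 y partial_sum_H10)
    have y1: "\<bar>y j\<bar> \<le> 1" for j using y by (auto simp: param_domain_def Pi_iff abs_le_iff)
    have res: "bil (A y) ?e ?e = - (\<Sum>\<mu>\<in>level_set m N. \<Sum>j<m. y j * multi_power y \<mu> * bil (\<psi> j) (t \<mu>) ?e)"
      by (rule residual_equation[OF y supp e])
    have "bil (A y) ?e ?e \<le> (\<Sum>\<mu>\<in>level_set m N. \<Sum>j<m. \<bar>y j * multi_power y \<mu> * bil (\<psi> j) (t \<mu>) ?e\<bar>)"
      unfolding res sum_negf[symmetric] by (intro sum_mono) simp
    also have "\<dots> \<le> (\<Sum>\<mu>\<in>level_set m N. \<Sum>j<m. psi_const j * grad_norm (t \<mu>) * grad_norm ?e)"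
    proof (intro sum_mono)
      fix \<mu> j assume \<mu>: "\<mu> \<in> level_set m N"
      have "\<bar>y j * multi_power y \<mu>\<bar> \<le> 1 * 1"
        unfolding abs_mult by (intro mult_mono y1 multi_power_abs_le_1 y) auto
      then have "\<bar>y j * multi_power y \<mu>\<bar> * \<bar>bil (\<psi> j) (t \<mu>) ?e\<bar> \<le> 1 * \<bar>bil (\<psi> j) (t \<mu>) ?e\<bar>"
        by (intro mult_right_mono) auto
      also have "\<dots> \<le> psi_const j * grad_norm (t \<mu>) * grad_norm ?e"
        using psi_const(2)[OF t_H10[OF level_set_multi[OF \<mu>]] e] by simp
      finally show "\<bar>y j * multi_power y \<mu> * bil (\<psi> j) (t \<mu>) ?e\<bar> \<le> psi_const j * grad_norm (t \<mu>) * grad_norm ?e"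
        by (simp only: abs_mult)
    qed
    also have "\<dots> = (C * (\<Sum>\<mu>\<in>level_set m N. grad_norm (t \<mu>))) * grad_norm ?e"
    proof -
      have "C * (\<Sum>\<mu>\<in>level_set m N. grad_norm (t \<mu>)) = (\<Sum>j<m. \<Sum>\<mu>\<in>level_set m N. psi_const j * grad_norm (t \<mu>))"
        unfolding C_def by (rule sum_product)
      also have "\<dots> = (\<Sum>\<mu>\<in>level_set m N. \<Sum>j<m. psi_const j * grad_norm (t \<mu>))" by (rule sum.swap)
      finally show ?thesis by (simp only: sum_distrib_right)
    qed
    also have "\<dots> \<le> (C * sqrt (\<delta> ^ N * b * Z)) * grad_norm ?e"
      by (intro mult_right_mono mult_left_mono level C grad_norm_nonneg)
    finally show "bil (A y) ?e ?e \<le> (C * sqrt (\<delta> ^ N * b * Z)) * grad_norm ?e" .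
    have "0 \<le> (\<Sum>\<nu>\<in>level_set m N. grad_norm (t \<nu>))" by (intro sum_nonneg grad_norm_nonneg)
    then show "0 \<le> C * sqrt (\<delta> ^ N * b * Z)" using level[of N] C by (intro mult_nonneg_nonneg) linarith+
  qed
  have "(\<lambda>N. C * sqrt (\<delta> ^ N * b * Z) / r) \<longlonglongrightarrow> C * sqrt (0 * b * Z) / r"
    using d r_pos by (intro tendsto_intros LIMSEQ_realpow_zero) auto
  then have "(\<lambda>N. C * sqrt (\<delta> ^ N * b * Z) / r) \<longlonglongrightarrow> 0" by simp
  then show ?thesis
    by (rule Lim_null_comparison[rotated]) (use bound in simp)
qed

definition truncate :: "nat \<Rightarrow> (nat \<Rightarrow> real) \<Rightarrow> nat \<Rightarrow> real" where
  "truncate m y j = (if j < m then y j else 0)"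

lemma truncate_param: "y \<in> param_domain \<Longrightarrow> truncate m y \<in> param_domain"
  by (auto simp: param_domain_def truncate_def Pi_iff)

text \<open>
  The truncated coefficients converge pointwise almost everywhere, in general not uniformly,
  but against the fixed square-integrable gradient of \<open>u y\<close> dominated convergence applies.
\<close>

lemma truncation_converges:
  assumes y: "y \<in> param_domain"
  shows "(\<lambda>m. grad_norm (u y - u (truncate m y))) \<longlonglongrightarrow> 0"
proof -
  let ?G = "weak_grad D (u y)"
  note yt = truncate_param[OF y]
  note GL = H10_weak_grad[OF u_H10[OF y]]
  define d where "d m x = A (truncate m y) x - A y x" for m x
  obtain K where K: "K \<ge> r" "AE x in M. abar x \<le> K" using abar_bound by blast
  have dL: "d m \<in> Linf_space D" for m
    using Linf_add[OF A_Linf[OF yt] Linf_scale[OF A_Linf[OF y], of "- 1"]] by (simp add: d_def[abs_def])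
  have ub: "AE x in M. \<bar>A z x\<bar> \<le> 2 * K" if z: "z \<in> param_domain" for z
    using param_domain_series[OF z] A_lower[OF z] K(2)
    by eventually_elim (use r_pos in \<open>auto simp: affine_coeff_def\<close>)
  have [measurable]: "d m \<in> borel_measurable M" "?G \<in> borel_measurable M" for m
    using dL[of m] L2v_measurable[OF GL] by (auto simp: Linf_space_def)
  have lim: "(\<lambda>m. LINT x|M. (norm (d m x *\<^sub>R ?G x))\<^sup>2) \<longlonglongrightarrow> (LINT x|M. 0)"
  proof (rule integral_dominated_convergence[where w = "\<lambda>x. (4 * K)\<^sup>2 * (norm (?G x))\<^sup>2"])
    show "integrable M (\<lambda>x. (4 * K)\<^sup>2 * (norm (?G x))\<^sup>2)"
      using L2v_integrable[OF GL] by simp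
    show "AE x in M. (\<lambda>m. (norm (d m x *\<^sub>R ?G x))\<^sup>2) \<longlonglongrightarrow> 0"
      using param_domain_series[OF y]
    proof eventually_elim
      case (elim x)
      have "d m x = (\<Sum>j<m. y j * \<psi> j x) - (\<Sum>j. y j * \<psi> j x)" for m
        unfolding d_def affine_coeff_def
        by (subst suminf_finite[of "{..<m}" "\<lambda>j. truncate m y j * \<psi> j x"]) (auto simp: truncate_def)
      moreover have "(\<lambda>m. (\<Sum>j<m. y j * \<psi> j x) - (\<Sum>j. y j * \<psi> j x)) \<longlonglongrightarrow> 0"
        using elim by (intro LIM_zero summable_LIMSEQ) auto
      ultimately have "(\<lambda>m. d m x) \<longlonglongrightarrow> 0" by simp
      then have "(\<lambda>m. (norm (d m x *\<^sub>R ?G x))\<^sup>2) \<longlonglongrightarrow> (norm (0 *\<^sub>R ?G x))\<^sup>2" by (intro tendsto_intros)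
      then show ?case by simp
    qed
    show "AE x in M. norm ((norm (d m x *\<^sub>R ?G x))\<^sup>2) \<le> (4 * K)\<^sup>2 * (norm (?G x))\<^sup>2" for m
      using ub[OF yt[of m]] ub[OF y]
    proof eventually_elim
      case (elim x)
      then have "\<bar>d m x\<bar> \<le> 4 * K" by (simp add: d_def)
      then have "(norm (d m x *\<^sub>R ?G x))\<^sup>2 \<le> (4 * K * norm (?G x))\<^sup>2"
        by (intro power_mono) (auto intro: mult_right_mono)
      then show ?case by (simp add: power_mult_distrib)
    qed
  qed measurable
  have l2: "(\<lambda>m. l2_norm M (\<lambda>x. d m x *\<^sub>R ?G x)) \<longlonglongrightarrow> 0"
    using tendsto_real_sqrt[OF lim] by (simp add: l2_norm_def)
  have bound: "grad_norm (u y - u (truncate m y)) \<le> l2_norm M (\<lambda>x. d m x *\<^sub>R ?G x) / r" for m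
  proof (rule energy_bound[OF A_Linf[OF yt] _ r_pos A_lower[OF yt]])
    let ?e = "u y - u (truncate m y)"
    show e: "?e \<in> H10" by (intro V.V_intros(3) u_H10 y yt)
    have s: "(\<lambda>x. d m x *\<^sub>R ?G x) \<in> L2v M" by (rule Linf_scale_L2v[OF dL GL])
    have "bil (A (truncate m y)) (u (truncate m y)) ?e = bil (A y) (u y) ?e"
      using sol[OF y] sol[OF yt] e by (simp add: weak_solution_def bil_def)
    then have "bil (A (truncate m y)) ?e ?e = bil (A (truncate m y)) (u y) ?e - bil (A y) (u y) ?e"
      using bil_left(2)[OF A_Linf[OF yt] e u_H10[OF y] u_H10[OF yt]] by simp
    also have "\<dots> = l2_inner M (\<lambda>x. d m x *\<^sub>R ?G x) (weak_grad D ?e)"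
    proof -
      have "bil (d m) (u y) ?e = 1 * bil (A (truncate m y)) (u y) ?e + (- 1) * bil (A y) (u y) ?e"
        by (intro bil_linear_coeff A_Linf y yt u_H10 e dL AE_I2) (simp add: d_def)
      then show ?thesis by (simp add: bil_def l2_inner_def)
    qed
    also have "\<dots> \<le> l2_norm M (\<lambda>x. d m x *\<^sub>R ?G x) * grad_norm ?e"
      unfolding grad_norm_def using L2.Cauchy_Schwarz[OF s H10_weak_grad[OF e]] by (simp add: abs_le_iff)
    finally show "bil (A (truncate m y)) ?e ?e \<le> l2_norm M (\<lambda>x. d m x *\<^sub>R ?G x) * grad_norm ?e" .
  qed simp
  have "(\<lambda>m. l2_norm M (\<lambda>x. d m x *\<^sub>R ?G x) / r) \<longlonglongrightarrow> 0"
    using tendsto_divide[OF l2 tendsto_const[of r]] r_pos by simp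
  then show ?thesis
    by (rule Lim_null_comparison[rotated]) (use bound in simp)
qed

lemma u_bounded: "\<exists>C\<ge>0. \<forall>y\<in>param_domain. grad_norm (u y) \<le> C"
proof -
  obtain P where P: "P \<ge> 1" "\<And>v. v \<in> H10 \<Longrightarrow> h1_norm v \<le> P * grad_norm v"
    using poincare by blast
  have fL: "f \<in> L2v M" using f by (simp add: L2_space_eq)
  have "grad_norm (u y) \<le> (l2_norm M f * P) / r" if y: "y \<in> param_domain" for y
  proof (rule energy_bound[OF A_Linf[OF y] u_H10[OF y] r_pos A_lower[OF y]])
    note uH = u_H10[OF y]
    have "bil (A y) (u y) (u y) = l2_inner M f (u y)"
      using sol[OF y] uH by (simp add: weak_solution_def bil_def l2_inner_def)
    also have "\<dots> \<le> l2_norm M f * l2_norm M (u y)"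
      using L2.Cauchy_Schwarz[OF fL H1_L2v[OF H10_H1[OF uH]]] by (simp add: abs_le_iff)
    also have "\<dots> \<le> l2_norm M f * (P * grad_norm (u y))"
      using h1_norm_ge(1)[OF H10_H1[OF uH]] P(2)[OF uH] by (intro mult_left_mono) auto
    finally show "bil (A y) (u y) (u y) \<le> (l2_norm M f * P) * grad_norm (u y)" by (simp add: mult.assoc)
  qed (use P(1) in simp)
  moreover have "0 \<le> (l2_norm M f * P) / r" using P(1) r_pos by simp
  ultimately show ?thesis by blast
qed

section \<open>The rate of convergence\<close>

text \<open>
  The truncated Taylor series formed with the solutions of the recursion in place of the
  coefficients chosen in the statement; the two agree in \<open>H\<^sup>1\<^sub>0\<close>.
\<close>

definition truncated :: "(nat \<Rightarrow> nat) set \<Rightarrow> (nat \<Rightarrow> real) \<Rightarrow> real^'k \<Rightarrow> real" where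
  "truncated \<Lambda> y = (\<Sum>\<nu>\<in>\<Lambda>. multi_power y \<nu> *\<^sub>R t \<nu>)"

lemma truncated_H10: "\<Lambda> \<subseteq> multi_indices \<Longrightarrow> truncated \<Lambda> y \<in> H10"
  unfolding truncated_def by (intro V.sum_in_V V.V_intros(4) t_H10) auto

lemma grad_norm_truncated_le:
  assumes "\<Lambda> \<subseteq> multi_indices" "y \<in> param_domain"
  shows "grad_norm (truncated \<Lambda> y) \<le> (\<Sum>\<nu>\<in>\<Lambda>. grad_norm (t \<nu>))"
proof -
  have "grad_norm (truncated \<Lambda> y) \<le> (\<Sum>\<nu>\<in>\<Lambda>. grad_norm (multi_power y \<nu> *\<^sub>R t \<nu>))"
    unfolding truncated_def using assms(1) by (intro V.nrm_sum V.V_intros(4) t_H10) auto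
  also have "\<dots> \<le> (\<Sum>\<nu>\<in>\<Lambda>. grad_norm (t \<nu>))"
  proof (rule sum_mono)
    fix \<nu> assume "\<nu> \<in> \<Lambda>"
    then have "t \<nu> \<in> H10" using assms(1) by (intro t_H10) auto
    then have "grad_norm (multi_power y \<nu> *\<^sub>R t \<nu>) = \<bar>multi_power y \<nu>\<bar> * grad_norm (t \<nu>)" by (rule V.nrm_scale)
    also have "\<dots> \<le> 1 * grad_norm (t \<nu>)"
      by (intro mult_right_mono multi_power_abs_le_1 assms(2) grad_norm_nonneg)
    finally show "grad_norm (multi_power y \<nu> *\<^sub>R t \<nu>) \<le> grad_norm (t \<nu>)" by simp
  qed
  finally show ?thesis .
qed

text \<open>
  The limit is taken in two stages: the number of coordinates is fixed first, so that the
  truncated parameter is close enough, and the degree is chosen afterwards. Both are large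
  enough to cover \<open>\<Lambda>\<close>, so that the Taylor polynomial differs from the truncation by indices
  outside \<open>\<Lambda>\<close> only.
\<close>

lemma truncation_error_le_tail:
  assumes y: "y \<in> param_domain" and \<Lambda>: "finite \<Lambda>" "\<Lambda> \<subseteq> multi_indices"
    and Z: "\<And>G. \<lbrakk>finite G; G \<subseteq> multi_indices\<rbrakk> \<Longrightarrow> (\<Sum>\<nu>\<in>G. (inverse (multi_power \<rho> \<nu>))\<^sup>2) \<le> Z"
    and S: "\<And>G. \<lbrakk>finite G; G \<subseteq> multi_indices - \<Lambda>\<rbrakk> \<Longrightarrow> (\<Sum>\<nu>\<in>G. grad_norm (t \<nu>)) \<le> S"
  shows "grad_norm (u y - truncated \<Lambda> y) \<le> S"
proof (rule field_le_epsilon)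
  fix e :: real assume "e > 0"
  obtain m0 N0 where cover: "\<forall>m'\<ge>m0. \<forall>N'\<ge>N0. \<Lambda> \<subseteq> (\<Union>k\<le>N'. level_set m' k)"
    using finite_multi_indices_bounded[OF \<Lambda>] by (elim exE)
  obtain m1 where m1: "\<forall>m\<ge>m1. norm (grad_norm (u y - u (truncate m y)) - 0) < e / 2"
    using LIMSEQ_D[OF truncation_converges[OF y], where r = "e / 2"] \<open>e > 0\<close> by auto
  define m where "m = max m0 m1"
  define z where "z = truncate m y"
  have z: "z \<in> param_domain" unfolding z_def by (rule truncate_param[OF y])
  have zs: "z j = 0" if "j \<ge> m" for j using that by (simp add: z_def truncate_def)
  have conv: "(\<lambda>N. grad_norm (u z - partial_sum m N z)) \<longlonglongrightarrow> 0"
    by (rule partial_sum_converges[OF z]) (fact zs, fact Z)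
  obtain N1 where N1: "\<forall>N\<ge>N1. norm (grad_norm (u z - partial_sum m N z) - 0) < e / 2"
    using LIMSEQ_D[OF conv, where r = "e / 2"] \<open>e > 0\<close> by auto
  define N where "N = max N0 N1"
  let ?F = "\<Union>k\<le>N. level_set m k"
  have F: "finite ?F" "?F \<subseteq> multi_indices" "\<Lambda> \<subseteq> ?F"
    using cover by (auto simp: finite_level_set m_def N_def intro: level_set_multi)
  have mono: "multi_power z \<nu> = multi_power y \<nu>" if "\<nu> \<in> ?F" for \<nu>
  proof -
    have "{j. \<nu> j \<noteq> 0} \<subseteq> {..<m}" using that level_set_supp by blast
    then show ?thesis unfolding multi_power_def z_def truncate_def by (intro prod.cong) auto
  qed
  have ps: "partial_sum m N z = truncated ?F z"
    by (simp add: partial_sum_def truncated_def sum_levels)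
  have "truncated ?F z = truncated (?F - \<Lambda>) z + truncated \<Lambda> z"
    unfolding truncated_def using F by (intro sum.subset_diff) auto
  also have "truncated \<Lambda> z = truncated \<Lambda> y"
    unfolding truncated_def by (intro sum.cong refl) (simp only: mono[OF subsetD[OF F(3)]])
  finally have split: "truncated ?F z - truncated \<Lambda> y = truncated (?F - \<Lambda>) z" by (simp add: fun_eq_iff)
  have H: "u y \<in> H10" "u z \<in> H10" "truncated ?F z \<in> H10" "truncated \<Lambda> y \<in> H10"
    using F \<Lambda> y z by (auto intro!: u_H10 truncated_H10)
  have "grad_norm (u y - truncated \<Lambda> y) \<le> grad_norm (u y - u z) + grad_norm (u z - truncated \<Lambda> y)"
    by (rule V.nrm_triangle3) (rule H)+
  moreover have "grad_norm (u z - truncated \<Lambda> y) \<le> grad_norm (u z - truncated ?F z) + grad_norm (truncated ?F z - truncated \<Lambda> y)"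
    by (rule V.nrm_triangle3) (rule H)+
  moreover have "grad_norm (truncated ?F z - truncated \<Lambda> y) \<le> (\<Sum>\<nu>\<in>?F - \<Lambda>. grad_norm (t \<nu>))"
    unfolding split using F(2) z by (intro grad_norm_truncated_le) auto
  moreover have "(\<Sum>\<nu>\<in>?F - \<Lambda>. grad_norm (t \<nu>)) \<le> S" using F by (intro S) auto
  moreover have "grad_norm (u y - u z) < e / 2" using m1 by (simp add: z_def m_def)
  moreover have "grad_norm (u z - partial_sum m N z) < e / 2" using N1[rule_format, of N] by (simp add: N_def)
  ultimately show "grad_norm (u y - truncated \<Lambda> y) \<le> S + e" unfolding ps by linarith
qed

lemma taylor_truncation_error:
  assumes P: "\<And>v. v \<in> H10 \<Longrightarrow> h1_norm v \<le> P * grad_norm v" "P \<ge> 0"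
    and \<Lambda>: "\<Lambda> \<subseteq> multi_indices" "finite \<Lambda>"
    and err: "\<And>y. y \<in> param_domain \<Longrightarrow> grad_norm (u y - truncated \<Lambda> y) \<le> E"
  shows "sup_H1_norm D (\<lambda>y x. u y x - taylor_truncation D u \<Lambda> y x) \<le> ennreal (P * E)"
  unfolding sup_H1_norm_def
proof (rule SUP_least)
  fix y assume y: "y \<in> param_domain"
  define W where "W = (\<Sum>\<nu>\<in>\<Lambda>. multi_power y \<nu> *\<^sub>R taylor_coeff D u \<nu>)"
  have sum_apply: "sum g \<Lambda> x = (\<Sum>\<nu>\<in>\<Lambda>. g \<nu> x)" for g :: "(nat \<Rightarrow> nat) \<Rightarrow> real^'k \<Rightarrow> real" and x
    using \<Lambda>(2) by (induction \<Lambda> rule: finite_induct) auto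
  have Weq: "(\<lambda>x. u y x - taylor_truncation D u \<Lambda> y x) = u y - W"
    by (simp add: fun_eq_iff W_def taylor_truncation_def sum_apply scaleR_fun mult.commute)
  have WH: "W \<in> H10"
    unfolding W_def using \<Lambda> by (intro V.sum_in_V V.V_intros(4) taylor_coeff_eq(1)) auto
  note uH = u_H10[OF y] and tH = truncated_H10[OF \<Lambda>(1), of y]
  have diff: "truncated \<Lambda> y - W = (\<Sum>\<nu>\<in>\<Lambda>. multi_power y \<nu> *\<^sub>R (t \<nu> - taylor_coeff D u \<nu>))"
    by (simp add: truncated_def W_def sum_subtractf scaleR_diff_right)
  have "grad_norm (truncated \<Lambda> y - W) \<le> (\<Sum>\<nu>\<in>\<Lambda>. grad_norm (multi_power y \<nu> *\<^sub>R (t \<nu> - taylor_coeff D u \<nu>)))"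
    unfolding diff using \<Lambda> by (intro V.nrm_sum V.V_intros(3) V.V_intros(4) t_H10 taylor_coeff_eq(1)) auto
  also have "\<dots> = 0"
  proof (rule sum.neutral, rule ballI)
    fix \<nu> assume "\<nu> \<in> \<Lambda>"
    then have \<nu>: "\<nu> \<in> multi_indices" using \<Lambda> by auto
    note h = t_H10[OF \<nu>] taylor_coeff_eq(1)[OF \<nu>]
    show "grad_norm (multi_power y \<nu> *\<^sub>R (t \<nu> - taylor_coeff D u \<nu>)) = 0"
      using V.nrm_scale[OF V.V_intros(3)[OF h]] V.nrm_minus_commute[OF h] taylor_coeff_eq(2)[OF \<nu>] by simp
  qed
  finally have null: "grad_norm (truncated \<Lambda> y - W) \<le> 0" .
  have "grad_norm (u y - W) \<le> grad_norm (u y - truncated \<Lambda> y) + grad_norm (truncated \<Lambda> y - W)"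
    by (rule V.nrm_triangle3[OF uH tH WH])
  then have "grad_norm (u y - W) \<le> E" using err[OF y] null by linarith
  then have "P * grad_norm (u y - W) \<le> P * E" using P(2) by (intro mult_left_mono)
  then have "h1_norm (u y - W) \<le> P * E" using P(1)[OF V.V_intros(3)[OF uH WH]] by linarith
  then show "H1_norm D (\<lambda>x. u y x - taylor_truncation D u \<Lambda> y x) \<le> ennreal (P * E)"
    unfolding Weq H1_norm_eq[OF H10_H1[OF V.V_intros(3)[OF uH WH]]] by (rule ennreal_leI)
qed

text \<open>
  The case \<open>q \<le> 2\<close> uses the tail of the series, the case \<open>q > 2\<close> the triangle inequality and
  the growth of sums over \<open>\<Lambda>\<close>; in the latter the bound is at least a positive constant and
  absorbs the norm of the solution.
\<close>

lemma convergence_rate: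
  assumes q: "0 < q" and lq: "summable (\<lambda>j. inverse (\<rho> j) powr q)"
  shows "\<exists>C. \<forall>n\<ge>1. \<forall>\<Lambda>.
           n_largest (multi_power (\<lambda>j. inverse (\<rho> j))) n \<Lambda> \<longrightarrow>
           sup_H1_norm D (\<lambda>y x. u y x - taylor_truncation D u \<Lambda> y x)
             \<le> ennreal (C * real n powr - (1 / q - 1 / 2))"
proof -
  define \<kappa> where "\<kappa> = multi_power (\<lambda>j. inverse (\<rho> j))"
  have inv_pos: "0 < inverse (\<rho> j)" for j using rho_pos'[of j] by simp
  have inv1: "inverse (\<rho> j) < 1" for j using rho_gt_1[of j] by (simp add: inverse_less_1_iff)
  have \<kappa>_eq: "\<kappa> \<nu> = inverse (multi_power \<rho> \<nu>)" for \<nu> by (simp add: \<kappa>_def multi_power_inverse)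
  have \<kappa>_pos: "0 < \<kappa> \<nu>" for \<nu> unfolding \<kappa>_def by (rule multi_power_pos[OF inv_pos])
  have b1: "inverse (\<rho> j) powr q < 1" for j
    using powr_less_mono2[OF q _ inv1[of j]] inv_pos[of j] by simp
  have b0: "0 < inverse (\<rho> j) powr q" for j using inv_pos[of j] by simp
  obtain Z where Z: "Z > 0" "\<And>G. \<lbrakk>finite G; G \<subseteq> multi_indices\<rbrakk> \<Longrightarrow> (\<Sum>\<nu>\<in>G. \<kappa> \<nu> powr q) \<le> Z"
  proof -
    obtain Z where "Z > 0" "\<forall>G. finite G \<longrightarrow> G \<subseteq> multi_indices \<longrightarrow> (\<Sum>\<nu>\<in>G. multi_power (\<lambda>j. inverse (\<rho> j) powr q) \<nu>) \<le> Z"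
      using sum_multi_power_bounded[OF b0 b1 lq] by (elim exE conjE)
    then show thesis using that[of Z] by (simp add: \<kappa>_def multi_power_powr[OF inv_pos])
  qed
  obtain P where P: "P \<ge> 1" "\<And>v. v \<in> H10 \<Longrightarrow> h1_norm v \<le> P * grad_norm v"
    using poincare by blast
  obtain B where B0: "B \<ge> 0" "\<forall>G. finite G \<longrightarrow> G \<subseteq> multi_indices \<longrightarrow> (\<Sum>\<nu>\<in>G. (weighted_norm \<nu>)\<^sup>2) \<le> B"
    using weighted_l2_summable by (elim exE conjE)
  then have B: "B \<ge> 0" "\<And>G. \<lbrakk>finite G; G \<subseteq> multi_indices\<rbrakk> \<Longrightarrow> (\<Sum>\<nu>\<in>G. (weighted_norm \<nu>)\<^sup>2) \<le> B"
    by blast+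
  obtain Cu where Cu: "Cu \<ge> 0" "\<forall>y\<in>param_domain. grad_norm (u y) \<le> Cu" using u_bounded by blast
  have sumt: "(\<Sum>\<nu>\<in>G. grad_norm (t \<nu>)) \<le> sqrt B * sqrt (\<Sum>\<nu>\<in>G. (\<kappa> \<nu>)\<^sup>2)" if "finite G" "G \<subseteq> multi_indices" for G
    unfolding \<kappa>_eq by (intro sum_grad_norm_le B(2) that)
  define C where "C = Cu + sqrt B * sqrt (1 + Z) + sqrt B * Z powr (1 / q)"
  have err: "grad_norm (u y - truncated \<Lambda> y) \<le> C * real n powr - (1 / q - 1 / 2)"
    if y: "y \<in> param_domain" and n: "n \<ge> 1" and \<Lambda>: "n_largest \<kappa> n \<Lambda>" for y n \<Lambda>
  proof -
    have L: "\<Lambda> \<subseteq> multi_indices" "finite \<Lambda>" "card \<Lambda> = n" "\<And>\<nu> \<mu>. \<lbrakk>\<nu> \<in> \<Lambda>; \<mu> \<in> multi_indices - \<Lambda>\<rbrakk> \<Longrightarrow> \<kappa> \<mu> \<le> \<kappa> \<nu>"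
      using \<Lambda> by (auto simp: n_largest_def)
    let ?R = "real n powr - (1 / q - 1 / 2)"
    show ?thesis
    proof (cases "q \<le> 2")
      case True
      have \<kappa>1: "\<kappa> \<nu> \<le> 1" for \<nu>
        unfolding \<kappa>_def multi_power_def
        by (intro prod_le_1 conjI zero_le_power power_le_one less_imp_le[OF inv_pos] less_imp_le[OF inv1])
      have Z2: "(\<Sum>\<nu>\<in>G. (inverse (multi_power \<rho> \<nu>))\<^sup>2) \<le> Z" if "finite G" "G \<subseteq> multi_indices" for G
      proof -
        have "(\<Sum>\<nu>\<in>G. (\<kappa> \<nu>)\<^sup>2) \<le> (\<Sum>\<nu>\<in>G. \<kappa> \<nu> powr q)"
        proof (rule sum_mono)
          fix \<nu>
          have "(\<kappa> \<nu>)\<^sup>2 = \<kappa> \<nu> powr 2" using \<kappa>_pos[of \<nu>] by simp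
          also have "\<dots> \<le> \<kappa> \<nu> powr q" using \<kappa>_pos[of \<nu>] \<kappa>1[of \<nu>] True by (intro powr_mono') auto
          finally show "(\<kappa> \<nu>)\<^sup>2 \<le> \<kappa> \<nu> powr q" .
        qed
        then show ?thesis using Z(2)[OF that] by (simp add: \<kappa>_eq)
      qed
      have "grad_norm (u y - truncated \<Lambda> y) \<le> sqrt B * (Z powr (1 / q) * ?R)"
      proof (rule truncation_error_le_tail[OF y L(2,1)])
        show "(\<Sum>\<nu>\<in>G. (inverse (multi_power \<rho> \<nu>))\<^sup>2) \<le> Z" if "finite G" "G \<subseteq> multi_indices" for G
          by (rule Z2[OF that])
        fix G assume G: "finite G" "G \<subseteq> multi_indices - \<Lambda>"
        have "(\<Sum>\<nu>\<in>G. grad_norm (t \<nu>)) \<le> sqrt B * sqrt (\<Sum>\<nu>\<in>G. (\<kappa> \<nu>)\<^sup>2)"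
          using G by (intro sumt) auto
        also have "\<dots> \<le> sqrt B * (Z powr (1 / q) * ?R)"
        proof (rule mult_left_mono)
          show "sqrt (\<Sum>\<nu>\<in>G. (\<kappa> \<nu>)\<^sup>2) \<le> Z powr (1 / q) * ?R"
            by (rule stechkin[where I = multi_indices and \<Lambda> = \<Lambda>])
               (fact q True \<kappa>_pos Z(2) L n G)+
        qed (use B(1) in simp)
        finally show "(\<Sum>\<nu>\<in>G. grad_norm (t \<nu>)) \<le> sqrt B * (Z powr (1 / q) * ?R)" .
      qed
      also have "\<dots> \<le> C * ?R"
        unfolding C_def mult.assoc[symmetric] using Cu(1) B(1) Z(1) by (intro mult_right_mono) auto
      finally show ?thesis .
    next
      case False
      then have q2: "2 \<le> q" by simp
      have "0 \<le> - (1 / q - 1 / 2)" using q2 q by (simp add: field_simps)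
      then have R1: "1 \<le> ?R" using n by (intro ge_one_powr_ge_zero) auto
      have "grad_norm (u y - truncated \<Lambda> y) \<le> grad_norm (u y) + grad_norm (truncated \<Lambda> y)"
        by (intro V.nrm_triangle_diff u_H10 truncated_H10 y L)
      also have "\<dots> \<le> Cu + (\<Sum>\<nu>\<in>\<Lambda>. grad_norm (t \<nu>))"
        using Cu y L by (intro add_mono grad_norm_truncated_le) auto
      also have "\<dots> \<le> Cu + sqrt B * sqrt (\<Sum>\<nu>\<in>\<Lambda>. (\<kappa> \<nu>)\<^sup>2)"
        by (intro add_left_mono sumt L)
      also have "\<dots> \<le> Cu * ?R + sqrt B * (sqrt (1 + Z) * ?R)"
        using mult_left_mono[OF R1 Cu(1)] B(1)
        by (intro add_mono mult_left_mono l2_le_lq_growth[OF q2 \<kappa>_pos Z(2)[OF L(2,1)] L(2,3) n]) auto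
      also have "\<dots> \<le> C * ?R"
        unfolding C_def distrib_right using B(1) by simp
      finally show ?thesis .
    qed
  qed
  show ?thesis
  proof (intro exI[of _ "P * C"] allI impI)
    fix n \<Lambda> assume n: "1 \<le> n" and \<Lambda>: "n_largest (multi_power (\<lambda>j. inverse (\<rho> j))) n \<Lambda>"
    have L: "\<Lambda> \<subseteq> multi_indices" "finite \<Lambda>" using \<Lambda> by (auto simp: n_largest_def)
    have "sup_H1_norm D (\<lambda>y x. u y x - taylor_truncation D u \<Lambda> y x) \<le> ennreal (P * (C * real n powr - (1 / q - 1 / 2)))"
      using P(1) by (intro taylor_truncation_error P(2) L err n \<Lambda>[folded \<kappa>_def]) auto
    then show "sup_H1_norm D (\<lambda>y x. u y x - taylor_truncation D u \<Lambda> y x) \<le> ennreal (P * C * real n powr - (1 / q - 1 / 2))"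
      by (simp only: mult.assoc)
  qed
qed

end

theorem theorem2p4:
  fixes D :: "(real^'k) set"
    and f abar :: "real^'k \<Rightarrow> real"
    and \<psi> :: "nat \<Rightarrow> real^'k \<Rightarrow> real"
    and u :: "(nat \<Rightarrow> real) \<Rightarrow> real^'k \<Rightarrow> real"
    and \<rho> :: "nat \<Rightarrow> real"
    and r q :: real
  assumes dim: "CARD('k) \<in> {1, 2, 3}"
    and dom: "bounded_lipschitz_domain D"
    and f: "f \<in> L2_space D"
    and abar: "abar \<in> Linf_space D"
    and psi: "\<And>j. \<psi> j \<in> Linf_space D"
    and sol: "\<And>y. y \<in> param_domain \<Longrightarrow> weak_solution D (affine_coeff abar \<psi> y) f (u y)"
    and r_pos: "r > 0"
    and weights: "AE x in lebesgue_on D.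
           summable (\<lambda>j. \<rho> j * \<bar>\<psi> j x\<bar>) \<and> (\<Sum>j. \<rho> j * \<bar>\<psi> j x\<bar>) \<le> abar x - r"
    and q_pos: "0 < q"
    and rho_lq: "summable (\<lambda>j. inverse (\<rho> j) powr q)"
    and rho_pos: "\<And>j. \<rho> j > 0"
    and rho_gt_1: "\<And>j. \<rho> j > 1"
  shows "\<exists>C. \<forall>n\<ge>1. \<forall>\<Lambda>.
           downward_closed \<Lambda> \<and> n_largest (multi_power (\<lambda>j. inverse (\<rho> j))) n \<Lambda> \<longrightarrow>
           sup_H1_norm D (\<lambda>y x. u y x - taylor_truncation D u \<Lambda> y x)
             \<le> ennreal (C * real n powr - (1 / q - 1 / 2))"
proof -
  interpret elliptic_family D f abar \<psi> u \<rho> r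
    using dom f abar psi sol r_pos weights rho_gt_1
    by unfold_locales (auto simp: bounded_lipschitz_domain_def)
  show ?thesis using convergence_rate[OF q_pos rho_lq] by blast
qed

end
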